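(* Let $(\mathcal Q,\Delta)$ be a compact quantum group and let $\alpha:C(S^1)\to C(S^1)\otimes\mathcal Q$ be a faithful, smooth action of $(\mathcal Q,\Delta)$ on $C(S^1)$ which is linear, i.e. $\alpha(z)=z\otimes A+\overline z\otimes B$ for some $A,B\in\mathcal Q$. Then $\mathcal Q$ is a commutative $C^*$-algebra.
   Context: $\otimes$ between $C^*$-algebras is the minimal tensor product. A compact quantum group is a unital $C^*$-algebra $\mathcal Q$ with a coproduct $\Delta:\mathcal Q\to\mathcal Q\otimes\mathcal Q$ in the sense of Woronowicz. An action of $(\mathcal Q,\Delta)$ on a unital $C^*$-algebra $\mathcal A$ is a unital $*$-homomorphism $\alpha:\mathcal A\to\mathcal A\otimes\mathcal Q$ with $(\alpha\otimes\mathrm{id})\alpha=(\mathrm{id}\otimes\Delta)\alpha$ and such that the linear span of $\alpha(\mathcal A)(1\otimes\mathcal Q)$ is norm-dense in $\mathcal A\otimes\mathcal Q$. The action is faithful if there is no proper unital $C^*$-subalgebra $\mathcal Q_1\subset\mathcal Q$, to which $\Delta$ restricts as a compact quantum group structure, such that $\alpha$ is an action of $\mathcal Q_1$; here this means that $\mathcal Q$ is generated as a unital $C^*$-algebra by $A$ and $B$. $z\in C(S^1)$ is the identity function on the unit circle and $\overline z$ its conjugate. An action on $C(S^1)$ is smooth if for every state $\phi$ on $\mathcal Q$, $(\mathrm{id}\otimes\phi)\circ\alpha$ maps $\mathrm{span}\{z^n:n\in\mathbb Z\}$ (the span of the eigenvectors of the standard Laplacian $z^n\mapsto -n^2z^n$)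 into itself; in particular $A$ and $B$ belong to the dense $*$-subalgebra of $\mathcal Q$ spanned by matrix coefficients of irreducible unitary representations. *)

theory Defs
  imports "HOL-Analysis.Analysis"
begin

section \<open>Unital C*-algebras\<close>

text \<open>
  The real scalar multiplication of the library classes is the restriction of the complex one.
  As in \<^class>\<open>real_normed_algebra_1\<close>, the unit has norm 1, so the zero algebra is excluded.
\<close>

class cstar_algebra = real_normed_algebra_1 + banach +
  fixes scaleC :: "complex \<Rightarrow> 'a \<Rightarrow> 'a" (infixr "*\<^sub>C" 75)
    and star :: "'a \<Rightarrow> 'a"
  assumes scaleC_add_right: "c *\<^sub>C (x + y) = c *\<^sub>C x + c *\<^sub>C y"
    and scaleC_add_left: "(c + d) *\<^sub>C x = c *\<^sub>C x + d *\<^sub>C x"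
    and scaleC_scaleC: "c *\<^sub>C (d *\<^sub>C x) = (c * d) *\<^sub>C x"
    and scaleC_of_real: "complex_of_real r *\<^sub>C x = r *\<^sub>R x"
    and scaleC_mult_left: "(c *\<^sub>C x) * y = c *\<^sub>C (x * y)"
    and scaleC_mult_right: "x * (c *\<^sub>C y) = c *\<^sub>C (x * y)"
    and norm_scaleC: "norm (c *\<^sub>C x) = cmod c * norm x"
    and star_add: "star (x + y) = star x + star y"
    and star_scaleC: "star (c *\<^sub>C x) = cnj c *\<^sub>C star x"
    and star_mult: "star (x * y) = star y * star x"
    and star_star: "star (star x) = x"
    and norm_star_mult_self: "norm (star x * x) = (norm x)\<^sup>2"

definition cspan :: "'a::cstar_algebra set \<Rightarrow> 'a set" where
  "cspan = module.span scaleC"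

definition clinear_map :: "('a::cstar_algebra \<Rightarrow> 'b::cstar_algebra) \<Rightarrow> bool" where
  "clinear_map f \<longleftrightarrow> (\<forall>x y. f (x + y) = f x + f y) \<and> (\<forall>c x. f (c *\<^sub>C x) = c *\<^sub>C f x)"

definition unital_star_hom :: "('a::cstar_algebra \<Rightarrow> 'b::cstar_algebra) \<Rightarrow> bool" where
  "unital_star_hom f \<longleftrightarrow> clinear_map f \<and> (\<forall>x y. f (x * y) = f x * f y) \<and>
     (\<forall>x. f (star x) = star (f x)) \<and> f 1 = 1"

definition unital_cstar_subalgebra :: "'a::cstar_algebra set \<Rightarrow> bool" where
  "unital_cstar_subalgebra S \<longleftrightarrow> closed S \<and> 1 \<in> S \<and> (\<forall>x\<in>S. \<forall>y\<in>S. x + y \<in> S \<and> x * y \<in> S) \<and>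
     (\<forall>c. \<forall>x\<in>S. c *\<^sub>C x \<in> S) \<and> (\<forall>x\<in>S. star x \<in> S)"

instantiation complex :: cstar_algebra
begin

definition scaleC_complex :: "complex \<Rightarrow> complex \<Rightarrow> complex" where
  "scaleC_complex c x = c * x"

definition star_complex :: "complex \<Rightarrow> complex" where
  "star_complex = cnj"

instance
  by standard
    (simp_all add: scaleC_complex_def star_complex_def algebra_simps scaleR_conv_of_real
      norm_mult power2_eq_square)

end

definition state :: "('a::cstar_algebra \<Rightarrow> complex) \<Rightarrow> bool" where
  "state \<phi> \<longleftrightarrow> clinear_map \<phi> \<and> (\<forall>x. \<phi> (star x * x) \<in> \<real> \<and> 0 \<le> Re (\<phi> (star x * x))) \<and> \<phi> 1 = 1"


section \<open>The C*-algebra of bounded continuous functions\<close>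

instantiation bcontfun :: (topological_space, real_normed_algebra_1) real_normed_algebra_1
begin

definition one_bcontfun :: "('a, 'b) bcontfun" where
  "one_bcontfun = const_bcontfun 1"

definition times_bcontfun :: "('a, 'b) bcontfun \<Rightarrow> ('a, 'b) bcontfun \<Rightarrow> ('a, 'b) bcontfun" where
  "times_bcontfun f g = Bcontfun (\<lambda>x. apply_bcontfun f x * apply_bcontfun g x)"

lemma apply_times_bcontfun [simp]:
  "apply_bcontfun (f * g) x = apply_bcontfun f x * apply_bcontfun g x"
    for f g :: "('a, 'b) bcontfun"
proof -
  have "(\<lambda>x. apply_bcontfun f x * apply_bcontfun g x) \<in> bcontfun"
    by (rule bcontfun_normI[where b = "norm f * norm g"])
      (auto intro!: continuous_intros order_trans[OF norm_mult_ineq] mult_mono norm_bounded)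
  then show ?thesis
    by (simp add: times_bcontfun_def Bcontfun_inverse)
qed

lemma apply_one_bcontfun [simp]: "apply_bcontfun (1 :: ('a, 'b) bcontfun) x = 1"
  by (simp add: one_bcontfun_def)

instance
proof
  fix f g h :: "('a, 'b) bcontfun" and r :: real
  show "norm (f * g) \<le> norm f * norm g"
    by (rule norm_bound)
      (auto intro!: order_trans[OF norm_mult_ineq] mult_mono norm_bounded)
  show "norm (1 :: ('a, 'b) bcontfun) = 1"
    by (rule antisym, rule norm_bound, simp)
      (metis apply_one_bcontfun norm_bounded norm_one)
  show "(0 :: ('a, 'b) bcontfun) \<noteq> 1"
    by (metis apply_one_bcontfun zero_bcontfun.rep_eq zero_neq_one)
qed (auto intro!: bcontfun_eqI simp: algebra_simps)

end

instantiation bcontfun :: (metric_space, cstar_algebra) cstar_algebra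
begin

definition scaleC_bcontfun :: "complex \<Rightarrow> ('a, 'b) bcontfun \<Rightarrow> ('a, 'b) bcontfun" where
  "scaleC_bcontfun c f = const_bcontfun (c *\<^sub>C 1) * f"

definition star_bcontfun :: "('a, 'b) bcontfun \<Rightarrow> ('a, 'b) bcontfun" where
  "star_bcontfun f = Bcontfun (\<lambda>x. star (apply_bcontfun f x))"

lemma apply_scaleC_bcontfun [simp]: "apply_bcontfun (c *\<^sub>C f) x = c *\<^sub>C apply_bcontfun f x"
  for f :: "('a, 'b) bcontfun"
  by (simp add: scaleC_bcontfun_def scaleC_mult_left)

lemma norm_star_le: "norm (x :: 'b) \<le> norm (star x)"
proof (cases "x = 0")
  case False
  have "norm x * norm x \<le> norm (star x) * norm x"
    by (metis norm_star_mult_self norm_mult_ineq power2_eq_square)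
  with False show ?thesis by simp
qed simp

lemma norm_star: "norm (star x :: 'b) = norm x"
  by (metis norm_star_le antisym star_star)

lemma star_diff: "star (x - y :: 'b) = star x - star y"
  by (metis add_diff_cancel diff_add_cancel star_add)

lemma apply_star_bcontfun [simp]: "apply_bcontfun (star f) x = star (apply_bcontfun f x)"
  for f :: "('a, 'b) bcontfun"
proof -
  have "continuous_on UNIV (star :: 'b \<Rightarrow> 'b)"
    unfolding continuous_on_iff dist_norm by (metis star_diff norm_star)
  then have "continuous_on UNIV (\<lambda>x. star (apply_bcontfun f x))"
    by (rule continuous_on_compose2) auto
  then have "(\<lambda>x. star (apply_bcontfun f x)) \<in> bcontfun"
    by (rule bcontfun_normI[where b = "norm f"]) (simp add: norm_star norm_bounded)
  then show ?thesis
    by (simp add: star_bcontfun_def Bcontfun_inverse)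
qed

instance
proof
  fix f g :: "('a, 'b) bcontfun" and c d :: complex and r :: real
  show "norm (c *\<^sub>C f) = cmod c * norm f"
  proof (cases "c = 0")
    case True
    have "norm (c *\<^sub>C f) \<le> 0"
      by (rule norm_bound) (simp add: True norm_scaleC)
    with True show ?thesis by simp
  next
    case False
    have *: "norm (e *\<^sub>C h) \<le> cmod e * norm h" for e and h :: "('a, 'b) bcontfun"
      by (rule norm_bound) (simp add: norm_scaleC mult_left_mono norm_bounded)
    have "inverse c *\<^sub>C (c *\<^sub>C f) = f"
      using False scaleC_of_real[of 1] by (intro bcontfun_eqI) (simp add: scaleC_scaleC)
    with *[of "inverse c" "c *\<^sub>C f"] have "norm f \<le> inverse (cmod c) * norm (c *\<^sub>C f)"
      by (simp add: norm_inverse)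
    then have "cmod c * norm f \<le> norm (c *\<^sub>C f)"
      using False by (simp add: field_simps)
    with *[of c f] show ?thesis by simp
  qed
  show "norm (star f * f) = (norm f)\<^sup>2"
  proof (rule antisym)
    show "norm (star f * f) \<le> (norm f)\<^sup>2"
      by (rule norm_bound) (simp add: norm_star_mult_self power_mono norm_bounded)
    have "norm f \<le> sqrt (norm (star f * f))"
    proof (rule norm_bound)
      fix x
      have "(norm (apply_bcontfun f x))\<^sup>2 \<le> norm (star f * f)"
        using norm_bounded[of "star f * f" x] by (simp add: norm_star_mult_self)
      then show "norm (apply_bcontfun f x) \<le> sqrt (norm (star f * f))"
        by (rule real_le_rsqrt)
    qed
    then show "(norm f)\<^sup>2 \<le> norm (star f * f)"
      by (metis norm_ge_zero real_sqrt_pow2 power_mono)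
  qed
qed (auto intro!: bcontfun_eqI simp: scaleC_add_right scaleC_add_left scaleC_scaleC
    scaleC_of_real scaleC_mult_left scaleC_mult_right star_add star_scaleC star_mult star_star)

end


section \<open>The circle\<close>

typedef circle = "sphere (0::complex) 1" morphisms of_circle to_circle
  by (rule exI[of _ 1]) simp

instantiation circle :: metric_space
begin

definition dist_circle :: "circle \<Rightarrow> circle \<Rightarrow> real" where
  "dist_circle w v = dist (of_circle w) (of_circle v)"

definition uniformity_circle :: "(circle \<times> circle) filter" where
  "uniformity_circle = (INF e\<in>{0<..}. principal {(w, v). dist w v < e})"

definition open_circle :: "circle set \<Rightarrow> bool" where
  "open_circle U = (\<forall>w\<in>U. \<forall>\<^sub>F (w', v) in uniformity. w' = w \<longrightarrow> v \<in> U)"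

instance
  by standard
    (auto simp: dist_circle_def of_circle_inject dist_triangle2 uniformity_circle_def
      open_circle_def)

end

text \<open>
  Since the circle is compact, \<^typ>\<open>circle \<Rightarrow>\<^sub>C complex\<close> consists of all continuous functions on it.
\<close>

definition circle_power :: "int \<Rightarrow> (circle \<Rightarrow>\<^sub>C complex)" where
  "circle_power n = Bcontfun (\<lambda>w. of_circle w powi n)"

definition circle_z :: "circle \<Rightarrow>\<^sub>C complex" where
  "circle_z = Bcontfun of_circle"

lemma norm_of_circle [simp]: "cmod (of_circle w) = 1"
  using of_circle[of w] by simp

lemma continuous_of_circle: "continuous_on UNIV of_circle"
  unfolding continuous_on_iff dist_circle_def by auto

lemma apply_circle_z: "apply_bcontfun circle_z w = of_circle w"
proof -
  have "of_circle \<in> bcontfun"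
    by (rule bcontfun_normI[where b = 1]) (simp_all add: continuous_of_circle)
  then show ?thesis
    by (simp add: circle_z_def Bcontfun_inverse)
qed

lemma apply_circle_power: "apply_bcontfun (circle_power n) w = of_circle w powi n"
proof -
  have nz: "of_circle v \<noteq> 0" for v
    by (metis norm_of_circle norm_zero zero_neq_one)
  have "continuous_on UNIV (\<lambda>v. of_circle v powi n)"
    using nz by (intro continuous_intros continuous_of_circle) auto
  then have "(\<lambda>v. of_circle v powi n) \<in> bcontfun"
    by (rule bcontfun_normI[where b = 1]) (simp add: norm_power_int)
  then show ?thesis
    by (simp add: circle_power_def Bcontfun_inverse)
qed


section \<open>The minimal tensor product\<close>

definition ell2 :: "('i \<Rightarrow> complex) set" where
  "ell2 = {\<xi>. (\<lambda>i. (cmod (\<xi> i))\<^sup>2) summable_on UNIV}"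

definition ell2_inner :: "('i \<Rightarrow> complex) \<Rightarrow> ('i \<Rightarrow> complex) \<Rightarrow> complex" where
  "ell2_inner \<xi> \<eta> = (\<Sum>\<^sub>\<infinity>i. \<xi> i * cnj (\<eta> i))"

definition ell2_norm :: "('i \<Rightarrow> complex) \<Rightarrow> real" where
  "ell2_norm \<xi> = sqrt (\<Sum>\<^sub>\<infinity>i. (cmod (\<xi> i))\<^sup>2)"

text \<open>Operators are only considered on \<^const>\<open>ell2\<close>; their values elsewhere are irrelevant.\<close>

definition bounded_op :: "(('i \<Rightarrow> complex) \<Rightarrow> ('i \<Rightarrow> complex)) \<Rightarrow> bool" where
  "bounded_op T \<longleftrightarrow> (\<forall>\<xi>\<in>ell2. T \<xi> \<in> ell2) \<and>
     (\<forall>\<xi>\<in>ell2. \<forall>\<eta>\<in>ell2. T (\<lambda>i. \<xi> i + \<eta> i) = (\<lambda>i. T \<xi> i + T \<eta> i)) \<and>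
     (\<forall>c. \<forall>\<xi>\<in>ell2. T (\<lambda>i. c * \<xi> i) = (\<lambda>i. c * T \<xi> i)) \<and>
     (\<exists>K. \<forall>\<xi>\<in>ell2. ell2_norm (T \<xi>) \<le> K * ell2_norm \<xi>)"

definition op_norm :: "(('i \<Rightarrow> complex) \<Rightarrow> ('i \<Rightarrow> complex)) \<Rightarrow> real" where
  "op_norm T = Sup {ell2_norm (T \<xi>) | \<xi>. \<xi> \<in> ell2 \<and> ell2_norm \<xi> \<le> 1}"

text \<open>
  Unital *-representations on \<open>\<ell>\<^sup>2(I)\<close> that are faithful. Faithfulness is expressed by isometry,
  which for *-homomorphisms of C*-algebras is automatic from injectivity.
\<close>

definition faithful_rep ::
    "('a::cstar_algebra \<Rightarrow> ('i \<Rightarrow> complex) \<Rightarrow> ('i \<Rightarrow> complex)) \<Rightarrow> bool" where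
  "faithful_rep \<pi> \<longleftrightarrow> (\<forall>a. bounded_op (\<pi> a)) \<and>
     (\<forall>a b. \<forall>\<xi>\<in>ell2. \<pi> (a + b) \<xi> = (\<lambda>i. \<pi> a \<xi> i + \<pi> b \<xi> i)) \<and>
     (\<forall>c a. \<forall>\<xi>\<in>ell2. \<pi> (c *\<^sub>C a) \<xi> = (\<lambda>i. c * \<pi> a \<xi> i)) \<and>
     (\<forall>a b. \<forall>\<xi>\<in>ell2. \<pi> (a * b) \<xi> = \<pi> a (\<pi> b \<xi>)) \<and>
     (\<forall>\<xi>\<in>ell2. \<pi> 1 \<xi> = \<xi>) \<and>
     (\<forall>a. \<forall>\<xi>\<in>ell2. \<forall>\<eta>\<in>ell2. ell2_inner (\<pi> (star a) \<xi>) \<eta> = ell2_inner \<xi> (\<pi> a \<eta>)) \<and>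
     (\<forall>a. op_norm (\<pi> a) = norm a)"

text \<open>
  The operator \<open>S \<otimes> T = (S \<otimes> 1) (1 \<otimes> T)\<close> on \<open>\<ell>\<^sup>2(I \<times> J) = \<ell>\<^sup>2(I) \<otimes> \<ell>\<^sup>2(J)\<close>: \<open>T\<close> acts on the rows and
  then \<open>S\<close> on the columns.
\<close>

definition tensor_op ::
    "(('i \<Rightarrow> complex) \<Rightarrow> ('i \<Rightarrow> complex)) \<Rightarrow> (('j \<Rightarrow> complex) \<Rightarrow> ('j \<Rightarrow> complex)) \<Rightarrow>
     ('i \<times> 'j \<Rightarrow> complex) \<Rightarrow> ('i \<times> 'j \<Rightarrow> complex)" where
  "tensor_op S T \<zeta> = (\<lambda>(i, j). S (\<lambda>i'. T (\<lambda>j'. \<zeta> (i', j')) j) i)"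

text \<open>
  \<open>min_tensor t\<close> says that \<open>'c\<close> together with the bilinear map \<open>t\<close>, \<open>t a b = a \<otimes> b\<close>, is the minimal
  (spatial) tensor product of \<open>'a\<close> and \<open>'b\<close>: the completion of the algebraic tensor product, a
  *-algebra in the usual way, in the norm of the operators \<open>\<Sum>\<^sub>k \<pi>(a\<^sub>k) \<otimes> \<rho>(b\<^sub>k)\<close> for faithful
  representations \<open>\<pi>\<close> and \<open>\<rho>\<close>. This norm does not depend on the choice of \<open>\<pi>\<close> and \<open>\<rho>\<close>, so \<open>('c, t)\<close> is
  determined up to a unique isomorphism. It is no restriction that the representation spaces are
  \<open>\<ell>\<^sup>2('a)\<close> and \<open>\<ell>\<^sup>2('b)\<close>: the sum of the cyclic representations of enough states has a space of
  dimension at most the cardinality of the algebra, and a suitable multiple of it has exactly that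
  dimension.
\<close>

definition min_tensor ::
    "('a::cstar_algebra \<Rightarrow> 'b::cstar_algebra \<Rightarrow> 'c::cstar_algebra) \<Rightarrow> bool" where
  "min_tensor t \<longleftrightarrow>
     (\<forall>b. clinear_map (\<lambda>a. t a b)) \<and> (\<forall>a. clinear_map (t a)) \<and>
     (\<forall>a b c d. t a b * t c d = t (a * c) (b * d)) \<and>
     (\<forall>a b. star (t a b) = t (star a) (star b)) \<and> t 1 1 = 1 \<and>
     closure (cspan {t a b | a b. True}) = UNIV \<and>
     (\<exists>(\<pi> :: 'a \<Rightarrow> ('a \<Rightarrow> complex) \<Rightarrow> ('a \<Rightarrow> complex)) (\<rho> :: 'b \<Rightarrow> ('b \<Rightarrow> complex) \<Rightarrow> ('b \<Rightarrow> complex)).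
        faithful_rep \<pi> \<and> faithful_rep \<rho> \<and>
        (\<forall>n::nat. \<forall>a b. norm (\<Sum>k<n. t (a k) (b k)) =
           op_norm (\<lambda>\<zeta> x. \<Sum>k<n. tensor_op (\<pi> (a k)) (\<rho> (b k)) \<zeta> x)))"

text \<open>
  \<open>'abc\<close> as a model of both \<open>('a \<otimes> 'b) \<otimes> 'c\<close> and \<open>'a \<otimes> ('b \<otimes> 'c)\<close>, with the canonical identification.
\<close>

definition triple_tensor ::
    "('a::cstar_algebra \<Rightarrow> 'b::cstar_algebra \<Rightarrow> 'ab::cstar_algebra) \<Rightarrow>
     ('ab \<Rightarrow> 'c::cstar_algebra \<Rightarrow> 'abc::cstar_algebra) \<Rightarrow>
     ('b \<Rightarrow> 'c \<Rightarrow> 'bc::cstar_algebra) \<Rightarrow> ('a \<Rightarrow> 'bc \<Rightarrow> 'abc) \<Rightarrow> bool" where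
  "triple_tensor t l u r \<longleftrightarrow> min_tensor t \<and> min_tensor l \<and> min_tensor u \<and> min_tensor r \<and>
     (\<forall>a b c. l (t a b) c = r a (u b c))"

text \<open>\<open>h = f \<otimes> g\<close> for *-homomorphisms \<open>f\<close> and \<open>g\<close>; such an \<open>h\<close> exists and is unique.\<close>

definition is_tensor_hom ::
    "('a::cstar_algebra \<Rightarrow> 'b::cstar_algebra \<Rightarrow> 'ab::cstar_algebra) \<Rightarrow>
     ('c::cstar_algebra \<Rightarrow> 'd::cstar_algebra \<Rightarrow> 'cd::cstar_algebra) \<Rightarrow>
     ('a \<Rightarrow> 'c) \<Rightarrow> ('b \<Rightarrow> 'd) \<Rightarrow> ('ab \<Rightarrow> 'cd) \<Rightarrow> bool" where
  "is_tensor_hom t t' f g h \<longleftrightarrow> unital_star_hom h \<and> (\<forall>a b. h (t a b) = t' (f a) (g b))"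

text \<open>\<open>h = id \<otimes> \<phi>\<close> for a bounded functional \<open>\<phi>\<close>; again \<open>h\<close> exists and is unique.\<close>

definition is_slice_map ::
    "('a::cstar_algebra \<Rightarrow> 'b::cstar_algebra \<Rightarrow> 'ab::cstar_algebra) \<Rightarrow> ('b \<Rightarrow> complex) \<Rightarrow>
     ('ab \<Rightarrow> 'a) \<Rightarrow> bool" where
  "is_slice_map t \<phi> h \<longleftrightarrow> clinear_map h \<and> bounded_linear h \<and> (\<forall>a b. h (t a b) = \<phi> b *\<^sub>C a)"

text \<open>
  The minimal tensor product of C*-subalgebras \<open>S\<close> and \<open>T\<close>, as a subalgebra of that of the whole
  algebras.
\<close>

definition tensor_sub ::
    "('a::cstar_algebra \<Rightarrow> 'b::cstar_algebra \<Rightarrow> 'ab::cstar_algebra) \<Rightarrow>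
     'a set \<Rightarrow> 'b set \<Rightarrow> 'ab set" where
  "tensor_sub t S T = closure (cspan {t a b | a b. a \<in> S \<and> b \<in> T})"


section \<open>Compact quantum groups and their actions\<close>

text \<open>
  Woronowicz's density conditions, for the restriction of \<open>\<Delta>\<close> to \<open>S\<close>. For \<open>S = UNIV\<close> the right-hand
  sides are the whole algebra \<open>Q \<otimes> Q\<close>.
\<close>

definition cancellation_on ::
    "('q::cstar_algebra \<Rightarrow> 'q \<Rightarrow> 'qq::cstar_algebra) \<Rightarrow> ('q \<Rightarrow> 'qq) \<Rightarrow> 'q set \<Rightarrow> bool" where
  "cancellation_on t \<Delta> S \<longleftrightarrow>
     closure (cspan {t a 1 * \<Delta> b | a b. a \<in> S \<and> b \<in> S}) = tensor_sub t S S \<and>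
     closure (cspan {t 1 a * \<Delta> b | a b. a \<in> S \<and> b \<in> S}) = tensor_sub t S S"

definition action_density_on ::
    "('a::cstar_algebra \<Rightarrow> 'q::cstar_algebra \<Rightarrow> 'aq::cstar_algebra) \<Rightarrow> ('a \<Rightarrow> 'aq) \<Rightarrow>
     'q set \<Rightarrow> bool" where
  "action_density_on t \<alpha> S \<longleftrightarrow>
     closure (cspan {\<alpha> a * t 1 q | a q. q \<in> S}) = tensor_sub t UNIV S"

text \<open>
  The parameters \<open>qq\<close>, \<open>qq_q\<close> and \<open>q_qq\<close> are the bilinear maps into the models of \<open>Q \<otimes> Q\<close>,
  \<open>(Q \<otimes> Q) \<otimes> Q\<close> and \<open>Q \<otimes> (Q \<otimes> Q)\<close>; likewise below, where \<open>aq\<close> belongs to \<open>A \<otimes> Q\<close>.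
\<close>

locale compact_quantum_group =
  fixes qq :: "'q::cstar_algebra \<Rightarrow> 'q \<Rightarrow> 'qq::cstar_algebra"
    and qq_q :: "'qq \<Rightarrow> 'q \<Rightarrow> 'qqq::cstar_algebra"
    and q_qq :: "'q \<Rightarrow> 'qq \<Rightarrow> 'qqq"
    and \<Delta> :: "'q \<Rightarrow> 'qq"
  assumes tensor_qqq: "triple_tensor qq qq_q qq q_qq"
    and hom_coproduct: "unital_star_hom \<Delta>"
    and coassociative: "\<exists>F G. is_tensor_hom qq qq_q \<Delta> id F \<and> is_tensor_hom qq q_qq id \<Delta> G \<and>
          F \<circ> \<Delta> = G \<circ> \<Delta>"
    and cancellation: "cancellation_on qq \<Delta> UNIV"

locale quantum_group_action = compact_quantum_group qq qq_q q_qq \<Delta>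
  for qq :: "'q::cstar_algebra \<Rightarrow> 'q \<Rightarrow> 'qq::cstar_algebra"
    and qq_q :: "'qq \<Rightarrow> 'q \<Rightarrow> 'qqq::cstar_algebra"
    and q_qq :: "'q \<Rightarrow> 'qq \<Rightarrow> 'qqq"
    and \<Delta> :: "'q \<Rightarrow> 'qq" +
  fixes aq :: "'a::cstar_algebra \<Rightarrow> 'q \<Rightarrow> 'aq::cstar_algebra"
    and aq_q :: "'aq \<Rightarrow> 'q \<Rightarrow> 'aqq::cstar_algebra"
    and a_qq :: "'a \<Rightarrow> 'qq \<Rightarrow> 'aqq"
    and \<alpha> :: "'a \<Rightarrow> 'aq"
  assumes tensor_aqq: "triple_tensor aq aq_q qq a_qq"
    and hom_action: "unital_star_hom \<alpha>"
    and action_coassociative: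
          "\<exists>F G. is_tensor_hom aq aq_q \<alpha> id F \<and> is_tensor_hom aq a_qq id \<Delta> G \<and>
             F \<circ> \<alpha> = G \<circ> \<alpha>"
    and action_density: "action_density_on aq \<alpha> UNIV"

text \<open>
  The coassociativity of the restrictions to a C*-subalgebra \<open>S\<close> is inherited and need not be
  required.
\<close>

definition faithful_action ::
    "('q::cstar_algebra \<Rightarrow> 'q \<Rightarrow> 'qq::cstar_algebra) \<Rightarrow> ('q \<Rightarrow> 'qq) \<Rightarrow>
     ('a::cstar_algebra \<Rightarrow> 'q \<Rightarrow> 'aq::cstar_algebra) \<Rightarrow> ('a \<Rightarrow> 'aq) \<Rightarrow> bool" where
  "faithful_action qq \<Delta> aq \<alpha> \<longleftrightarrow>
     \<not> (\<exists>S. unital_cstar_subalgebra S \<and> S \<noteq> UNIV \<and>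
          (\<forall>q\<in>S. \<Delta> q \<in> tensor_sub qq S S) \<and> cancellation_on qq \<Delta> S \<and>
          (\<forall>a. \<alpha> a \<in> tensor_sub aq UNIV S) \<and> action_density_on aq \<alpha> S)"

text \<open>
  The eigenvectors of the standard Laplacian on the circle are the functions
  \<^const>\<open>circle_power\<close> \<open>n\<close>.
\<close>

definition smooth_circle_action ::
    "((circle \<Rightarrow>\<^sub>C complex) \<Rightarrow> 'q::cstar_algebra \<Rightarrow> 'aq::cstar_algebra) \<Rightarrow>
     ((circle \<Rightarrow>\<^sub>C complex) \<Rightarrow> 'aq) \<Rightarrow> bool" where
  "smooth_circle_action aq \<alpha> \<longleftrightarrow>
     (\<forall>\<phi>. state \<phi> \<longrightarrow> (\<exists>h. is_slice_map aq \<phi> h \<and>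
        (\<forall>f\<in>cspan (range circle_power). h (\<alpha> f) \<in> cspan (range circle_power))))"

definition linear_circle_action ::
    "((circle \<Rightarrow>\<^sub>C complex) \<Rightarrow> 'q::cstar_algebra \<Rightarrow> 'aq::cstar_algebra) \<Rightarrow>
     ((circle \<Rightarrow>\<^sub>C complex) \<Rightarrow> 'aq) \<Rightarrow> bool" where
  "linear_circle_action aq \<alpha> \<longleftrightarrow>
     (\<exists>A B. \<alpha> circle_z = aq circle_z A + aq (star circle_z) B)"

end

theory Submission
  imports Defs
begin

text \<open>
  Since \<open>z\<close> is unitary and \<open>1, z\<^sup>2, z\<^sup>-\<^sup>2\<close> are linearly independent, \<open>\<alpha>(z) = z \<otimes> A + z\<^sup>-\<^sup>1 \<otimes> B\<close>
  gives \<open>AB\<^sup>* = A\<^sup>*B = 0\<close> and \<open>AA\<^sup>* + BB\<^sup>* = A\<^sup>*A + B\<^sup>*B = 1\<close>, so that \<open>A\<close> and \<open>B\<close> are partial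
  isometries, and the coaction identity gives \<open>\<Delta>(A) = A \<otimes> A + B\<^sup>* \<otimes> B\<close> and \<open>\<Delta>(B) = B \<otimes> A + A\<^sup>* \<otimes> B\<close>.
  Put \<open>e = A\<^sup>*A\<close> and \<open>f = AA\<^sup>*\<close>. These relations alone do not make \<open>A\<close> normal; the point is that
  \<open>e = f\<close> holds because \<open>Q\<close> is a quantum group.

  If \<open>e = f\<close>, then \<open>A, B, A\<^sup>*, B\<^sup>*\<close> commute pairwise, so the C*-algebra \<open>S\<close> generated by \<open>A\<close> and \<open>B\<close>
  is commutative. Moreover the matrix with rows \<open>(A, B\<^sup>*)\<close> and \<open>(B, A\<^sup>*)\<close> is then unitary, which
  allows one to solve for \<open>A \<otimes> 1, 1 \<otimes> A, B \<otimes> 1, 1 \<otimes> B\<close> and \<open>z \<otimes> 1\<close>; hence the density conditions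
  hold for \<open>S\<close>, and faithfulness of the action yields \<open>S = Q\<close>.

  For \<open>e = f\<close> consider \<open>s = e + f - 1\<close> and \<open>d = e - f\<close>. One computes \<open>\<Delta>(s) = s \<otimes> s\<close>,
  \<open>\<Delta>(d) = d \<otimes> 1 + s \<otimes> d\<close>, \<open>s\<^sup>2 + d\<^sup>2 = 1\<close> and \<open>sd + ds = 0\<close>. Invariance of a Haar state \<open>h\<close> would
  give \<open>d + h(d)s = h(d)1\<close>, and with the two algebraic relations this leaves only \<open>d = 0\<close>, \<open>e = 1\<close>
  or \<open>f = 1\<close>; in the last two cases \<open>B = 0\<close>, so \<open>e = f = 1\<close> after all. The proof replaces the Haar
  state by the means of the convolution powers of a single vector state \<open>\<omega>\<close>. That these means become
  invariant in the limit is the argument of Maes and Van Daele, carried out at finite stages (lemma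
  \<open>asymptotic_invariance\<close>); it is here that Woronowicz's density condition enters. The outcome is
  that each vector state vanishes on one of \<open>1 - e\<close>, \<open>1 - f\<close> and \<open>d\<^sup>2\<close>. As a Hilbert space is not a
  finite union of proper subspaces, one of these three elements is \<open>0\<close>.

  Convolution by \<open>\<omega>\<close> is \<open>(id \<otimes> \<omega>)\<Delta>\<close>. The slice maps \<open>id \<otimes> \<omega>\<close> are read off from the spatial norm: the
  vector functionals of the representation that defines the norm have contractive slices, which
  moreover carry states to states.
\<close>


section \<open>Star homomorphisms and states\<close>

interpretation complex_module: module "scaleC :: complex \<Rightarrow> 'a::cstar_algebra \<Rightarrow> 'a"
proof
  show "1 *\<^sub>C x = x" for x :: 'a
    using scaleC_of_real[of 1 x] by simp
qed (simp_all add: scaleC_add_right scaleC_add_left scaleC_scaleC)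

lemma bounded_linear_star: "bounded_linear (star :: 'a::cstar_algebra \<Rightarrow> 'a)"
proof (rule bounded_linear_intro[where K = 1])
  show "star (r *\<^sub>R x) = r *\<^sub>R star x" for r and x :: 'a
    by (simp add: star_scaleC flip: scaleC_of_real)
qed (simp_all add: star_add norm_star)

lemmas continuous_star [continuous_intros] =
  bounded_linear.continuous_on[OF bounded_linear_star]

lemmas star_zero [simp] = linear_0[OF bounded_linear.linear[OF bounded_linear_star]]
  and star_sum = linear_sum[OF bounded_linear.linear[OF bounded_linear_star]]
  and star_scaleR = linear_scale[OF bounded_linear.linear[OF bounded_linear_star]]

lemma star_one [simp]: "star (1 :: 'a::cstar_algebra) = 1"
  by (metis mult_1 mult_1_right star_mult star_star)

lemma star_mult_self_eq_0: "star x * x = 0 \<Longrightarrow> x = (0 :: 'a::cstar_algebra)"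
  by (metis norm_star_mult_self norm_zero power_eq_0_iff norm_eq_zero)

lemma bounded_linear_scaleC: "bounded_linear (\<lambda>x :: 'a::cstar_algebra. c *\<^sub>C x)"
proof (rule bounded_linear_intro[where K = "cmod c"])
  show "c *\<^sub>C (r *\<^sub>R x) = r *\<^sub>R (c *\<^sub>C x)" for r and x :: 'a
    by (simp add: scaleC_scaleC mult.commute flip: scaleC_of_real)
qed (simp_all add: scaleC_add_right norm_scaleC mult.commute)

lemmas continuous_scaleC [continuous_intros] =
  bounded_linear.continuous_on[OF bounded_linear_scaleC]
  and tendsto_scaleC = bounded_linear.tendsto[OF bounded_linear_scaleC]

lemma clinear_mapD:
  assumes "clinear_map f"
  shows "f (x + y) = f x + f y" "f (c *\<^sub>C x) = c *\<^sub>C f x" "f (r *\<^sub>R x) = r *\<^sub>R f x"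
    "f 0 = 0" "f (- x) = - f x" "f (x - y) = f x - f y" "f (sum g I) = (\<Sum>i\<in>I. f (g i))"
proof -
  have lin: "linear f"
    using assms by (intro linearI) (auto simp: clinear_map_def simp flip: scaleC_of_real)
  show "f (x + y) = f x + f y" "f (c *\<^sub>C x) = c *\<^sub>C f x"
    using assms by (auto simp: clinear_map_def)
  show "f (r *\<^sub>R x) = r *\<^sub>R f x" "f 0 = 0" "f (- x) = - f x" "f (x - y) = f x - f y"
      "f (sum g I) = (\<Sum>i\<in>I. f (g i))"
    using lin by (simp_all add: linear_scale linear_0 linear_neg linear_diff linear_sum)
qed

lemma clinear_functional_scaleC: "clinear_map \<phi> \<Longrightarrow> \<phi> (c *\<^sub>C x) = c * \<phi> x"
  by (simp add: clinear_map_def scaleC_complex_def)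

lemma clinear_map_bounded:
  assumes "clinear_map f" "\<And>x. norm (f x) \<le> K * norm x"
  shows "bounded_linear f"
  using assms by (intro bounded_linear_intro[where K = K])
    (simp_all add: clinear_mapD mult.commute)

lemma clinear_map_comp: "clinear_map f \<Longrightarrow> clinear_map g \<Longrightarrow> clinear_map (\<lambda>x. f (g x))"
  by (simp add: clinear_map_def)

lemma clinear_map_mult_left: "clinear_map (\<lambda>x. y * x)"
  by (simp add: clinear_map_def distrib_left scaleC_mult_right)

lemma clinear_map_funpow: "clinear_map (f :: 'a::cstar_algebra \<Rightarrow> 'a) \<Longrightarrow> clinear_map (f ^^ n)"
  unfolding clinear_map_def by (induction n) auto

lemma unital_star_homD:
  assumes "unital_star_hom f"
  shows "clinear_map f" "f (x * y) = f x * f y" "f (star x) = star (f x)" "f 1 = 1"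
  using assms by (simp_all add: unital_star_hom_def)

lemma unital_cstar_subalgebraD:
  assumes "unital_cstar_subalgebra S"
  shows "closed S" "1 \<in> S" "x \<in> S \<Longrightarrow> y \<in> S \<Longrightarrow> x + y \<in> S"
    "x \<in> S \<Longrightarrow> y \<in> S \<Longrightarrow> x * y \<in> S" "x \<in> S \<Longrightarrow> c *\<^sub>C x \<in> S" "x \<in> S \<Longrightarrow> star x \<in> S"
  using assms by (auto simp: unital_cstar_subalgebra_def)

text \<open>
  The equation \<open>(1 - v)\<^sup>2 = 1 - h\<close> is the fixed point equation \<open>v = (h + v\<^sup>2)/2\<close>, whose right-hand
  side is a contraction of a ball of radius less than 1. It preserves the closed set of self-adjoint
  elements that commute with everything that commutes with \<open>h\<close>, and the fixed point is found in this
  set.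
\<close>

lemma square_root_one_minus:
  fixes h :: "'a::cstar_algebra"
  assumes "star h = h" "norm h < 1"
  obtains w where "star w = w" "w * w = 1 - h" "\<And>x. x * h = h * x \<Longrightarrow> x * w = w * x"
proof -
  \<comment> \<open>The smaller root of \<open>r = (\<parallel>h\<parallel> + r\<^sup>2)/2\<close>, so that the ball of radius \<open>r\<close> is invariant.\<close>
  define r where "r = 1 - sqrt (1 - norm h)"
  define V where "V = cball 0 r \<inter> {v. star v = v} \<inter> {v. \<forall>x. x * h = h * x \<longrightarrow> x * v = v * x}"
  define g where "g v = (1/2) *\<^sub>R (h + v * v)" for v
  have r: "0 \<le> r" "r < 1" and r2: "norm h + r * r \<le> 2 * r"
    using assms(2) by (auto simp: r_def real_sqrt_le_1_iff algebra_simps)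
  have "closed {v :: 'a. star v = v}"
    by (intro closed_Collect_eq continuous_intros)
  moreover have "closed {v. \<forall>x. x * h = h * x \<longrightarrow> x * v = v * x}"
    by (intro closed_Collect_all closed_Collect_imp closed_Collect_eq continuous_intros) simp
  ultimately have "complete V"
    unfolding V_def by (simp add: complete_eq_closed closed_Int)
  moreover have "0 \<in> V" using r by (simp add: V_def)
  moreover have "g ` V \<subseteq> V"
  proof clarify
    fix v assume "v \<in> V"
    then have v: "norm v \<le> r" "star v = v" "\<And>x. x * h = h * x \<Longrightarrow> x * v = v * x"
      by (auto simp: V_def)
    have "norm (h + v * v) \<le> norm h + norm v * norm v"
      using norm_triangle_ineq[of h "v * v"] norm_mult_ineq[of v v] by linarith
    also have "\<dots> \<le> norm h + r * r"
      using v(1) r(1) by (intro add_left_mono mult_mono) auto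
    finally have "norm (g v) \<le> r"
      using r2 by (simp add: g_def)
    moreover have "star (g v) = g v"
      by (simp add: g_def star_scaleR star_add star_mult v(2) assms(1))
    moreover have "x * g v = g v * x" if "x * h = h * x" for x
    proof -
      have "x * (v * v) = v * v * x"
        by (metis mult.assoc v(3)[OF that])
      then show ?thesis by (simp add: g_def distrib_left distrib_right that)
    qed
    ultimately show "g v \<in> V" by (simp add: V_def)
  qed
  moreover have "dist (g v) (g v') \<le> r * dist v v'" if "v \<in> V \<and> v' \<in> V" for v v'
  proof -
    have n: "norm v \<le> r" "norm v' \<le> r" using that by (auto simp: V_def)
    have "v * v - v' * v' = v * (v - v') + (v - v') * v'"
      by (simp add: algebra_simps)
    then have "norm (v * v - v' * v') \<le> norm (v * (v - v')) + norm ((v - v') * v')"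
      by (metis norm_triangle_ineq)
    also have "\<dots> \<le> r * norm (v - v') + norm (v - v') * r"
      using n r(1) by (intro add_mono order_trans[OF norm_mult_ineq] mult_mono) auto
    finally have "norm (v * v - v' * v') \<le> 2 * (r * norm (v - v'))" by simp
    moreover have "g v - g v' = (1/2) *\<^sub>R (v * v - v' * v')"
      by (simp add: g_def algebra_simps)
    ultimately show ?thesis by (simp add: dist_norm)
  qed
  ultimately have "\<exists>!v. v \<in> V \<and> g v = v"
    using r by (intro Banach_fix[of V r g]) auto
  then obtain v where v: "v \<in> V" "g v = v" by blast
  show ?thesis
  proof (rule that[of "1 - v"])
    have "h + v * v = 2 *\<^sub>R v" using arg_cong[OF v(2), of "\<lambda>u. 2 *\<^sub>R u"] by (simp add: g_def)
    then show "(1 - v) * (1 - v) = 1 - h"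
      by (simp add: algebra_simps scaleR_2)
    show "star (1 - v) = 1 - v" using v(1) by (simp add: V_def star_diff)
    show "x * (1 - v) = (1 - v) * x" if "x * h = h * x" for x
      using v(1) that by (simp add: V_def algebra_simps)
  qed
qed

text \<open>
  For self-adjoint \<open>x\<close> with \<open>\<parallel>x\<parallel> < 1\<close> the element \<open>x + \<i> \<surd>(1 - x\<^sup>2)\<close> is unitary and has real part
  \<open>x\<close>. Its image under \<open>f\<close> is unitary as well, so \<open>f(x)\<close> is the real part of a unitary.
\<close>

theorem unital_star_hom_contractive:
  fixes f :: "'a::cstar_algebra \<Rightarrow> 'b::cstar_algebra"
  assumes f: "unital_star_hom f"
  shows "norm (f a) \<le> norm a"
proof -
  note lin = clinear_mapD[OF unital_star_homD(1)[OF f]] and hom = unital_star_homD[OF f]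
  have 1: "norm (f x) \<le> 1" if "star x = x" "norm x < 1" for x
  proof -
    have "norm (x * x) < 1"
      using norm_star_mult_self[of x] that by (simp add: power_less_one_iff)
    moreover have "star (x * x) = x * x" by (simp add: star_mult that(1))
    ultimately obtain w where w: "star w = w" "w * w = 1 - x * x"
      and comm: "\<And>v. v * (x * x) = x * x * v \<Longrightarrow> v * w = w * v"
      using square_root_one_minus[of "x * x"] by blast
    have xw: "x * w = w * x" by (rule comm) (simp add: mult.assoc)
    have rel: "f w * f w = 1 - f x * f x" "f x * f w = f w * f x" "star (f x) = f x"
        "star (f w) = f w"
      using arg_cong[OF w(2), of f] arg_cong[OF xw, of f] hom(3)[of x] hom(3)[of w] that(1) w(1)
      by (simp_all add: hom lin)
    define u where "u = f x + \<i> *\<^sub>C f w"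
    have us: "star u = f x - \<i> *\<^sub>C f w"
      by (simp add: u_def star_add star_scaleC rel)
    have "star u * u = 1"
      unfolding us unfolding u_def
      by (simp add: distrib_left left_diff_distrib scaleC_mult_left scaleC_mult_right scaleC_scaleC
          rel complex_module.scale_right_diff_distrib)
    then have "norm u = 1" using norm_star_mult_self[of u] power2_eq_imp_eq[of "norm u" 1] by simp
    moreover have "norm (star u) = norm u" by (rule norm_star)
    moreover have "2 *\<^sub>R f x = u + star u" by (simp add: us scaleR_2) (simp add: u_def)
    ultimately have "norm (2 *\<^sub>R f x) \<le> 2" by (metis norm_triangle_ineq one_add_one)
    then show ?thesis by simp
  qed
  have 2: "norm (f x) \<le> norm x" if "star x = x" for x
  proof (rule field_le_epsilon)
    fix e :: real assume "0 < e"
    define t where "t = norm x + e"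
    have t: "t > 0" "norm x < t" using \<open>0 < e\<close> by (simp_all add: t_def add_nonneg_pos)
    have "norm (f ((1/t) *\<^sub>R x)) \<le> 1"
      using t that by (intro 1) (simp_all add: star_scaleR)
    then have "norm (f x) / t \<le> 1" using t by (simp add: lin)
    then show "norm (f x) \<le> norm x + e" using t by (simp add: t_def)
  qed
  have "(norm (f a))\<^sup>2 \<le> (norm a)\<^sup>2"
    using 2[of "star a * a"] by (simp add: star_mult star_star hom norm_star_mult_self)
  then show ?thesis by (simp add: power2_le_iff_abs_le)
qed

lemma unital_star_hom_bounded_linear: "unital_star_hom f \<Longrightarrow> bounded_linear f"
  using unital_star_hom_contractive[of f]
  by (intro clinear_map_bounded[where K = 1]) (auto simp: unital_star_homD)

text \<open>
  The common core of the Cauchy-Schwarz inequalities for states and for square-summable functions.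
\<close>

lemma nonneg_quadratic_imp_cauchy_schwarz:
  fixes a b :: real and c :: complex
  assumes nonneg: "\<And>l. 0 \<le> a + 2 * Re (l * c) + (cmod l)\<^sup>2 * b" and "0 \<le> b"
  shows "(cmod c)\<^sup>2 \<le> a * b"
proof (cases "b = 0")
  case True
  have "c = 0"
  proof (rule ccontr)
    assume "c \<noteq> 0"
    \<comment> \<open>Without the quadratic term the real part of \<open>l c\<close> can be made equal to \<open>- (a + 1)\<close>.\<close>
    define l where "l = - of_real ((a + 1) / (cmod c)\<^sup>2) * cnj c"
    have "l * c = - of_real ((a + 1) / (cmod c)\<^sup>2) * of_real ((cmod c)\<^sup>2)"
      by (simp add: l_def complex_norm_square mult.commute del: of_real_power)
    also have "\<dots> = - of_real (a + 1)" using \<open>c \<noteq> 0\<close> by (simp flip: of_real_mult)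
    finally have "l * c = - of_real (a + 1)" .
    then have "0 \<le> a - 2 * (a + 1)" using nonneg[of l] True by simp
    moreover have "0 \<le> a" using nonneg[of 0] by simp
    ultimately show False by simp
  qed
  with True show ?thesis by simp
next
  case False
  \<comment> \<open>The minimum of the quadratic polynomial.\<close>
  define l where "l = - of_real (1 / b) * cnj c"
  have "l * c = - of_real (1 / b) * of_real ((cmod c)\<^sup>2)"
    by (simp add: l_def complex_norm_square mult.commute del: of_real_power)
  then have "Re (l * c) = - (cmod c)\<^sup>2 / b" by simp
  moreover have "cmod l = cmod c / b" using \<open>0 \<le> b\<close> by (simp add: l_def norm_mult norm_divide)
  ultimately have "0 \<le> a - 2 * (cmod c)\<^sup>2 / b + (cmod c / b)\<^sup>2 * b" using nonneg[of l] by simp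
  also have "\<dots> = a - (cmod c)\<^sup>2 / b" using False by (simp add: field_simps power2_eq_square)
  finally have "(cmod c)\<^sup>2 / b \<le> a" by simp
  then show ?thesis using False \<open>0 \<le> b\<close> by (simp add: field_simps)
qed

text \<open>
  Positivity at \<open>x + 1\<close> and at \<open>x + \<i> 1\<close> determines the imaginary and the real part.
\<close>

lemma state_star:
  assumes "state \<phi>"
  shows "\<phi> (star x) = cnj (\<phi> x)"
proof -
  note lin = clinear_mapD(1,3-7) clinear_functional_scaleC
  have cl: "clinear_map \<phi>" and one: "\<phi> 1 = 1" and re: "\<And>y. Im (\<phi> (star y * y)) = 0"
    using assms by (auto simp: state_def complex_is_Real_iff)
  have "Im (\<phi> (star x) + \<phi> x) = 0" and "Im (\<i> * \<phi> (star x) - \<i> * \<phi> x) = 0"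
  proof -
    have "star (x + 1) * (x + 1) = star x * x + (star x + x) + 1"
      by (simp add: star_add algebra_simps)
    then show "Im (\<phi> (star x) + \<phi> x) = 0"
      using re[of "x + 1"] re[of x] by (simp add: lin[OF cl] one)
    have "star (x + \<i> *\<^sub>C 1) * (x + \<i> *\<^sub>C 1) = star x * x + (\<i> *\<^sub>C star x - \<i> *\<^sub>C x) + 1"
      by (simp add: star_add star_scaleC algebra_simps scaleC_mult_left scaleC_mult_right
          scaleC_scaleC)
    then show "Im (\<i> * \<phi> (star x) - \<i> * \<phi> x) = 0"
      using re[of "x + \<i> *\<^sub>C 1"] re[of x] by (simp add: lin[OF cl] one)
  qed
  then show ?thesis by (simp add: complex_eq_iff)
qed

lemma state_cauchy_schwarz:
  assumes "state \<phi>"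
  shows "(cmod (\<phi> (star x * y)))\<^sup>2 \<le> Re (\<phi> (star x * x)) * Re (\<phi> (star y * y))"
proof (rule nonneg_quadratic_imp_cauchy_schwarz)
  note lin = clinear_mapD(1,3-7) clinear_functional_scaleC
  have cl: "clinear_map \<phi>" and pos: "\<And>y. 0 \<le> Re (\<phi> (star y * y))"
    using assms by (auto simp: state_def)
  show "0 \<le> Re (\<phi> (star y * y))" by (rule pos)
  fix l
  have "star (x + l *\<^sub>C y) * (x + l *\<^sub>C y) =
      star x * x + l *\<^sub>C (star x * y) + cnj l *\<^sub>C (star y * x) + (l * cnj l) *\<^sub>C (star y * y)"
    by (simp add: star_add star_scaleC algebra_simps scaleC_mult_left scaleC_mult_right
        scaleC_scaleC scaleC_add_right)
  moreover have "\<phi> (star y * x) = cnj (\<phi> (star x * y))"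
    using state_star[OF assms, of "star x * y"] by (simp add: star_mult star_star)
  ultimately have "Re (\<phi> (star (x + l *\<^sub>C y) * (x + l *\<^sub>C y))) =
      Re (\<phi> (star x * x)) + 2 * Re (l * \<phi> (star x * y)) + (cmod l)\<^sup>2 * Re (\<phi> (star y * y))"
    by (simp add: lin[OF cl] flip: complex_norm_square)
  then show "0 \<le> Re (\<phi> (star x * x)) + 2 * Re (l * \<phi> (star x * y)) + (cmod l)\<^sup>2 * Re (\<phi>
      (star y * y))"
    using pos by metis
qed

text \<open>
  By the square root above, \<open>1 - h/t\<close> is of the form \<open>w\<^sup>*w\<close> if \<open>t > \<parallel>h\<parallel>\<close>; this bounds \<open>\<phi>\<close> on
  self-adjoint elements, and the general case follows from the Cauchy-Schwarz inequality.
\<close>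

lemma state_bound:
  assumes "state \<phi>"
  shows "cmod (\<phi> x) \<le> norm x"
proof -
  note lin = clinear_mapD(1,3-7) clinear_functional_scaleC
  have cl: "clinear_map \<phi>" and one: "\<phi> 1 = 1" and pos: "\<And>y. 0 \<le> Re (\<phi> (star y * y))"
    using assms by (auto simp: state_def)
  have "Re (\<phi> h) \<le> norm h" if "star h = h" for h
  proof (rule field_le_epsilon)
    fix e :: real assume "0 < e"
    define t where "t = norm h + e"
    have t: "t > 0" "norm h < t" using \<open>0 < e\<close> by (simp_all add: t_def add_nonneg_pos)
    have "star ((1/t) *\<^sub>R h) = (1/t) *\<^sub>R h" "norm ((1/t) *\<^sub>R h) < 1"
      using t that by (simp_all add: star_scaleR)
    then obtain w where "star w = w" "w * w = 1 - (1/t) *\<^sub>R h"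
      using square_root_one_minus by blast
    then have "0 \<le> Re (\<phi> (1 - (1/t) *\<^sub>R h))" using pos[of w] by simp
    then have "Re (\<phi> h) / t \<le> 1" by (simp add: lin[OF cl] one)
    then show "Re (\<phi> h) \<le> norm h + e" using t by (simp add: t_def)
  qed
  from this[of "star x * x"] have "Re (\<phi> (star x * x)) \<le> (norm x)\<^sup>2"
    by (simp add: star_mult star_star norm_star_mult_self)
  moreover have "(cmod (\<phi> x))\<^sup>2 \<le> Re (\<phi> (star x * x))"
    using state_cauchy_schwarz[OF assms, of 1 x] by (simp add: one)
  ultimately have "(cmod (\<phi> x))\<^sup>2 \<le> (norm x)\<^sup>2" by linarith
  then show ?thesis by (simp add: power2_le_iff_abs_le)
qed

lemma state_bounded_linear: "state \<phi> \<Longrightarrow> bounded_linear \<phi>"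
  using state_bound[of \<phi>] by (intro clinear_map_bounded[where K = 1]) (auto simp: state_def)

lemma state_iff: "state \<phi> \<longleftrightarrow> clinear_map \<phi> \<and> (\<forall>x. Im (\<phi> (star x * x)) = 0 \<and> 0 \<le>
    Re (\<phi> (star x * x))) \<and> \<phi> 1 = 1"
  by (simp add: state_def complex_is_Real_iff)

lemma stateD:
  assumes "state \<phi>"
  shows "clinear_map \<phi>" "0 \<le> Re (\<phi> (star x * x))" "Im (\<phi> (star x * x)) = 0" "\<phi> 1 = 1"
    "\<phi> (x + y) = \<phi> x + \<phi> y" "\<phi> (c *\<^sub>C x) = c * \<phi> x" "\<phi> (x - y) = \<phi> x - \<phi> y"
    "\<phi> 0 = 0" "\<phi> (sum g I) = (\<Sum>i\<in>I. \<phi> (g i))"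
  using assms by (auto simp: state_iff clinear_mapD(1,4-7) clinear_functional_scaleC)


section \<open>Square-summable functions and operators on them\<close>

lemma ell2_norm_nonneg [simp]: "0 \<le> ell2_norm \<xi>"
  by (simp add: ell2_norm_def infsum_nonneg)

lemma ell2_norm_square: "(ell2_norm \<xi>)\<^sup>2 = (\<Sum>\<^sub>\<infinity>i. (cmod (\<xi> i))\<^sup>2)"
  by (simp add: ell2_norm_def infsum_nonneg)

lemma ell2_dominated:
  assumes "f summable_on UNIV" "\<And>i. (cmod (\<xi> i))\<^sup>2 \<le> f i"
  shows "\<xi> \<in> ell2" "(ell2_norm \<xi>)\<^sup>2 \<le> (\<Sum>\<^sub>\<infinity>i. f i)"
proof -
  have s: "(\<lambda>i. (cmod (\<xi> i))\<^sup>2) summable_on UNIV"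
    by (rule summable_on_comparison_test[OF assms(1)]) (use assms(2) in auto)
  then show "\<xi> \<in> ell2" by (simp add: ell2_def)
  show "(ell2_norm \<xi>)\<^sup>2 \<le> (\<Sum>\<^sub>\<infinity>i. f i)"
    unfolding ell2_norm_square by (rule infsum_mono) (use s assms in auto)
qed

lemma norm_add_square_le: "(norm (x + y))\<^sup>2 \<le> 2 * ((norm x)\<^sup>2 + (norm y)\<^sup>2)"
proof -
  have "(norm (x + y))\<^sup>2 \<le> (norm x + norm y)\<^sup>2"
    by (intro power_mono norm_triangle_ineq) simp
  also have "\<dots> \<le> 2 * ((norm x)\<^sup>2 + (norm y)\<^sup>2)"
    using sum_squares_bound[of "norm x" "norm y"] by (simp add: power2_sum)
  finally show ?thesis .
qed

lemma ell2_add: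
  assumes "\<xi> \<in> ell2" "\<eta> \<in> ell2"
  shows "(\<lambda>i. \<xi> i + \<eta> i) \<in> ell2"
    "(ell2_norm (\<lambda>i. \<xi> i + \<eta> i))\<^sup>2 \<le> 2 * ((ell2_norm \<xi>)\<^sup>2 + (ell2_norm \<eta>)\<^sup>2)"
proof -
  have s: "(\<lambda>i. (cmod (\<xi> i))\<^sup>2) summable_on UNIV" "(\<lambda>i. (cmod (\<eta> i))\<^sup>2) summable_on UNIV"
    using assms by (simp_all add: ell2_def)
  note d = ell2_dominated[OF summable_on_cmult_right[OF summable_on_add[OF s]] norm_add_square_le]
  show "(\<lambda>i. \<xi> i + \<eta> i) \<in> ell2" by (rule d(1))
  show "(ell2_norm (\<lambda>i. \<xi> i + \<eta> i))\<^sup>2 \<le> 2 * ((ell2_norm \<xi>)\<^sup>2 + (ell2_norm \<eta>)\<^sup>2)"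
    using d(2) unfolding infsum_cmult_right' infsum_add[OF s] ell2_norm_square .
qed

lemma ell2_scale:
  assumes "\<xi> \<in> ell2"
  shows "(\<lambda>i. c * \<xi> i) \<in> ell2" "ell2_norm (\<lambda>i. c * \<xi> i) = cmod c * ell2_norm \<xi>"
  using assms
  by (auto simp: ell2_def ell2_norm_def norm_mult power_mult_distrib infsum_cmult_right'
      real_sqrt_mult intro!: summable_on_cmult_right)

lemma ell2_zero [simp]: "(\<lambda>i. 0) \<in> ell2" "ell2_norm (\<lambda>i. 0) = 0"
  by (simp_all add: ell2_def ell2_norm_def)

lemma ell2_norm_eq_0: "\<xi> \<in> ell2 \<Longrightarrow> ell2_norm \<xi> = 0 \<Longrightarrow> \<xi> i = 0"
  using nonneg_infsum_le_0D[of "\<lambda>i. (cmod (\<xi> i))\<^sup>2" UNIV i] by (auto simp: ell2_norm_def ell2_def)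

lemma ell2_sum: "(\<And>k. k \<in> K \<Longrightarrow> \<xi> k \<in> ell2) \<Longrightarrow> (\<lambda>i. \<Sum>k\<in>K. \<xi> k i) \<in> ell2"
  by (induction K rule: infinite_finite_induct) (auto intro: ell2_add)

lemma ell2_inner_summable:
  assumes "\<xi> \<in> ell2" "\<eta> \<in> ell2"
  shows "(\<lambda>i. \<xi> i * cnj (\<eta> i)) summable_on UNIV"
proof -
  have "cmod (\<xi> i * cnj (\<eta> i)) \<le> (cmod (\<xi> i))\<^sup>2 + (cmod (\<eta> i))\<^sup>2" for i
  proof -
    have "0 \<le> cmod (\<xi> i) * cmod (\<eta> i)" by simp
    then show ?thesis
      using sum_squares_bound[of "cmod (\<xi> i)" "cmod (\<eta> i)"] unfolding norm_mult complex_mod_cnj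
      by linarith
  qed
  moreover have "(\<lambda>i. (cmod (\<xi> i))\<^sup>2 + (cmod (\<eta> i))\<^sup>2) summable_on UNIV"
    using assms by (intro summable_on_add) (simp_all add: ell2_def)
  ultimately have "(\<lambda>i. cmod (\<xi> i * cnj (\<eta> i))) summable_on UNIV"
    by (intro Infinite_Sum.abs_summable_on_comparison_test') auto
  then show ?thesis by (rule abs_summable_summable)
qed

lemma ell2_inner_add:
  "\<xi> \<in> ell2 \<Longrightarrow> \<xi>' \<in> ell2 \<Longrightarrow> \<eta> \<in> ell2 \<Longrightarrow>
    ell2_inner (\<lambda>i. \<xi> i + \<xi>' i) \<eta> = ell2_inner \<xi> \<eta> + ell2_inner \<xi>' \<eta>"
  by (simp add: ell2_inner_def distrib_right infsum_add ell2_inner_summable)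

lemma ell2_inner_scale: "ell2_inner (\<lambda>i. c * \<xi> i) \<eta> = c * ell2_inner \<xi> \<eta>"
  by (simp add: ell2_inner_def mult.assoc infsum_cmult_right')

lemma ell2_inner_sum:
  "(\<And>k. k \<in> K \<Longrightarrow> \<xi> k \<in> ell2) \<Longrightarrow> \<eta> \<in> ell2 \<Longrightarrow>
    ell2_inner (\<lambda>i. \<Sum>k\<in>K. \<xi> k i) \<eta> = (\<Sum>k\<in>K. ell2_inner (\<xi> k) \<eta>)"
proof (induction K rule: infinite_finite_induct)
  case (insert k K)
  then show ?case by (simp add: ell2_inner_add ell2_sum)
qed (simp_all add: ell2_inner_def)

lemma ell2_inner_cnj: "cnj (ell2_inner \<xi> \<eta>) = ell2_inner \<eta> \<xi>"
  unfolding ell2_inner_def infsum_cnj[symmetric] by (simp add: mult.commute del: infsum_cnj)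

lemma ell2_inner_self:
  assumes "\<xi> \<in> ell2"
  shows "ell2_inner \<xi> \<xi> = of_real ((ell2_norm \<xi>)\<^sup>2)"
proof -
  have "((\<lambda>i. (cmod (\<xi> i))\<^sup>2) has_sum (ell2_norm \<xi>)\<^sup>2) UNIV"
    unfolding ell2_norm_square using assms by (intro has_sum_infsum) (simp add: ell2_def)
  from infsumI[OF has_sum_of_real[OF this]] show ?thesis
    unfolding ell2_inner_def complex_norm_square[symmetric] by simp
qed

lemma ell2_cauchy_schwarz:
  assumes "\<xi> \<in> ell2" "\<eta> \<in> ell2"
  shows "cmod (ell2_inner \<xi> \<eta>) \<le> ell2_norm \<xi> * ell2_norm \<eta>"
proof -
  have "(cmod (ell2_inner \<xi> \<eta>))\<^sup>2 \<le> (ell2_norm \<eta>)\<^sup>2 * (ell2_norm \<xi>)\<^sup>2"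
  proof (rule nonneg_quadratic_imp_cauchy_schwarz)
    fix l
    define \<zeta> where "\<zeta> = (\<lambda>i. \<eta> i + l * \<xi> i)"
    have l\<xi>: "(\<lambda>i. l * \<xi> i) \<in> ell2" using assms by (simp add: ell2_scale)
    have \<zeta>: "\<zeta> \<in> ell2" unfolding \<zeta>_def by (intro ell2_add assms l\<xi>)
    have "ell2_inner \<zeta> \<zeta> = ell2_inner \<eta> \<zeta> + l * ell2_inner \<xi> \<zeta>"
      unfolding \<zeta>_def by (subst ell2_inner_add)
          (use assms l\<xi> \<zeta> in \<open>simp_all add: \<zeta>_def ell2_inner_scale\<close>)
    moreover have "ell2_inner \<alpha> \<zeta> = ell2_inner \<alpha> \<eta> + cnj l * ell2_inner \<alpha> \<xi>" if "\<alpha> \<in> ell2" for \<alpha>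
    proof -
      have "ell2_inner \<zeta> \<alpha> = ell2_inner \<eta> \<alpha> + l * ell2_inner \<xi> \<alpha>"
        unfolding \<zeta>_def by (subst ell2_inner_add)
            (use assms l\<xi> that in \<open>simp_all add: ell2_inner_scale\<close>)
      from arg_cong[OF this, of cnj] show ?thesis by (simp add: ell2_inner_cnj)
    qed
    ultimately have "ell2_inner \<zeta> \<zeta> = ell2_inner \<eta> \<eta> + (l * ell2_inner \<xi> \<eta> + cnj
        (l * ell2_inner \<xi> \<eta>))
        + (l * cnj l) * ell2_inner \<xi> \<xi>"
      using assms by (simp add: algebra_simps ell2_inner_cnj)
    moreover have "l * cnj l = of_real ((cmod l)\<^sup>2)" by (simp only: complex_norm_square)
    ultimately have "Re (ell2_inner \<zeta> \<zeta>) = (ell2_norm \<eta>)\<^sup>2 + 2 * Re (l * ell2_inner \<xi> \<eta>) +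
        (cmod l)\<^sup>2 * (ell2_norm \<xi>)\<^sup>2"
      using assms by (simp add: ell2_inner_self del: of_real_power)
    then show "0 \<le> (ell2_norm \<eta>)\<^sup>2 + 2 * Re (l * ell2_inner \<xi> \<eta>) + (cmod l)\<^sup>2 * (ell2_norm \<xi>)\<^sup>2"
      using \<zeta> zero_le_power2[of "ell2_norm \<zeta>"] by (simp only: ell2_inner_self Re_complex_of_real)
  qed simp
  then have "(cmod (ell2_inner \<xi> \<eta>))\<^sup>2 \<le> (ell2_norm \<xi> * ell2_norm \<eta>)\<^sup>2"
    by (simp add: power_mult_distrib mult.commute)
  then show ?thesis by (simp add: power2_le_iff_abs_le)
qed

lemma ell2_unit_vector:
  "(\<lambda>j. if j = i then 1 else 0) \<in> ell2" "ell2_norm (\<lambda>j. if j = i then 1 else 0) = 1"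
  "ell2_inner \<xi> (\<lambda>j. if j = i then 1 else 0) = \<xi> i"
proof -
  have "((\<lambda>j. (cmod (if j = i then 1 else 0))\<^sup>2) has_sum 1) UNIV"
    by (rule has_sum_finite_neutralI[of "{i}"]) auto
  then show "(\<lambda>j. if j = i then 1 else 0) \<in> ell2" "ell2_norm (\<lambda>j. if j = i then 1 else 0) = 1"
    by (auto simp: ell2_def ell2_norm_def infsumI intro: has_sum_imp_summable)
  have "((\<lambda>j. \<xi> j * cnj (if j = i then 1 else 0)) has_sum \<xi> i) UNIV"
    by (rule has_sum_finite_neutralI[of "{i}"]) auto
  then show "ell2_inner \<xi> (\<lambda>j. if j = i then 1 else 0) = \<xi> i"
    by (simp add: ell2_inner_def infsumI)
qed

lemma ell2_prod:
  fixes \<zeta> :: "'i \<times> 'j \<Rightarrow> complex"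
  shows "\<zeta> \<in> ell2 \<longleftrightarrow> (\<forall>i. (\<lambda>j. \<zeta> (i, j)) \<in> ell2) \<and> (\<lambda>i. (ell2_norm (\<lambda>j. \<zeta> (i,
      j)))\<^sup>2) summable_on UNIV"
    and "\<zeta> \<in> ell2 \<Longrightarrow> (ell2_norm \<zeta>)\<^sup>2 = (\<Sum>\<^sub>\<infinity>i. (ell2_norm (\<lambda>j. \<zeta> (i, j)))\<^sup>2)"
proof -
  show *: "\<zeta> \<in> ell2 \<longleftrightarrow> (\<forall>i. (\<lambda>j. \<zeta> (i, j)) \<in> ell2) \<and> (\<lambda>i. (ell2_norm (\<lambda>j. \<zeta> (i,
      j)))\<^sup>2) summable_on UNIV"
    using Infinite_Sum.abs_summable_on_Sigma_iff[where f = "\<lambda>x. (cmod (\<zeta> x))\<^sup>2" and A = UNIV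
        and B = "\<lambda>_. UNIV"]
    by (simp add: ell2_def ell2_norm_square infsum_nonneg)
  assume "\<zeta> \<in> ell2"
  then show "(ell2_norm \<zeta>)\<^sup>2 = (\<Sum>\<^sub>\<infinity>i. (ell2_norm (\<lambda>j. \<zeta> (i, j)))\<^sup>2)"
    using infsum_Sigma_banach[where f = "\<lambda>x. (cmod (\<zeta> x))\<^sup>2" and A = UNIV and B = "\<lambda>_. UNIV"]
    by (simp add: ell2_def ell2_norm_square)
qed

lemma ell2_swap:
  fixes \<zeta> :: "'i \<times> 'j \<Rightarrow> complex"
  shows "(\<lambda>x. \<zeta> (prod.swap x)) \<in> ell2 \<longleftrightarrow> \<zeta> \<in> ell2"
    "ell2_norm (\<lambda>x. \<zeta> (prod.swap x)) = ell2_norm \<zeta>"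
proof -
  have bij: "bij_betw prod.swap (UNIV :: ('j \<times> 'i) set) UNIV" by simp
  show "(\<lambda>x. \<zeta> (prod.swap x)) \<in> ell2 \<longleftrightarrow> \<zeta> \<in> ell2"
    unfolding ell2_def mem_Collect_eq by (rule summable_on_reindex_bij_betw[OF bij])
  show "ell2_norm (\<lambda>x. \<zeta> (prod.swap x)) = ell2_norm \<zeta>"
    unfolding ell2_norm_def by (subst infsum_reindex_bij_betw[OF bij]) (rule refl)
qed

lemma ell2_tensor:
  assumes "\<xi> \<in> ell2" "\<eta> \<in> ell2"
  shows "(\<lambda>(i, j). \<xi> i * \<eta> j) \<in> ell2"
    "ell2_norm (\<lambda>(i, j). \<xi> i * \<eta> j) = ell2_norm \<xi> * ell2_norm \<eta>"
proof -
  have row: "(\<lambda>j. \<xi> i * \<eta> j) \<in> ell2" "(ell2_norm (\<lambda>j. \<xi> i * \<eta> j))\<^sup>2 =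
      (cmod (\<xi> i))\<^sup>2 * (ell2_norm \<eta>)\<^sup>2" for i
    using assms by (simp_all add: ell2_scale power_mult_distrib)
  then show *: "(\<lambda>(i, j). \<xi> i * \<eta> j) \<in> ell2"
    using assms by (subst ell2_prod) (auto simp: ell2_def intro: summable_on_cmult_left)
  have "(ell2_norm (\<lambda>(i, j). \<xi> i * \<eta> j))\<^sup>2 = (\<Sum>\<^sub>\<infinity>i. (cmod (\<xi> i))\<^sup>2 * (ell2_norm \<eta>)\<^sup>2)"
    using ell2_prod(2)[OF *] by (simp only: prod.case row)
  also have "\<dots> = (ell2_norm \<xi> * ell2_norm \<eta>)\<^sup>2"
    unfolding infsum_cmult_left' ell2_norm_square power_mult_distrib ..
  finally show "ell2_norm (\<lambda>(i, j). \<xi> i * \<eta> j) = ell2_norm \<xi> * ell2_norm \<eta>" by simp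
qed

lemma bounded_opD:
  assumes "bounded_op T"
  shows "\<xi> \<in> ell2 \<Longrightarrow> T \<xi> \<in> ell2" "\<xi> \<in> ell2 \<Longrightarrow> T (\<lambda>i. c * \<xi> i) = (\<lambda>i. c * T \<xi> i)"
  using assms unfolding bounded_op_def by blast+

text \<open>
  Stated with squares, which turns sums over rows and columns of a tensor into sums of norms, and
  for maps between different index sets, so that the flip of the two factors is included.
\<close>

definition bounded_on_ell2 :: "(('i \<Rightarrow> complex) \<Rightarrow> 'j \<Rightarrow> complex) \<Rightarrow> bool" where
  "bounded_on_ell2 T \<longleftrightarrow> (\<exists>K\<ge>0. \<forall>\<zeta>\<in>ell2. T \<zeta> \<in> ell2 \<and> (ell2_norm (T \<zeta>))\<^sup>2 \<le> K * (ell2_norm \<zeta>)\<^sup>2)"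

lemma bounded_on_ell2I:
  assumes "0 \<le> K" "\<And>\<zeta>. \<zeta> \<in> ell2 \<Longrightarrow> T \<zeta> \<in> ell2"
    "\<And>\<zeta>. \<zeta> \<in> ell2 \<Longrightarrow> (ell2_norm (T \<zeta>))\<^sup>2 \<le> K * (ell2_norm \<zeta>)\<^sup>2"
  shows "bounded_on_ell2 T"
  using assms unfolding bounded_on_ell2_def by blast

lemma bounded_on_ell2E:
  assumes "bounded_on_ell2 T"
  obtains K where "0 \<le> K" "\<And>\<zeta>. \<zeta> \<in> ell2 \<Longrightarrow> T \<zeta> \<in> ell2"
    "\<And>\<zeta>. \<zeta> \<in> ell2 \<Longrightarrow> (ell2_norm (T \<zeta>))\<^sup>2 \<le> K * (ell2_norm \<zeta>)\<^sup>2"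
  using assms unfolding bounded_on_ell2_def by blast

lemma bounded_on_ell2_comp:
  assumes "bounded_on_ell2 S" "bounded_on_ell2 T"
  shows "bounded_on_ell2 (\<lambda>\<zeta>. S (T \<zeta>))"
proof -
  obtain K where K: "0 \<le> K" "\<And>\<zeta>. \<zeta> \<in> ell2 \<Longrightarrow> S \<zeta> \<in> ell2"
    "\<And>\<zeta>. \<zeta> \<in> ell2 \<Longrightarrow> (ell2_norm (S \<zeta>))\<^sup>2 \<le> K * (ell2_norm \<zeta>)\<^sup>2"
    using assms(1) by (rule bounded_on_ell2E) (rule that)
  obtain K' where K': "0 \<le> K'" "\<And>\<zeta>. \<zeta> \<in> ell2 \<Longrightarrow> T \<zeta> \<in> ell2"
    "\<And>\<zeta>. \<zeta> \<in> ell2 \<Longrightarrow> (ell2_norm (T \<zeta>))\<^sup>2 \<le> K' * (ell2_norm \<zeta>)\<^sup>2"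
    using assms(2) by (rule bounded_on_ell2E) (rule that)
  show ?thesis
  proof (rule bounded_on_ell2I)
    show "(ell2_norm (S (T \<zeta>)))\<^sup>2 \<le> K * K' * (ell2_norm \<zeta>)\<^sup>2" if "\<zeta> \<in> ell2" for \<zeta>
      using order_trans[OF K(3)[OF K'(2)[OF that]] mult_left_mono[OF K'(3)[OF that] K(1)]]
      by (simp add: mult.assoc)
  qed (use K K' in auto)
qed

lemma bounded_on_ell2_add:
  assumes "bounded_on_ell2 S" "bounded_on_ell2 T"
  shows "bounded_on_ell2 (\<lambda>\<zeta> i. S \<zeta> i + T \<zeta> i)"
proof -
  obtain K where K: "0 \<le> K" "\<And>\<zeta>. \<zeta> \<in> ell2 \<Longrightarrow> S \<zeta> \<in> ell2"
    "\<And>\<zeta>. \<zeta> \<in> ell2 \<Longrightarrow> (ell2_norm (S \<zeta>))\<^sup>2 \<le> K * (ell2_norm \<zeta>)\<^sup>2"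
    using assms(1) by (rule bounded_on_ell2E) (rule that)
  obtain K' where K': "0 \<le> K'" "\<And>\<zeta>. \<zeta> \<in> ell2 \<Longrightarrow> T \<zeta> \<in> ell2"
    "\<And>\<zeta>. \<zeta> \<in> ell2 \<Longrightarrow> (ell2_norm (T \<zeta>))\<^sup>2 \<le> K' * (ell2_norm \<zeta>)\<^sup>2"
    using assms(2) by (rule bounded_on_ell2E) (rule that)
  show ?thesis
  proof (rule bounded_on_ell2I)
    show "(ell2_norm (\<lambda>i. S \<zeta> i + T \<zeta> i))\<^sup>2 \<le> 2 * (K + K') * (ell2_norm \<zeta>)\<^sup>2" if "\<zeta> \<in> ell2" for \<zeta>
      using ell2_add(2)[OF K(2)[OF that] K'(2)[OF that]] K(3)[OF that] K'(3)[OF that]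
      by (simp add: algebra_simps)
  qed (use K K' in \<open>auto intro: ell2_add(1)\<close>)
qed

lemma bounded_on_ell2_sum:
  "(\<And>k. k \<in> A \<Longrightarrow> bounded_on_ell2 (S k)) \<Longrightarrow> bounded_on_ell2 (\<lambda>\<zeta> i. \<Sum>k\<in>A. S k \<zeta> i)"
proof (induction A rule: infinite_finite_induct)
  case (insert k A)
  then show ?case by (simp add: bounded_on_ell2_add)
qed (auto intro!: bounded_on_ell2I[of 0])

lemma bounded_on_ell2_rows:
  fixes T :: "('j \<Rightarrow> complex) \<Rightarrow> 'j \<Rightarrow> complex"
  assumes "bounded_op T"
  shows "bounded_on_ell2 (\<lambda>(\<zeta> :: 'i \<times> 'j \<Rightarrow> complex) (i, j). T (\<lambda>j'. \<zeta> (i, j')) j)"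
proof -
  obtain K where K: "\<And>\<xi>. \<xi> \<in> ell2 \<Longrightarrow> ell2_norm (T \<xi>) \<le> K * ell2_norm \<xi>"
    using assms unfolding bounded_op_def by blast
  have *: "(\<lambda>(i, j). T (\<lambda>j'. \<zeta> (i, j')) j) \<in> ell2 \<and>
      (ell2_norm (\<lambda>(i, j). T (\<lambda>j'. \<zeta> (i, j')) j))\<^sup>2 \<le> K\<^sup>2 * (ell2_norm \<zeta>)\<^sup>2"
    if \<zeta>: "\<zeta> \<in> ell2" for \<zeta> :: "'i \<times> 'j \<Rightarrow> complex"
  proof -
    have row: "(\<lambda>j. \<zeta> (i, j)) \<in> ell2" for i using ell2_prod(1)[THEN iffD1, OF \<zeta>] by simp
    have s: "(\<lambda>i. (ell2_norm (\<lambda>j. \<zeta> (i, j)))\<^sup>2) summable_on UNIV"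
        using ell2_prod(1)[THEN iffD1, OF \<zeta>] by simp
    have le: "(ell2_norm (T (\<lambda>j. \<zeta> (i, j))))\<^sup>2 \<le> K\<^sup>2 * (ell2_norm (\<lambda>j. \<zeta> (i, j)))\<^sup>2" for i
      using power_mono[OF K[OF row], where n = 2] by (simp add: power_mult_distrib)
    have s': "(\<lambda>i. (ell2_norm (T (\<lambda>j. \<zeta> (i, j))))\<^sup>2) summable_on UNIV"
      by (rule summable_on_comparison_test[OF summable_on_cmult_right[OF s] le]) simp
    have Z: "(\<lambda>(i, j). T (\<lambda>j'. \<zeta> (i, j')) j) \<in> ell2"
      unfolding ell2_prod(1) prod.case by (rule conjI, rule allI,
          rule bounded_opD(1)[OF assms row], rule s')
    have "(ell2_norm (\<lambda>(i, j). T (\<lambda>j'. \<zeta> (i, j')) j))\<^sup>2 = (\<Sum>\<^sub>\<infinity>i. (ell2_norm (T (\<lambda>j. \<zeta> (i, j))))\<^sup>2)"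
      using ell2_prod(2)[OF Z] unfolding prod.case .
    also have "\<dots> \<le> (\<Sum>\<^sub>\<infinity>i. K\<^sup>2 * (ell2_norm (\<lambda>j. \<zeta> (i, j)))\<^sup>2)"
      by (rule infsum_mono[OF s' summable_on_cmult_right[OF s] le])
    also have "\<dots> = K\<^sup>2 * (ell2_norm \<zeta>)\<^sup>2"
      unfolding infsum_cmult_right' ell2_prod(2)[OF \<zeta>] ..
    finally show ?thesis using Z by blast
  qed
  show ?thesis by (rule bounded_on_ell2I[of "K\<^sup>2"]) (use * in auto)
qed

lemma bounded_on_ell2_swap: "bounded_on_ell2 (\<lambda>\<zeta> x. \<zeta> (prod.swap x))"
  by (rule bounded_on_ell2I[of 1]) (simp_all add: ell2_swap)

lemma bounded_on_ell2_tensor_op: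
  fixes S :: "('i \<Rightarrow> complex) \<Rightarrow> 'i \<Rightarrow> complex" and T :: "('j \<Rightarrow> complex) \<Rightarrow> 'j \<Rightarrow> complex"
  assumes "bounded_op S" "bounded_op T"
  shows "bounded_on_ell2 (tensor_op S T)"
proof -
  define R where "R = (\<lambda>\<zeta> (i :: 'i, j). T (\<lambda>j'. \<zeta> (i, j')) j)"
  define C where "C = (\<lambda>\<zeta> (j :: 'j, i). S (\<lambda>i'. \<zeta> (j, i')) i)"
  have "tensor_op S T = (\<lambda>\<zeta> x. C (\<lambda>x. R \<zeta> (prod.swap x)) (prod.swap x))"
    by (auto simp: tensor_op_def R_def C_def)
  moreover have "bounded_on_ell2 (\<lambda>\<zeta> x. C (\<lambda>x. R \<zeta> (prod.swap x)) (prod.swap x))"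
    unfolding R_def C_def
    by (rule bounded_on_ell2_comp[OF bounded_on_ell2_swap bounded_on_ell2_comp[OF
          bounded_on_ell2_rows[OF assms(1)] bounded_on_ell2_comp[OF bounded_on_ell2_swap
          bounded_on_ell2_rows[OF assms(2)]]]])
  ultimately show ?thesis by simp
qed

lemma op_norm_least:
  assumes "\<And>\<xi>. \<xi> \<in> ell2 \<Longrightarrow> ell2_norm \<xi> \<le> 1 \<Longrightarrow> ell2_norm (T \<xi>) \<le> C"
  shows "op_norm T \<le> C"
  unfolding op_norm_def
proof (rule cSup_least)
  have "ell2_norm (T (\<lambda>i. 0)) \<in> {ell2_norm (T \<xi>) |\<xi>. \<xi> \<in> ell2 \<and> ell2_norm \<xi> \<le> 1}"
    by (intro CollectI exI[of _ "\<lambda>i. 0"]) simp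
  then show "{ell2_norm (T \<xi>) |\<xi>. \<xi> \<in> ell2 \<and> ell2_norm \<xi> \<le> 1} \<noteq> {}" by blast
qed (use assms in blast)

text \<open>
  The supremum that defines the operator norm has this meaning only if it is taken over a bounded
  set.
\<close>

lemma op_norm_upper:
  assumes "bounded_on_ell2 T" "\<xi> \<in> ell2" "ell2_norm \<xi> \<le> 1"
  shows "ell2_norm (T \<xi>) \<le> op_norm T"
  unfolding op_norm_def
proof (rule cSup_upper)
  obtain K where K: "0 \<le> K" "\<And>\<zeta>. \<zeta> \<in> ell2 \<Longrightarrow> (ell2_norm (T \<zeta>))\<^sup>2 \<le> K * (ell2_norm \<zeta>)\<^sup>2"
    using assms(1) by (rule bounded_on_ell2E) (rule that)
  have "ell2_norm (T \<zeta>) \<le> sqrt K" if "\<zeta> \<in> ell2" "ell2_norm \<zeta> \<le> 1" for \<zeta>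
  proof (rule real_le_rsqrt)
    have "K * (ell2_norm \<zeta>)\<^sup>2 \<le> K * 1"
      using that(2) K(1) by (intro mult_left_mono) (simp_all add: power_le_one)
    with K(2)[OF that(1)] show "(ell2_norm (T \<zeta>))\<^sup>2 \<le> K" by simp
  qed
  then show "bdd_above {ell2_norm (T \<xi>) |\<xi>. \<xi> \<in> ell2 \<and> ell2_norm \<xi> \<le> 1}"
    by (intro bdd_aboveI[of _ "sqrt K"]) blast
qed (use assms in blast)

lemma faithful_repD:
  assumes "faithful_rep \<pi>"
  shows "bounded_op (\<pi> a)" "op_norm (\<pi> a) = norm a"
    "\<xi> \<in> ell2 \<Longrightarrow> \<pi> a \<xi> \<in> ell2"
    "\<xi> \<in> ell2 \<Longrightarrow> \<pi> (a + b) \<xi> = (\<lambda>i. \<pi> a \<xi> i + \<pi> b \<xi> i)"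
    "\<xi> \<in> ell2 \<Longrightarrow> \<pi> (c *\<^sub>C a) \<xi> = (\<lambda>i. c * \<pi> a \<xi> i)"
    "\<xi> \<in> ell2 \<Longrightarrow> \<pi> (a * b) \<xi> = \<pi> a (\<pi> b \<xi>)"
    "\<xi> \<in> ell2 \<Longrightarrow> \<pi> 1 \<xi> = \<xi>"
    "\<xi> \<in> ell2 \<Longrightarrow> \<eta> \<in> ell2 \<Longrightarrow> ell2_inner (\<pi> (star a) \<xi>) \<eta> = ell2_inner \<xi> (\<pi> a \<eta>)"
    "\<xi> \<in> ell2 \<Longrightarrow> \<pi> 0 \<xi> = (\<lambda>i. 0)"
proof -
  note rep = assms[unfolded faithful_rep_def]
  show b: "bounded_op (\<pi> a)" for a using rep by simp
  then show "\<pi> a \<xi> \<in> ell2" if "\<xi> \<in> ell2" using that by (rule bounded_opD(1))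
  show "op_norm (\<pi> a) = norm a" using rep by simp
  show "\<pi> (a + b) \<xi> = (\<lambda>i. \<pi> a \<xi> i + \<pi> b \<xi> i)" if "\<xi> \<in> ell2"
    using that rep[THEN conjunct2, THEN conjunct1] by simp
  have scale: "\<pi> (c *\<^sub>C a) \<xi> = (\<lambda>i. c * \<pi> a \<xi> i)" if "\<xi> \<in> ell2" for c a
    using that rep[THEN conjunct2, THEN conjunct2, THEN conjunct1] by simp
  then show "\<pi> (c *\<^sub>C a) \<xi> = (\<lambda>i. c * \<pi> a \<xi> i)" if "\<xi> \<in> ell2" using that by simp
  show "\<pi> 0 \<xi> = (\<lambda>i. 0)" if "\<xi> \<in> ell2" using scale[OF that, of 0 0] by simp
  show "\<pi> (a * b) \<xi> = \<pi> a (\<pi> b \<xi>)" if "\<xi> \<in> ell2"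
    using that rep[THEN conjunct2, THEN conjunct2, THEN conjunct2, THEN conjunct1] by simp
  show "\<pi> 1 \<xi> = \<xi>" if "\<xi> \<in> ell2"
    using that rep[THEN conjunct2, THEN conjunct2, THEN conjunct2, THEN conjunct2, THEN conjunct1]
        by simp
  show "ell2_inner (\<pi> (star a) \<xi>) \<eta> = ell2_inner \<xi> (\<pi> a \<eta>)" if "\<xi> \<in> ell2" "\<eta> \<in> ell2"
    using that rep[THEN conjunct2, THEN conjunct2, THEN conjunct2, THEN conjunct2, THEN conjunct2,
        THEN conjunct1] by simp
qed

lemma faithful_rep_sum:
  assumes "faithful_rep \<pi>" "\<xi> \<in> ell2"
  shows "\<pi> (\<Sum>k\<in>K. c k *\<^sub>C a k) \<xi> = (\<lambda>i. \<Sum>k\<in>K. c k * \<pi> (a k) \<xi> i)"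
proof (induction K rule: infinite_finite_induct)
  case (insert k K)
  then show ?case using assms by (simp add: faithful_repD)
qed (use assms in \<open>simp_all add: faithful_repD\<close>)

lemma vector_functional_mult:
  assumes "faithful_rep \<rho>" "\<xi> \<in> ell2"
  shows "ell2_inner (\<rho> (star a * b) \<xi>) \<xi> = ell2_inner (\<rho> b \<xi>) (\<rho> a \<xi>)"
  using assms by (simp add: faithful_repD(3,6,8))

lemma vector_state:
  assumes \<rho>: "faithful_rep \<rho>" and \<xi>: "\<xi> \<in> ell2" "ell2_norm \<xi> = 1"
  shows "state (\<lambda>b. ell2_inner (\<rho> b \<xi>) \<xi>)"
proof -
  have "clinear_map (\<lambda>b. ell2_inner (\<rho> b \<xi>) \<xi>)"
    unfolding clinear_map_def
    using \<rho> \<xi>(1) by (simp add: faithful_repD(3-5) ell2_inner_add ell2_inner_scale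
        scaleC_complex_def)
  moreover have "ell2_inner (\<rho> 1 \<xi>) \<xi> = 1"
    using \<rho> \<xi> by (simp add: faithful_repD(7) ell2_inner_self)
  ultimately show ?thesis
    using \<rho> \<xi>(1) unfolding state_def
    by (simp add: vector_functional_mult ell2_inner_self faithful_repD(3) flip: of_real_power)
qed

text \<open>
  A vector space over an infinite field is not a finite union of proper subspaces: on a line
  \<open>x + n z\<close> with suitable \<open>x\<close> and \<open>z\<close> each of the subspaces contains at most one point.
\<close>

lemma subspaces_avoid:
  fixes \<K> :: "('i \<Rightarrow> complex) set set" and V :: "('i \<Rightarrow> complex) set"
  assumes V: "\<And>x y c. x \<in> V \<Longrightarrow> y \<in> V \<Longrightarrow> (\<lambda>i. x i + c * y i) \<in> V" and ne: "V \<noteq> {}"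
    and "finite \<K>"
    and sub: "\<And>K x y c. K \<in> \<K> \<Longrightarrow> x \<in> K \<Longrightarrow> y \<in> K \<Longrightarrow> (\<lambda>i. x i + c * y i) \<in> K"
    and scale: "\<And>K x c. K \<in> \<K> \<Longrightarrow> x \<in> K \<Longrightarrow> (\<lambda>i. c * x i) \<in> K"
    and proper: "\<And>K. K \<in> \<K> \<Longrightarrow> \<exists>x\<in>V. x \<notin> K"
  shows "\<exists>x\<in>V. \<forall>K\<in>\<K>. x \<notin> K"
  using assms(3-)
proof (induction \<K> rule: finite_induct)
  case empty
  show ?case using ne by auto
next
  case (insert K0 \<K>)
  have "\<exists>x\<in>V. \<forall>K\<in>\<K>. x \<notin> K"
  proof (rule insert.IH)
    show "(\<lambda>i. x i + c * y i) \<in> K" if "K \<in> \<K>" "x \<in> K" "y \<in> K" for K x y c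
      using that by (intro insert.prems(1)) simp_all
    show "(\<lambda>i. c * x i) \<in> K" if "K \<in> \<K>" "x \<in> K" for K x c
      using that by (intro insert.prems(2)) simp_all
    show "\<exists>x\<in>V. x \<notin> K" if "K \<in> \<K>" for K
      using that by (intro insert.prems(3)) simp_all
  qed
  then obtain x where x: "x \<in> V" "\<forall>K\<in>\<K>. x \<notin> K" by blast
  obtain z where z: "z \<in> V" "z \<notin> K0" using insert.prems(3)[of K0] by blast
  \<comment> \<open>The vector \<open>x\<close> avoids all members of \<open>\<K>\<close>, and \<open>z\<close> avoids \<open>K0\<close>.\<close>
  define f where "f n = (\<lambda>i. x i + of_nat n * z i)" for n :: nat
  have uniq: "n = m" if K: "K \<in> insert K0 \<K>" and nm: "f n \<in> K" "f m \<in> K" for n m K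
  proof (rule ccontr)
    assume "n \<noteq> m"
    have "(\<lambda>i. f n i + (-1) * f m i) \<in> K" using insert.prems(1)[OF K nm] .
    then have "(\<lambda>i. (1 / (of_nat n - of_nat m)) * (f n i + (-1) * f m i)) \<in> K"
      by (rule insert.prems(2)[OF K])
    moreover have "(1 / (of_nat n - of_nat m)) * (f n i + (-1) * f m i) = z i" for i
      using \<open>n \<noteq> m\<close> by (simp add: f_def field_simps)
    ultimately have zK: "z \<in> K" by simp
    have "(\<lambda>i. f n i + (- of_nat n) * z i) \<in> K" using insert.prems(1)[OF K nm(1) zK] .
    then have xK: "x \<in> K" by (simp add: f_def)
    show False using K z x zK xK by blast
  qed
  have "finite {n. f n \<in> K}" if "K \<in> insert K0 \<K>" for K
  proof (cases "{n. f n \<in> K} = {}")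
    case False
    then obtain m where "f m \<in> K" by blast
    then have "{n. f n \<in> K} \<subseteq> {m}" using uniq[OF that] by blast
    then show ?thesis by (rule finite_subset) simp
  qed simp
  then have "finite (\<Union>K\<in>insert K0 \<K>. {n. f n \<in> K})"
    using insert.hyps(1) by blast
  then obtain n where "n \<notin> (\<Union>K\<in>insert K0 \<K>. {n. f n \<in> K})"
    using ex_new_if_finite[OF infinite_UNIV_nat] by blast
  moreover have "f n \<in> V" unfolding f_def by (rule V[OF x(1) z(1)])
  ultimately show ?case by blast
qed

text \<open>
  The kernels of finitely many nonzero operators are proper subspaces, so they do not cover the
  space.
\<close>

lemma separating_vector:
  fixes \<rho> :: "'a::cstar_algebra \<Rightarrow> ('b \<Rightarrow> complex) \<Rightarrow> ('b \<Rightarrow> complex)"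
  assumes \<rho>: "faithful_rep \<rho>" and "finite F" "0 \<notin> F"
  obtains \<xi> where "\<xi> \<in> ell2" "ell2_norm \<xi> = 1" "\<forall>a\<in>F. \<rho> a \<xi> \<noteq> (\<lambda>i. 0)"
proof -
  define ker where "ker a = {x \<in> ell2. \<rho> a x = (\<lambda>i. 0)}" for a
  note bop = faithful_repD(1)[OF \<rho>]
  have ker_scale: "(\<lambda>i. c * x i) \<in> ker a" if "x \<in> ker a" for a x c
    using that bounded_opD(2)[OF bop, of x a c] by (auto simp: ker_def intro: ell2_scale(1))
  have ker_add: "(\<lambda>i. x i + c * y i) \<in> ker a" if x: "x \<in> ker a" "y \<in> ker a" for a x y c
  proof -
    have e: "x \<in> ell2" "(\<lambda>i. c * y i) \<in> ell2" and z: "\<rho> a (\<lambda>i. c * y i) = (\<lambda>i. 0)" "\<rho> a x = (\<lambda>i. 0)"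
      using x ker_scale[OF x(2), of c] by (auto simp: ker_def)
    have "\<forall>x\<in>ell2. \<forall>y\<in>ell2. \<rho> a (\<lambda>i. x i + y i) = (\<lambda>i. \<rho> a x i + \<rho> a y i)"
      using bop[of a] unfolding bounded_op_def by (elim conjE)
    from this[rule_format, OF e]
    have "\<rho> a (\<lambda>i. x i + c * y i) = (\<lambda>i. \<rho> a x i + \<rho> a (\<lambda>i. c * y i) i)" .
    then show ?thesis using e z by (simp add: ker_def ell2_add(1))
  qed
  have proper: "\<exists>x\<in>ell2. x \<notin> ker a" if "a \<in> F" for a
  proof (rule ccontr)
    assume "\<not> ?thesis"
    then have "op_norm (\<rho> a) \<le> 0" by (intro op_norm_least) (auto simp: ker_def)
    then show False using that assms(3) by (auto simp: faithful_repD(2)[OF \<rho>])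
  qed
  have "\<exists>x\<in>ell2. \<forall>K\<in>ker ` F. x \<notin> K"
  proof (rule subspaces_avoid)
    show "(\<lambda>i. x i + c * y i) \<in> ell2" if "x \<in> ell2" "y \<in> ell2" for x y :: "'b \<Rightarrow> complex" and c
      by (rule ell2_add(1)[OF that(1) ell2_scale(1)[OF that(2)]])
    show "ell2 \<noteq> ({} :: ('b \<Rightarrow> complex) set)" using ell2_zero(1) by blast
    show "finite (ker ` F)" using assms(2) by simp
    show "(\<lambda>i. x i + c * y i) \<in> K" if K: "K \<in> ker ` F" and xy: "x \<in> K" "y \<in> K" for K x y c
    proof -
      obtain a where a: "K = ker a" using K by (rule imageE)
      show ?thesis using xy unfolding a by (rule ker_add)
    qed
    show "(\<lambda>i. c * x i) \<in> K" if K: "K \<in> ker ` F" and x: "x \<in> K" for K x c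
    proof -
      obtain a where a: "K = ker a" using K by (rule imageE)
      show ?thesis using x unfolding a by (rule ker_scale)
    qed
    show "\<exists>x\<in>ell2. x \<notin> K" if K: "K \<in> ker ` F" for K
    proof -
      obtain a where a: "K = ker a" "a \<in> F" using K by (rule imageE)
      show ?thesis unfolding a(1) by (rule proper[OF a(2)])
    qed
  qed
  then obtain x where x_ell2: "x \<in> ell2" and "\<forall>K\<in>ker ` F. x \<notin> K" by (rule bexE)
  then have "x \<notin> ker a" if "a \<in> F" for a using that by simp
  note x = x_ell2 this
  show ?thesis
  proof (cases "F = {}")
    case True
    then show ?thesis by (intro that[OF ell2_unit_vector(1,2)]) simp
  next
    case False
    have "ell2_norm x \<noteq> 0"
    proof
      assume "ell2_norm x = 0"
      then have "x = (\<lambda>i. 0 * x i)" using ell2_norm_eq_0[OF x(1)] by auto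
      moreover have "\<rho> a (\<lambda>i. 0 * x i) = (\<lambda>i. 0 * \<rho> a x i)" for a
          by (rule bounded_opD(2)[OF bop x(1)])
      ultimately have "\<rho> a x = (\<lambda>i. 0)" for a by simp
      moreover obtain a where "a \<in> F" using False by auto
      ultimately show False using x by (simp add: ker_def)
    qed
    define \<xi> where "\<xi> = (\<lambda>i. of_real (1 / ell2_norm x) * x i)"
    show ?thesis
    proof (rule that)
      show "\<xi> \<in> ell2" unfolding \<xi>_def by (rule ell2_scale(1)[OF x(1)])
      show "ell2_norm \<xi> = 1"
        unfolding \<xi>_def ell2_scale(2)[OF x(1)] using \<open>ell2_norm x \<noteq> 0\<close> by (simp add: norm_divide)
      show "\<forall>a\<in>F. \<rho> a \<xi> \<noteq> (\<lambda>i. 0)"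
      proof (intro ballI notI)
        fix a assume a: "a \<in> F" and "\<rho> a \<xi> = (\<lambda>i. 0)"
        then have "\<xi> \<in> ker a" using \<open>\<xi> \<in> ell2\<close> by (simp add: ker_def)
        from ker_scale[OF this, of "of_real (ell2_norm x)"] have "x \<in> ker a"
          using \<open>ell2_norm x \<noteq> 0\<close> by (simp add: \<xi>_def)
        with x(2)[OF a] show False by simp
      qed
    qed
  qed
qed


section \<open>Slices of the minimal tensor product\<close>

text \<open>
  Extension by continuity of a map that is given by a densely defined graph. The norm bound makes
  the closure of the graph single-valued.
\<close>

lemma extend_bounded_graph:
  fixes R :: "('c::cstar_algebra \<times> 'a::cstar_algebra) set"
  assumes add: "\<And>x y x' y'. (x, y) \<in> R \<Longrightarrow> (x', y') \<in> R \<Longrightarrow> (x + x', y + y') \<in> R"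
    and scale: "\<And>c x y. (x, y) \<in> R \<Longrightarrow> (c *\<^sub>C x, c *\<^sub>C y) \<in> R"
    and bound: "\<And>x y. (x, y) \<in> R \<Longrightarrow> norm y \<le> norm x"
    and dense: "closure (fst ` R) = UNIV"
  obtains L where "clinear_map L" "\<And>x. norm (L x) \<le> norm x" "\<And>x y. (x, y) \<in> R \<Longrightarrow> L x = y"
proof -
  define G where "G = closure R"
  have diff: "(x - x', y - y') \<in> R" if "(x, y) \<in> R" "(x', y') \<in> R" for x y x' y'
    using add[OF that(1) scale[OF that(2), of "-1"]]
    by (simp add: complex_module.scale_minus_left complex_module.scale_one)
  have G_add: "(x + x', y + y') \<in> G" if xy: "(x, y) \<in> G" "(x', y') \<in> G" for x y x' y'
  proof -
    obtain p where p: "\<forall>n. p n \<in> R" "p \<longlonglongrightarrow> (x, y)"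
      using xy(1)[unfolded G_def closure_sequential] by auto
    obtain q where q: "\<forall>n. q n \<in> R" "q \<longlonglongrightarrow> (x', y')"
      using xy(2)[unfolded G_def closure_sequential] by auto
    have "\<forall>n. p n + q n \<in> R" using p(1) q(1) add by (metis plus_prod_def prod.collapse)
    moreover have "(\<lambda>n. p n + q n) \<longlonglongrightarrow> (x + x', y + y')" using tendsto_add[OF p(2) q(2)] by simp
    ultimately show ?thesis unfolding G_def closure_sequential
        by (intro exI[of _ "\<lambda>n. p n + q n"]) simp
  qed
  have G_scale: "(c *\<^sub>C x, c *\<^sub>C y) \<in> G" if xy: "(x, y) \<in> G" for c x y
  proof -
    obtain p where p: "\<forall>n. p n \<in> R" "p \<longlonglongrightarrow> (x, y)"
      using xy[unfolded G_def closure_sequential] by auto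
    have "\<forall>n. (c *\<^sub>C fst (p n), c *\<^sub>C snd (p n)) \<in> R" using p(1) scale by (metis prod.collapse)
    moreover have "(\<lambda>n. (c *\<^sub>C fst (p n), c *\<^sub>C snd (p n))) \<longlonglongrightarrow> (c *\<^sub>C x, c *\<^sub>C y)"
      using tendsto_fst[OF p(2)] tendsto_snd[OF p(2)]
      by (intro tendsto_Pair tendsto_scaleC) simp_all
    ultimately show ?thesis unfolding G_def closure_sequential
      by (intro exI[of _ "\<lambda>n. (c *\<^sub>C fst (p n), c *\<^sub>C snd (p n))"]) simp
  qed
  have G_bound: "norm y \<le> norm x" if "(x, y) \<in> G" for x y
  proof -
    have "closed {p :: 'c \<times> 'a. norm (snd p) \<le> norm (fst p)}"
      by (intro closed_Collect_le continuous_intros)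
    then have "G \<subseteq> {p. norm (snd p) \<le> norm (fst p)}"
      unfolding G_def using bound by (intro closure_minimal) auto
    with that show ?thesis by auto
  qed
  have "\<exists>y. (x, y) \<in> G" for x
  proof -
    obtain u where u: "\<forall>n. u n \<in> fst ` R" "u \<longlonglongrightarrow> x"
      using dense closure_sequential[of x "fst ` R"] by auto
    then have "\<forall>n. \<exists>y. (u n, y) \<in> R" by force
    then obtain v where v: "\<And>n. (u n, v n) \<in> R" by metis
    have "Cauchy u" using u(2) by (rule LIMSEQ_imp_Cauchy)
    have "Cauchy v"
    proof (rule CauchyI)
      fix e :: real assume "0 < e"
      then obtain M where "\<forall>m\<ge>M. \<forall>n\<ge>M. norm (u m - u n) < e" using CauchyD[OF \<open>Cauchy u\<close>] by blast
      moreover have "norm (v m - v n) \<le> norm (u m - u n)" for m n by (rule bound[OF diff[OF v v]])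
      ultimately show "\<exists>M. \<forall>m\<ge>M. \<forall>n\<ge>M. norm (v m - v n) < e" by (meson order.strict_trans1)
    qed
    then obtain y where "v \<longlonglongrightarrow> y" using Cauchy_convergent_iff convergent_def by blast
    then have "(\<lambda>n. (u n, v n)) \<longlonglongrightarrow> (x, y)" using u(2) by (intro tendsto_Pair)
    then have "(x, y) \<in> G"
      unfolding G_def closure_sequential using v by (intro exI[of _ "\<lambda>n. (u n, v n)"]) simp
    then show ?thesis by blast
  qed
  then obtain L where L: "\<And>x. (x, L x) \<in> G" by metis
  have unique: "y = L x" if "(x, y) \<in> G" for x y
    using G_bound[OF G_add[OF that G_scale[OF L, of "-1" x]]] 
    by (simp add: complex_module.scale_minus_left complex_module.scale_one)
  show ?thesis
  proof (rule that[of L])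
    show "clinear_map L"
      unfolding clinear_map_def using unique[OF G_add[OF L L]] unique[OF G_scale[OF L]] by metis
    show "L x = y" if "(x, y) \<in> R" for x y
      using unique that closure_subset[of R] unfolding G_def by blast
  qed (use G_bound L in auto)
qed

lemma min_tensorD:
  assumes "min_tensor t"
  shows "clinear_map (\<lambda>a. t a b)" "clinear_map (t a)" "t a b * t c d = t (a * c) (b * d)"
    "star (t a b) = t (star a) (star b)" "t 1 1 = 1" "closure (cspan {t a b |a b. True}) = UNIV"
  using assms by (auto simp: min_tensor_def)

text \<open>
  Representations that compute the norm of the minimal tensor product. Their index types are those
  in the definition of \<^const>\<open>min_tensor\<close>.
\<close>

definition spatial_reps ::
    "('a::cstar_algebra \<Rightarrow> 'b::cstar_algebra \<Rightarrow> 'c::cstar_algebra) \<Rightarrow>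
     ('a \<Rightarrow> ('a \<Rightarrow> complex) \<Rightarrow> ('a \<Rightarrow> complex)) \<Rightarrow> ('b \<Rightarrow> ('b \<Rightarrow> complex) \<Rightarrow> ('b \<Rightarrow> complex)) \<Rightarrow> bool" where
  "spatial_reps t \<pi> \<rho> \<longleftrightarrow> faithful_rep \<pi> \<and> faithful_rep \<rho> \<and>
     (\<forall>n::nat. \<forall>a b. norm (\<Sum>k<n. t (a k) (b k)) =
        op_norm (\<lambda>\<zeta> x. \<Sum>k<n. tensor_op (\<pi> (a k)) (\<rho> (b k)) \<zeta> x))"

lemma min_tensor_spatial_reps:
  fixes t :: "'a::cstar_algebra \<Rightarrow> 'b::cstar_algebra \<Rightarrow> 'c::cstar_algebra"
  assumes "min_tensor t"
  obtains \<pi> :: "'a \<Rightarrow> ('a \<Rightarrow> complex) \<Rightarrow> ('a \<Rightarrow> complex)"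
      and \<rho> :: "'b \<Rightarrow> ('b \<Rightarrow> complex) \<Rightarrow> ('b \<Rightarrow> complex)"
  where "spatial_reps t \<pi> \<rho>"
proof -
  have "\<exists>(\<pi> :: 'a \<Rightarrow> ('a \<Rightarrow> complex) \<Rightarrow> ('a \<Rightarrow> complex)) (\<rho> :: 'b \<Rightarrow> ('b \<Rightarrow> complex) \<Rightarrow> ('b \<Rightarrow> complex)).
      spatial_reps t \<pi> \<rho>"
    using assms unfolding min_tensor_def spatial_reps_def by (elim conjE) assumption
  with that show ?thesis by blast
qed

text \<open>
  If \<open>Z = (\<Sum> \<pi>(a\<^sub>k) \<otimes> \<rho>(b\<^sub>k))(u \<otimes> \<xi>)\<close>, then the vector \<open>\<Sum> \<langle>\<rho>(b\<^sub>k)\<xi>, \<eta>\<rangle> \<pi>(a\<^sub>k)u\<close> has the inner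
  products of the rows of \<open>Z\<close> with \<open>\<eta>\<close> as its coordinates, so its norm is at most that of \<open>Z\<close>.
\<close>

lemma vector_slice_bound:
  fixes t :: "'a::cstar_algebra \<Rightarrow> 'b::cstar_algebra \<Rightarrow> 'c::cstar_algebra"
  assumes reps: "spatial_reps t \<pi> \<rho>"
    and \<xi>: "\<xi> \<in> ell2" "ell2_norm \<xi> \<le> 1" and \<eta>: "\<eta> \<in> ell2" "ell2_norm \<eta> \<le> 1"
  shows "norm (\<Sum>k<(n::nat). ell2_inner (\<rho> (b k) \<xi>) \<eta> *\<^sub>C a k) \<le> norm (\<Sum>k<n. t (a k) (b k))"
proof -
  have \<pi>: "faithful_rep \<pi>" and \<rho>: "faithful_rep \<rho>"
    using reps by (simp_all add: spatial_reps_def)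
  define y where "y = (\<Sum>k<n. ell2_inner (\<rho> (b k) \<xi>) \<eta> *\<^sub>C a k)"
  define S where "S = (\<lambda>\<zeta> x. \<Sum>k<n. tensor_op (\<pi> (a k)) (\<rho> (b k)) \<zeta> x)"
  have S: "bounded_on_ell2 S"
    unfolding S_def by (intro bounded_on_ell2_sum bounded_on_ell2_tensor_op faithful_repD(1) \<pi> \<rho>)
  have "op_norm (\<pi> y) \<le> op_norm S"
  proof (rule op_norm_least)
    fix u :: "'a \<Rightarrow> complex" assume u: "u \<in> ell2" "ell2_norm u \<le> 1"
    define Z where "Z = S (\<lambda>(i, j). u i * \<xi> j)"
    have "ell2_norm u * ell2_norm \<xi> \<le> 1" using u \<xi> by (intro mult_le_one) auto
    then have Zle: "ell2_norm Z \<le> op_norm S"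
      unfolding Z_def using u \<xi> by (intro op_norm_upper[OF S]) (simp_all add: ell2_tensor)
    have Z: "Z \<in> ell2"
      using S ell2_tensor(1)[OF u(1) \<xi>(1)] unfolding Z_def by (elim bounded_on_ell2E) blast
    have col: "\<rho> (b k) \<xi> \<in> ell2" for k by (rule faithful_repD(3)[OF \<rho> \<xi>(1)])
    have Zeq: "Z (i, j) = (\<Sum>k<n. \<pi> (a k) u i * \<rho> (b k) \<xi> j)" for i j
    proof -
      have "\<pi> (a k) (\<lambda>i. u i * c) = (\<lambda>i. \<pi> (a k) u i * c)" for k c
        using bounded_opD(2)[OF faithful_repD(1)[OF \<pi>] u(1), of "a k" c] by (simp add: mult.commute)
      then show ?thesis
        by (simp add: Z_def S_def tensor_op_def bounded_opD(2)[OF faithful_repD(1)[OF \<rho>] \<xi>(1)])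
    qed
    have row: "\<pi> y u i = ell2_inner (\<lambda>j. Z (i, j)) \<eta>" for i
    proof -
      have "ell2_inner (\<lambda>j. Z (i, j)) \<eta> = (\<Sum>k<n. \<pi> (a k) u i * ell2_inner (\<rho> (b k) \<xi>) \<eta>)"
        unfolding Zeq using col \<eta>(1) by (subst ell2_inner_sum)
            (simp_all add: ell2_scale ell2_inner_scale)
      then show ?thesis by (simp add: y_def faithful_rep_sum[OF \<pi> u(1)] mult.commute)
    qed
    have "(cmod (\<pi> y u i))\<^sup>2 \<le> (ell2_norm (\<lambda>j. Z (i, j)))\<^sup>2" for i
    proof (rule power_mono)
      have "(\<lambda>j. Z (i, j)) \<in> ell2" using ell2_prod(1)[THEN iffD1, OF Z] by simp
      then have "cmod (\<pi> y u i) \<le> ell2_norm (\<lambda>j. Z (i, j)) * ell2_norm \<eta>"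
        unfolding row using \<eta>(1) by (rule ell2_cauchy_schwarz)
      also have "\<dots> \<le> ell2_norm (\<lambda>j. Z (i, j)) * 1"
        using \<eta>(2) by (intro mult_left_mono) auto
      finally show "cmod (\<pi> y u i) \<le> ell2_norm (\<lambda>j. Z (i, j))" by simp
    qed simp
    then have "(ell2_norm (\<pi> y u))\<^sup>2 \<le> (\<Sum>\<^sub>\<infinity>i. (ell2_norm (\<lambda>j. Z (i, j)))\<^sup>2)"
      using ell2_prod(1)[THEN iffD1, OF Z] by (intro ell2_dominated(2)) simp_all
    also have "\<dots> = (ell2_norm Z)\<^sup>2" by (rule ell2_prod(2)[OF Z, symmetric])
    finally have "ell2_norm (\<pi> y u) \<le> ell2_norm Z" by (rule power2_le_imp_le) simp
    with Zle show "ell2_norm (\<pi> y u) \<le> op_norm S" by simp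
  qed
  then have "norm y \<le> norm (\<Sum>k<n. t (a k) (b k))"
    using reps unfolding spatial_reps_def S_def by (simp add: faithful_repD(2))
  then show ?thesis by (simp add: y_def)
qed

lemma tensor_induct:
  assumes "min_tensor t" and closed: "closed {x. P x}" and tensor: "\<And>a b. P (t a b)"
    and add: "\<And>x y. P x \<Longrightarrow> P y \<Longrightarrow> P (x + y)" and scale: "\<And>c x. P x \<Longrightarrow> P (c *\<^sub>C x)"
  shows "P x"
proof -
  have "P 0" using scale[OF tensor, of 0] by simp
  then have "cspan {t a b |a b. True} \<subseteq> {x. P x}"
    unfolding cspan_def
    by (intro complex_module.span_minimal complex_module.subspaceI) (auto intro: add scale tensor)
  then have "closure (cspan {t a b |a b. True}) \<subseteq> {x. P x}" using closed by (rule closure_minimal)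
  then show ?thesis using min_tensorD(6)[OF assms(1)] by blast
qed

lemma sum_lessThan_append:
  fixes h :: "'x \<Rightarrow> 'y \<Rightarrow> 'z::comm_monoid_add" and n m :: nat
  shows "(\<Sum>k<n + m. h (if k < n then a k else c (k - n)) (if k < n then b k else d (k - n))) =
    (\<Sum>k<n. h (a k) (b k)) + (\<Sum>k<m. h (c k) (d k))"
  by (induction m) (simp_all add: add.assoc)

lemma tensor_sum_induct:
  assumes t: "min_tensor t" and closed: "closed {x. P x}"
    and sum: "\<And>(n::nat) a b. P (\<Sum>k<n. t (a k) (b k))"
  shows "P x"
proof -
  note lin = clinear_mapD[OF min_tensorD(1)[OF t]]
  define D where "D = {\<Sum>k<n. t (a k) (b k) |(n::nat) a b. True}"
  have mem: "(\<Sum>k<n. t (a k) (b k)) \<in> D" for n :: nat and a b unfolding D_def by blast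
  have "cspan {t a b |a b. True} \<subseteq> D"
    unfolding cspan_def
  proof (intro complex_module.span_minimal complex_module.subspaceI)
    show "0 \<in> D" using mem[of _ _ 0] by simp
    show "x + y \<in> D" if xy: "x \<in> D" "y \<in> D" for x y
    proof -
      obtain n :: nat and a b where 1: "x = (\<Sum>k<n. t (a k) (b k))"
        using xy(1) unfolding D_def mem_Collect_eq by (elim exE conjE) (use that in blast)
      obtain m :: nat and c d where 2: "y = (\<Sum>k<m. t (c k) (d k))"
        using xy(2) unfolding D_def mem_Collect_eq by (elim exE conjE) (use that in blast)
      show ?thesis
        using mem[of "\<lambda>k. if k < n then a k else c (k - n)" "\<lambda>k. if k < n then b k else d (k - n)"
            "n + m"]
        unfolding 1 2 sum_lessThan_append[where h = t] .
    qed
    show "c *\<^sub>C x \<in> D" if x: "x \<in> D" for c x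
    proof -
      obtain n :: nat and a b where 1: "x = (\<Sum>k<n. t (a k) (b k))"
        using x unfolding D_def mem_Collect_eq by (elim exE conjE) (use that in blast)
      show ?thesis
        using mem[of "\<lambda>k. c *\<^sub>C a k" b n] unfolding 1
        by (simp add: lin(2) complex_module.scale_sum_right)
    qed
    show "{t a b |a b. True} \<subseteq> D" using mem[of "\<lambda>_. _" "\<lambda>_. _" 1] by auto
  qed
  also have "D \<subseteq> {x. P x}" using sum unfolding D_def by blast
  finally have "closure (cspan {t a b |a b. True}) \<subseteq> {x. P x}" using closed
      by (rule closure_minimal)
  then show ?thesis using min_tensorD(6)[OF t] by blast
qed

lemma vector_slice_exists:
  assumes t: "min_tensor t" and reps: "spatial_reps t \<pi> \<rho>"
    and \<xi>: "\<xi> \<in> ell2" "ell2_norm \<xi> \<le> 1" and \<eta>: "\<eta> \<in> ell2" "ell2_norm \<eta> \<le> 1"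
  obtains L where "clinear_map L" "\<And>x. norm (L x) \<le> norm x"
    "\<And>a b. L (t a b) = ell2_inner (\<rho> b \<xi>) \<eta> *\<^sub>C a"
proof -
  note lin = clinear_mapD[OF min_tensorD(1)[OF t]]
  define \<omega> where "\<omega> b = ell2_inner (\<rho> b \<xi>) \<eta>" for b
  define R where "R = {(\<Sum>k<n. t (a k) (b k), \<Sum>k<n. \<omega> (b k) *\<^sub>C a k) |(n::nat) a b. True}"
  have mem: "(\<Sum>k<n. t (a k) (b k), \<Sum>k<n. \<omega> (b k) *\<^sub>C a k) \<in> R" for n :: nat and a b
    unfolding R_def by blast
  have add: "(x + x', y + y') \<in> R" if xy: "(x, y) \<in> R" "(x', y') \<in> R" for x y x' y'
  proof -
    obtain n :: nat and a b where 1: "x = (\<Sum>k<n. t (a k) (b k))" "y = (\<Sum>k<n. \<omega> (b k) *\<^sub>C a k)"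
      using xy(1) unfolding R_def mem_Collect_eq prod.inject by (elim exE conjE) (use that in blast)
    obtain m :: nat and c d where 2: "x' = (\<Sum>k<m. t (c k) (d k))" "y' = (\<Sum>k<m. \<omega> (d k) *\<^sub>C c k)"
      using xy(2) unfolding R_def mem_Collect_eq prod.inject by (elim exE conjE) (use that in blast)
    show ?thesis
      using mem[of "\<lambda>k. if k < n then a k else c (k - n)" "\<lambda>k. if k < n then b k else d (k - n)"
          "n + m"]
      unfolding 1 2 sum_lessThan_append[where h = t] sum_lessThan_append[where h =
          "\<lambda>a b. \<omega> b *\<^sub>C a"] .
  qed
  have scale: "(c *\<^sub>C x, c *\<^sub>C y) \<in> R" if xy: "(x, y) \<in> R" for c x y
  proof -
    obtain n :: nat and a b where 1: "x = (\<Sum>k<n. t (a k) (b k))" "y = (\<Sum>k<n. \<omega> (b k) *\<^sub>C a k)"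
      using xy unfolding R_def mem_Collect_eq prod.inject by (elim exE conjE) (use that in blast)
    show ?thesis
      using mem[of "\<lambda>k. c *\<^sub>C a k" b n] unfolding 1
      by (simp add: lin(2) complex_module.scale_sum_right mult.commute)
  qed
  have bound: "norm y \<le> norm x" if "(x, y) \<in> R" for x y
    using that vector_slice_bound[OF reps \<xi> \<eta>] unfolding R_def \<omega>_def by blast
  have tensor: "(t a b, \<omega> b *\<^sub>C a) \<in> R" for a b
    using mem[of "\<lambda>_. a" "\<lambda>_. b" 1] by simp
  have "x \<in> closure (fst ` R)" for x
  proof (rule tensor_sum_induct[OF t, where P = "\<lambda>x. x \<in> closure (fst ` R)"])
    show "(\<Sum>k<n. t (a k) (b k)) \<in> closure (fst ` R)" for n :: nat and a b
      using imageI[OF mem, of fst] closure_subset[of "fst ` R"] by auto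
  qed simp
  then have dense: "closure (fst ` R) = UNIV" by blast
  show ?thesis
  proof (rule extend_bounded_graph[OF add scale bound dense])
    fix L assume L: "clinear_map L" "\<And>x. norm (L x) \<le> norm x" "\<And>x y. (x, y) \<in> R \<Longrightarrow> L x = y"
    show thesis by (rule that[of L]) (use L tensor in \<open>simp_all add: \<omega>_def\<close>)
  qed
qed

text \<open>
  Slicing by the vector functional of \<open>\<xi>\<close> and a unit vector of the basis gives a linear relation
  between the \<open>a\<^sub>k\<close> with coefficients \<open>(\<rho>(b\<^sub>k)\<xi>)(i)\<close>.
\<close>

lemma tensor_left_independent:
  fixes t :: "'a::cstar_algebra \<Rightarrow> 'b::cstar_algebra \<Rightarrow> 'c::cstar_algebra"
  assumes t: "min_tensor t" and sum: "(\<Sum>k<(n::nat). t (a k) (b k)) = 0"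
    and indep: "\<And>c. (\<Sum>k<n. c k *\<^sub>C a k) = 0 \<Longrightarrow> \<forall>k<n. c k = 0"
    and k: "k < n"
  shows "b k = 0"
proof -
  obtain \<pi> \<rho> where reps: "spatial_reps t \<pi> \<rho>" using t by (rule min_tensor_spatial_reps)
  then have \<rho>: "faithful_rep \<rho>" by (simp add: spatial_reps_def)
  have "op_norm (\<rho> (b k)) \<le> 0"
  proof (rule op_norm_least)
    fix \<xi> :: "'b \<Rightarrow> complex" assume \<xi>: "\<xi> \<in> ell2" "ell2_norm \<xi> \<le> 1"
    have "\<rho> (b k) \<xi> i = 0" for i
    proof -
      have "norm (\<Sum>k<n. \<rho> (b k) \<xi> i *\<^sub>C a k) \<le> 0"
        using vector_slice_bound[OF reps \<xi>, where \<eta> = "\<lambda>j. if j = i then 1 else 0" and n = n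
            and b = b and a = a]
        by (simp add: ell2_unit_vector sum)
      then show ?thesis using indep[of "\<lambda>k. \<rho> (b k) \<xi> i"] k by simp
    qed
    then have "\<rho> (b k) \<xi> = (\<lambda>i. 0)" by blast
    then show "ell2_norm (\<rho> (b k) \<xi>) \<le> 0" by simp
  qed
  then show ?thesis by (simp add: faithful_repD(2)[OF \<rho>])
qed

lemma tensor_one_hom:
  assumes "min_tensor t"
  shows "unital_star_hom (\<lambda>a. t a 1)" "unital_star_hom (\<lambda>b. t 1 b)"
  unfolding unital_star_hom_def by (simp_all add: min_tensorD[OF assms])

lemma tensor_factor: "min_tensor t \<Longrightarrow> t a b = t a 1 * t 1 b"
  by (simp add: min_tensorD)

lemma norm_tensor_le:
  assumes "min_tensor t"
  shows "norm (t a b) \<le> norm a * norm b"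
  unfolding tensor_factor[OF assms, of a b]
  using unital_star_hom_contractive[OF tensor_one_hom(1)[OF assms], of a]
    unital_star_hom_contractive[OF tensor_one_hom(2)[OF assms], of b]
  by (intro order_trans[OF norm_mult_ineq] mult_mono) auto

lemma tensor_bounded_linear:
  assumes t: "min_tensor t"
  shows "bounded_linear (t a)"
  using norm_tensor_le[OF t, of a] by (rule clinear_map_bounded[OF min_tensorD(2)[OF t]])

text \<open>
  The lower bound is the slice of \<open>1 \<otimes> b\<close> by \<open>\<xi>\<close> and the normalisation of \<open>\<rho>(b)\<xi>\<close>.
\<close>

lemma norm_tensor_one_left:
  fixes t :: "'a::cstar_algebra \<Rightarrow> 'b::cstar_algebra \<Rightarrow> 'c::cstar_algebra"
  assumes t: "min_tensor t"
  shows "norm (t 1 b) = norm b"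
proof (rule antisym)
  show "norm (t 1 b) \<le> norm b" using norm_tensor_le[OF t, of 1 b] by simp
  obtain \<pi> \<rho> where reps: "spatial_reps t \<pi> \<rho>" using t by (rule min_tensor_spatial_reps)
  then have \<rho>: "faithful_rep \<rho>" by (simp add: spatial_reps_def)
  have "op_norm (\<rho> b) \<le> norm (t 1 b)"
  proof (rule op_norm_least)
    fix \<xi> :: "'b \<Rightarrow> complex" assume \<xi>: "\<xi> \<in> ell2" "ell2_norm \<xi> \<le> 1"
    define v where "v = \<rho> b \<xi>"
    define \<eta> where "\<eta> = (\<lambda>i. of_real (1 / ell2_norm v) * v i)"
    have v: "v \<in> ell2" unfolding v_def by (rule faithful_repD(3)[OF \<rho> \<xi>(1)])
    have \<eta>: "\<eta> \<in> ell2" unfolding \<eta>_def by (rule ell2_scale(1)[OF v])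
    have \<eta>1: "ell2_norm \<eta> \<le> 1" unfolding \<eta>_def ell2_scale(2)[OF v] by (simp add: norm_divide)
    have "ell2_inner \<eta> v = of_real (ell2_norm v)"
      unfolding \<eta>_def ell2_inner_scale ell2_inner_self[OF v] by (simp add: power2_eq_square)
    then have "ell2_inner v \<eta> = of_real (ell2_norm v)"
      by (metis complex_cnj_complex_of_real ell2_inner_cnj)
    then show "ell2_norm (\<rho> b \<xi>) \<le> norm (t 1 b)"
      using vector_slice_bound[OF reps \<xi> \<eta> \<eta>1, where n = 1 and b = "\<lambda>_. b" and a = "\<lambda>_. 1"]
      by (simp add: v_def[symmetric] norm_scaleC)
  qed
  then show "norm b \<le> norm (t 1 b)" by (simp add: faithful_repD(2)[OF \<rho>])
qed

lemma has_sum_finite_sum: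
  "finite K \<Longrightarrow> (\<And>k. k \<in> K \<Longrightarrow> (f k has_sum s k) A) \<Longrightarrow> ((\<lambda>x. \<Sum>k\<in>K. f k x) has_sum (\<Sum>k\<in>K. s k)) A"
  for f :: "'k \<Rightarrow> 'x \<Rightarrow> 'b::topological_comm_monoid_add"
  by (induction K rule: finite_induct) (auto intro: has_sum_add)

text \<open>
  For \<open>x = \<Sum> a\<^sub>k \<otimes> b\<^sub>k\<close> the matrix \<open>\<omega>(b\<^sub>i\<^sup>*b\<^sub>j)\<close> is the Gram matrix of the vectors \<open>\<rho>(b\<^sub>k)\<xi>\<close>.
  Summation over the coordinates \<open>m\<close> of these vectors gives \<open>\<phi>(L(x\<^sup>*x)) = \<Sum>\<^sub>m \<phi>(v\<^sub>m\<^sup>*v\<^sub>m)\<close> for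
  suitable elements \<open>v\<^sub>m\<close>, that is, the complete positivity of the slice map.
\<close>

lemma state_comp_vector_slice:
  assumes t: "min_tensor t" and \<rho>: "faithful_rep \<rho>" and \<xi>: "\<xi> \<in> ell2" "ell2_norm \<xi> = 1"
    and L: "clinear_map L" "bounded_linear L" and slice: "\<And>a b. L (t a b) =
        ell2_inner (\<rho> b \<xi>) \<xi> *\<^sub>C a"
    and \<phi>: "state \<phi>"
  shows "state (\<lambda>x. \<phi> (L x))"
proof -
  define \<omega> where "\<omega> b = ell2_inner (\<rho> b \<xi>) \<xi>" for b
  have \<phi>L: "clinear_map (\<lambda>x. \<phi> (L x))" by (rule clinear_map_comp[OF stateD(1)[OF \<phi>] L(1)])
  have "Im (\<phi> (L (star x * x))) = 0 \<and> 0 \<le> Re (\<phi> (L (star x * x)))" for x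
  proof (rule tensor_sum_induct[OF t, where P = "\<lambda>x. Im (\<phi> (L (star x * x))) = 0 \<and> 0 \<le>
      Re (\<phi> (L (star x * x)))"])
    have "continuous_on UNIV (\<lambda>x. \<phi> (L (star x * x)))"
      by (intro bounded_linear.continuous_on[OF state_bounded_linear[OF \<phi>]]
          bounded_linear.continuous_on[OF L(2)] continuous_intros)
    then show "closed {x. Im (\<phi> (L (star x * x))) = 0 \<and> 0 \<le> Re (\<phi> (L (star x * x)))}"
      by (intro closed_Collect_conj closed_Collect_eq closed_Collect_le continuous_intros)
  next
    fix n :: nat and a b
    define x where "x = (\<Sum>k<n. t (a k) (b k))"
    define \<beta> where "\<beta> k = \<rho> (b k) \<xi>" for k
    define v where "v m = (\<Sum>k<n. \<beta> k m *\<^sub>C a k)" for m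
    have \<beta>: "\<beta> k \<in> ell2" for k unfolding \<beta>_def by (rule faithful_repD(3)[OF \<rho> \<xi>(1)])
    have \<omega>: "\<omega> (star (b i) * b j) = ell2_inner (\<beta> j) (\<beta> i)" for i j
      unfolding \<omega>_def \<beta>_def by (rule vector_functional_mult[OF \<rho> \<xi>(1)])
    have "star x * x = (\<Sum>i<n. \<Sum>j<n. t (star (a i) * a j) (star (b i) * b j))"
      by (simp add: x_def star_sum sum_product min_tensorD[OF t])
    then have "\<phi> (L (star x * x)) =
        (\<Sum>i<n. \<Sum>j<n. ell2_inner (\<beta> j) (\<beta> i) * \<phi> (star (a i) * a j))"
      by (simp add: clinear_mapD[OF L(1)] stateD[OF \<phi>] slice \<omega>_def[symmetric] \<omega>)
    moreover have "((\<lambda>m. \<Sum>i<n. \<Sum>j<n. \<beta> j m * cnj (\<beta> i m) * \<phi> (star (a i) * a j)) has_sum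
        (\<Sum>i<n. \<Sum>j<n. ell2_inner (\<beta> j) (\<beta> i) * \<phi> (star (a i) * a j))) UNIV"
      unfolding ell2_inner_def
      by (intro has_sum_finite_sum has_sum_cmult_left has_sum_infsum ell2_inner_summable \<beta>) auto
    moreover have "(\<Sum>i<n. \<Sum>j<n. \<beta> j m * cnj (\<beta> i m) * \<phi> (star (a i) * a j)) =
        \<phi> (star (v m) * v m)" for m
      by (simp add: v_def star_sum sum_product star_scaleC scaleC_mult_left scaleC_mult_right
          scaleC_scaleC stateD[OF \<phi>])
    ultimately have sum: "((\<lambda>m. \<phi> (star (v m) * v m)) has_sum \<phi> (L (star x * x))) UNIV" by simp
    have "0 \<le> Re (\<phi> (L (star x * x)))"
      using has_sum_nonneg[OF has_sum_Re[OF sum]] stateD(2)[OF \<phi>] by simp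
    moreover have "Im (\<phi> (L (star x * x))) = (\<Sum>\<^sub>\<infinity>m. Im (\<phi> (star (v m) * v m)))"
      using has_sum_Im[OF sum] by (rule infsumI[symmetric])
    then have "Im (\<phi> (L (star x * x))) = 0" by (simp add: stateD(3)[OF \<phi>])
    ultimately show "Im (\<phi> (L (star (\<Sum>k<n. t (a k) (b k)) * (\<Sum>k<n. t (a k) (b k))))) = 0 \<and>
      0 \<le> Re (\<phi> (L (star (\<Sum>k<n. t (a k) (b k)) * (\<Sum>k<n. t (a k) (b k)))))"
      unfolding x_def by blast
  qed
  moreover have "\<phi> (L 1) = 1"
    using slice[of 1 1] \<xi> stateD(4)[OF \<phi>] \<rho>
    by (simp add: min_tensorD(5)[OF t] faithful_repD(7) ell2_inner_self)
  ultimately show ?thesis using \<phi>L by (simp add: state_iff)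
qed

text \<open>
  \<open>L = id \<otimes> \<omega>\<close> for a state \<open>\<omega>\<close>, together with the two properties that will be used of it: it is
  contractive, and its composition with a state is a state.
\<close>

definition state_slice ::
    "('a::cstar_algebra \<Rightarrow> 'b::cstar_algebra \<Rightarrow> 'c::cstar_algebra) \<Rightarrow> ('b \<Rightarrow> complex) \<Rightarrow>
        ('c \<Rightarrow> 'a) \<Rightarrow> bool" where
  "state_slice t \<omega> L \<longleftrightarrow> min_tensor t \<and> state \<omega> \<and> clinear_map L \<and> (\<forall>x. norm (L x) \<le> norm x) \<and>
     (\<forall>a b. L (t a b) = \<omega> b *\<^sub>C a) \<and> (\<forall>\<phi>. state \<phi> \<longrightarrow> state (\<lambda>x. \<phi> (L x)))"

lemma state_sliceD:
  assumes "state_slice t \<omega> L"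
  shows "min_tensor t" "state \<omega>" "clinear_map L" "norm (L x) \<le> norm x" "L (t a b) = \<omega> b *\<^sub>C a"
    "state \<phi> \<Longrightarrow> state (\<lambda>x. \<phi> (L x))"
  using assms by (auto simp: state_slice_def)

lemma state_slice_bounded_linear: "state_slice t \<omega> L \<Longrightarrow> bounded_linear L"
  by (intro clinear_map_bounded[where K = 1]) (auto simp: state_sliceD)

lemma vector_state_slice:
  assumes t: "min_tensor t" and reps: "spatial_reps t \<pi> \<rho>" and \<xi>: "\<xi> \<in> ell2" "ell2_norm \<xi> = 1"
  obtains L where "state_slice t (\<lambda>b. ell2_inner (\<rho> b \<xi>) \<xi>) L"
proof -
  have \<rho>: "faithful_rep \<rho>" using reps by (simp add: spatial_reps_def)
  have \<xi>1: "ell2_norm \<xi> \<le> 1" using \<xi>(2) by simp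
  show ?thesis
  proof (rule vector_slice_exists[OF t reps \<xi>(1) \<xi>1 \<xi>(1) \<xi>1])
    fix L assume L: "clinear_map L" "\<And>x. norm (L x) \<le> norm x"
        "\<And>a b. L (t a b) = ell2_inner (\<rho> b \<xi>) \<xi> *\<^sub>C a"
    have bl: "bounded_linear L" using L(2) by (intro clinear_map_bounded[where K = 1] L(1)) simp
    show thesis
      by (rule that[of L]) (use state_comp_vector_slice[OF t \<rho> \<xi> L(1) bl L(3)] vector_state[OF \<rho>
          \<xi>] t L
          in \<open>simp add: state_slice_def\<close>)
  qed
qed

lemma state_slice_mult:
  assumes L: "state_slice t \<omega> L"
  shows "L (t c 1 * x) = c * L x" "L (x * t c 1) = L x * c"
proof -
  note t = state_sliceD(1)[OF L] and lin = clinear_mapD[OF state_sliceD(3)[OF L]]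
  note cont = bounded_linear.continuous_on[OF state_slice_bounded_linear[OF L]]
  show "L (t c 1 * x) = c * L x"
  proof (rule tensor_induct[OF t, where P = "\<lambda>x. L (t c 1 * x) = c * L x"])
    show "closed {x. L (t c 1 * x) = c * L x}"
      by (intro closed_Collect_eq cont continuous_on_mult continuous_on_const continuous_on_id)
    show "L (t c 1 * t a b) = c * L (t a b)" for a b
      by (simp add: min_tensorD(3)[OF t] state_sliceD(5)[OF L] scaleC_mult_right)
  qed (simp_all add: distrib_left lin scaleC_mult_right)
  show "L (x * t c 1) = L x * c"
  proof (rule tensor_induct[OF t, where P = "\<lambda>x. L (x * t c 1) = L x * c"])
    show "closed {x. L (x * t c 1) = L x * c}"
      by (intro closed_Collect_eq cont continuous_on_mult continuous_on_const continuous_on_id)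
    show "L (t a b * t c 1) = L (t a b) * c" for a b
      by (simp add: min_tensorD(3)[OF t] state_sliceD(5)[OF L] scaleC_mult_left)
  qed (simp_all add: distrib_right lin scaleC_mult_left)
qed

lemma state_slice_star:
  assumes L: "state_slice t \<omega> L"
  shows "L (star x) = star (L x)"
proof -
  note t = state_sliceD(1)[OF L] and lin = clinear_mapD[OF state_sliceD(3)[OF L]]
  note cont = bounded_linear.continuous_on[OF state_slice_bounded_linear[OF L]]
  show ?thesis
  proof (rule tensor_induct[OF t, where P = "\<lambda>x. L (star x) = star (L x)"])
    show "closed {x. L (star x) = star (L x)}"
      by (intro closed_Collect_eq cont continuous_star continuous_on_id)
    show "L (star (t a b)) = star (L (t a b))" for a b
      by (simp add: min_tensorD(4)[OF t] state_sliceD(5)[OF L] star_scaleC state_star[OF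
          state_sliceD(2)[OF L]])
  qed (simp_all add: star_add lin star_scaleC)
qed

lemma state_slice_one:
  assumes L: "state_slice t \<omega> L"
  shows "L (t 1 b) = \<omega> b *\<^sub>C 1" "L 1 = 1"
  using state_sliceD(5)[OF L, of 1 1] stateD(4)[OF state_sliceD(2)[OF L]]
  by (simp_all add: state_sliceD(5)[OF L] min_tensorD(5)[OF state_sliceD(1)[OF L]])

text \<open>
  The norms of \<open>(A \<otimes> B) \<otimes> C\<close> and of \<open>B \<otimes> C\<close> may be computed by different representations of \<open>C\<close>. A
  vector state for the first product can nevertheless be sliced off from \<open>X\<close> in \<open>B \<otimes> C\<close>: slice it
  off from \<open>1 \<otimes> X\<close>. The result lies in \<open>1 \<otimes> B\<close>, which is an isometric copy of \<open>B\<close>.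
\<close>

lemma transfer_vector_state_slice:
  assumes triple: "triple_tensor t l u r" and L: "state_slice l (\<lambda>b. ell2_inner (\<rho> b \<xi>) \<xi>) L"
    and \<rho>: "faithful_rep \<rho>" and \<xi>: "\<xi> \<in> ell2" "ell2_norm \<xi> = 1"
  obtains M where "state_slice u (\<lambda>b. ell2_inner (\<rho> b \<xi>) \<xi>) M"
proof -
  define \<omega> where "\<omega> b = ell2_inner (\<rho> b \<xi>) \<xi>" for b
  have tens: "min_tensor t" "min_tensor l" "min_tensor u" "min_tensor r"
    and assoc: "\<And>a b c. l (t a b) c = r a (u b c)"
    using triple by (simp_all add: triple_tensor_def)
  note Llin = clinear_mapD[OF state_sliceD(3)[OF L]]
      and rlin = clinear_mapD[OF min_tensorD(2)[OF tens(4)]]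
    and tlin = clinear_mapD[OF min_tensorD(2)[OF tens(1)]]
  have t1: "bounded_linear (t 1)"
    using norm_tensor_one_left[OF tens(1)]
    by (intro clinear_map_bounded[where K = 1] min_tensorD(2)[OF tens(1)]) simp
  have r1: "bounded_linear (r 1)"
    using norm_tensor_one_left[OF tens(4)]
    by (intro clinear_map_bounded[where K = 1] min_tensorD(2)[OF tens(4)]) simp
  have slice: "L (r 1 (u b c)) = t 1 (\<omega> c *\<^sub>C b)" for b c
    using state_sliceD(5)[OF L, of "t 1 b" c] by (simp add: assoc tlin \<omega>_def)
  have closed: "closed (range (t 1))"
    using norm_tensor_one_left[OF tens(1)]
    by (intro complete_imp_closed complete_isometric_image[where e =
        1] t1) (simp_all add: complete_UNIV)
  have "L (r 1 x) \<in> range (t 1)" for x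
  proof (rule tensor_induct[OF tens(3), where P = "\<lambda>x. L (r 1 x) \<in> range (t 1)"])
    have "continuous_on UNIV (\<lambda>x. L (r 1 x))"
      by (intro bounded_linear.continuous_on[OF state_slice_bounded_linear[OF L]]
          bounded_linear.continuous_on[OF r1] continuous_intros)
    then have "closed ((\<lambda>x. L (r 1 x)) -` range (t 1))"
      by (intro closed_vimage closed)
    then show "closed {x. L (r 1 x) \<in> range (t 1)}" by (simp add: vimage_def)
    show "L (r 1 (u b c)) \<in> range (t 1)" for b c by (simp add: slice)
    show "L (r 1 (x + y)) \<in> range (t 1)" if "L (r 1 x) \<in> range (t 1)"
        "L (r 1 y) \<in> range (t 1)" for x y
      using that by (auto simp: rlin Llin simp flip: tlin)
    show "L (r 1 (c *\<^sub>C x)) \<in> range (t 1)" if "L (r 1 x) \<in> range (t 1)" for c x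
      using that by (auto simp: rlin Llin simp flip: tlin)
  qed
  then have "\<forall>x. \<exists>y. L (r 1 x) = t 1 y" by (simp add: image_iff)
  from choice[OF this] obtain M where M: "\<And>x. L (r 1 x) = t 1 (M x)" by blast
  have inj: "x = y" if "t 1 x = t 1 y" for x y
    using norm_tensor_one_left[OF tens(1), of "x - y"] that by (simp add: tlin)
  have cl: "clinear_map M"
    unfolding clinear_map_def
    by (intro conjI allI inj) (simp_all add: rlin Llin tlin flip: M)
  have le: "norm (M x) \<le> norm x" for x
    using state_sliceD(4)[OF L, of "r 1 x"] by (simp add: M norm_tensor_one_left tens)
  have sl: "M (u b c) = ell2_inner (\<rho> c \<xi>) \<xi> *\<^sub>C b" for b c
    by (rule inj) (simp add: slice \<omega>_def flip: M)
  have bl: "bounded_linear M" using le by (intro clinear_map_bounded[where K = 1] cl) simp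
  have "state_slice u (\<lambda>b. ell2_inner (\<rho> b \<xi>) \<xi>) M"
    using state_comp_vector_slice[OF tens(3) \<rho> \<xi> cl bl sl] cl le sl tens(3) vector_state[OF \<rho> \<xi>]
    by (simp add: state_slice_def)
  then show ?thesis by (rule that)
qed


section \<open>Averages of convolution powers\<close>

text \<open>
  The powers run from \<open>0\<close> to \<open>n\<close>, so that the number of summands is positive for every \<open>n\<close>.
\<close>

definition cesaro :: "('a::real_vector \<Rightarrow> 'a) \<Rightarrow> nat \<Rightarrow> 'a \<Rightarrow> 'a" where
  "cesaro T n x = (1 / real (Suc n)) *\<^sub>R (\<Sum>k\<le>n. (T ^^ k) x)"

locale clinear_contraction =
  fixes T :: "'a::cstar_algebra \<Rightarrow> 'a"
  assumes clinear: "clinear_map T" and contraction: "norm (T x) \<le> norm x"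
begin

lemma norm_funpow_le: "norm ((T ^^ k) x) \<le> norm x"
  by (induction k) (auto intro: order_trans[OF contraction])

lemma clinear_cesaro: "clinear_map (cesaro T n)"
proof -
  have "r *\<^sub>R (c *\<^sub>C x) = c *\<^sub>C (r *\<^sub>R x)" for r c and x :: 'a
    by (simp add: scaleC_scaleC mult.commute flip: scaleC_of_real)
  then show ?thesis
    unfolding clinear_map_def cesaro_def
    by (simp add: clinear_mapD(1,2)[OF clinear_map_funpow[OF clinear]] sum.distrib scaleR_add_right
        flip: complex_module.scale_sum_right)
qed

lemma norm_cesaro_le: "norm (cesaro T n x) \<le> norm x"
proof -
  have "norm (\<Sum>k\<le>n. (T ^^ k) x) \<le> real (Suc n) * norm x"
    using sum_norm_bound[of "{..n}" "\<lambda>k. (T ^^ k) x" "norm x"] norm_funpow_le by simp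
  then show ?thesis by (simp add: cesaro_def field_simps)
qed

lemma cesaro_commute: "cesaro T n (T x) = T (cesaro T n x)"
  by (simp add: cesaro_def clinear_mapD[OF clinear] funpow_swap1)

text \<open>
  The sum telescopes to \<open>T\<^sup>n\<^sup>+\<^sup>1 x - x\<close>.
\<close>

lemma norm_cesaro_diff_le: "norm (T (cesaro T n x) - cesaro T n x) \<le>
    2 * norm x * inverse (real (Suc n))"
proof -
  have "T (cesaro T n x) - cesaro T n x = (1 / real (Suc n)) *\<^sub>R (\<Sum>k\<le>n. (T ^^ Suc k) x -
      (T ^^ k) x)"
    by (simp add: cesaro_def clinear_mapD[OF clinear] sum_subtractf scaleR_diff_right)
  also have "(\<Sum>k\<le>n. (T ^^ Suc k) x - (T ^^ k) x) = (T ^^ Suc n) x - x"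
    using sum_lessThan_telescope[of "\<lambda>k. (T ^^ k) x" "Suc n"] by (simp add: lessThan_Suc_atMost)
  finally have "T (cesaro T n x) - cesaro T n x = (1 / real (Suc n)) *\<^sub>R ((T ^^ Suc n) x - x)" .
  then have "norm (T (cesaro T n x) - cesaro T n x) =
      norm ((T ^^ Suc n) x - x) * inverse (real (Suc n))"
    by (simp add: divide_inverse del: funpow.simps of_nat_Suc)
  also have "norm ((T ^^ Suc n) x - x) \<le> 2 * norm x"
    using norm_triangle_ineq4[of "(T ^^ Suc n) x" x] norm_funpow_le[of "Suc n" x] by linarith
  finally show ?thesis by (simp add: mult_right_mono)
qed

end

lemma cesaro_intertwine:
  assumes f: "clinear_map f" and "\<And>x. f (S x) = T (f x)"
  shows "f (cesaro S n x) = cesaro T n (f x)"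
proof -
  have "f ((S ^^ k) x) = (T ^^ k) (f x)" for k by (induction k) (simp_all add: assms(2))
  then show ?thesis by (simp add: cesaro_def clinear_mapD[OF f])
qed

lemma state_cesaro:
  assumes T: "\<And>\<phi>. state \<phi> \<Longrightarrow> state (\<lambda>x. \<phi> (T x))" and \<omega>: "state \<omega>"
  shows "state (\<lambda>x. \<omega> (cesaro T n x))"
proof -
  have st: "state (\<lambda>x. \<omega> ((T ^^ k) x))" for k
  proof (induction k)
    case (Suc k)
    from T[OF this] show ?case by (simp add: funpow_swap1)
  qed (simp add: \<omega>)
  have eq: "\<omega> (cesaro T n x) = of_real (1 / real (Suc n)) * (\<Sum>k\<le>n. \<omega> ((T ^^ k) x))" for x
    unfolding cesaro_def scaleC_of_real[symmetric] stateD(6,9)[OF \<omega>] ..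
  have c: "clinear_map (\<lambda>x. \<omega> (cesaro T n x))"
    unfolding clinear_map_def eq
    by (simp add: stateD(5,6)[OF st] sum.distrib distrib_left sum_distrib_left scaleC_complex_def
        mult_ac)
  have p: "Im (\<omega> (cesaro T n (star x * x))) = 0" "0 \<le> Re (\<omega> (cesaro T n (star x * x)))" for x
    unfolding eq by (simp_all add: stateD(2,3)[OF st] sum_nonneg)
  have "(\<Sum>k\<le>n. \<omega> ((T ^^ k) 1)) = of_real (real (Suc n))"
    using stateD(4)[OF st] by simp
  then have "\<omega> (cesaro T n 1) = 1" unfolding eq by (simp only: of_real_mult[symmetric]) simp
  with c p show ?thesis by (simp add: state_iff)
qed

lemma closed_pointwise_null:
  fixes \<theta> :: "nat \<Rightarrow> 'a::cstar_algebra \<Rightarrow> complex"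
  assumes lin: "\<And>n. clinear_map (\<theta> n)" and bound: "\<And>n x. cmod (\<theta> n x) \<le> C * norm x"
  shows "closed {x. (\<lambda>n. \<theta> n x) \<longlonglongrightarrow> 0}"
proof (unfold closed_sequential_limits, intro allI impI, elim conjE, unfold mem_Collect_eq)
  fix u x assume u: "\<forall>m. (\<lambda>n. \<theta> n (u m)) \<longlonglongrightarrow> 0" and lim: "u \<longlonglongrightarrow> x"
  define D where "D = \<bar>C\<bar> + 1"
  have D: "D > 0" "cmod (\<theta> n y) \<le> D * norm y" for n y
    using order_trans[OF bound[of n y] mult_right_mono[of C D "norm y"]] by (auto simp: D_def)
  show "(\<lambda>n. \<theta> n x) \<longlonglongrightarrow> 0"
  proof (rule LIMSEQ_I)
    fix e :: real assume e: "0 < e"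
    then have "0 < e / (2 * D)" using D by simp
    then obtain m where m: "norm (u m - x) < e / (2 * D)" using LIMSEQ_D[OF lim] by blast
    obtain N where N: "\<And>n. n \<ge> N \<Longrightarrow> cmod (\<theta> n (u m) - 0) < e / 2"
      using LIMSEQ_D[OF u[rule_format, of m], of "e / 2"] e by auto
    have "cmod (\<theta> n x - 0) < e" if "n \<ge> N" for n
    proof -
      have "\<theta> n x = \<theta> n (u m) - \<theta> n (u m - x)" by (simp add: clinear_mapD[OF lin])
      then have "cmod (\<theta> n x) \<le> cmod (\<theta> n (u m)) + cmod (\<theta> n (u m - x))"
        by (metis norm_triangle_ineq4)
      also have "cmod (\<theta> n (u m - x)) \<le> D * norm (u m - x)" by (rule D(2))
      also have "\<dots> \<le> e / 2" using m D(1) by (simp add: field_simps)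
      finally show ?thesis using N[OF that] by simp
    qed
    then show "\<exists>N. \<forall>n\<ge>N. cmod (\<theta> n x - 0) < e" by blast
  qed
qed

text \<open>
  Convolution by \<open>\<omega>\<close> on \<open>Q\<close> requires the slice map of \<open>\<omega>\<close> on \<open>Q \<otimes> Q\<close>, and its extension to the
  second leg of \<open>Q \<otimes> Q\<close> requires the one on \<open>(Q \<otimes> Q) \<otimes> Q\<close>. The maps \<open>F = \<Delta> \<otimes> id\<close> and \<open>G = id \<otimes> \<Delta>\<close>
  are the two sides of the coassociativity law.
\<close>

locale sliced_quantum_group = compact_quantum_group qq qq_q q_qq \<Delta>
  for qq :: "'q::cstar_algebra \<Rightarrow> 'q \<Rightarrow> 'qq::cstar_algebra"
    and qq_q :: "'qq \<Rightarrow> 'q \<Rightarrow> 'qqq::cstar_algebra"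
    and q_qq :: "'q \<Rightarrow> 'qq \<Rightarrow> 'qqq"
    and \<Delta> :: "'q \<Rightarrow> 'qq" +
  fixes \<omega> :: "'q \<Rightarrow> complex" and L :: "'qq \<Rightarrow> 'q" and L' :: "'qqq \<Rightarrow> 'qq"
    and F :: "'qq \<Rightarrow> 'qqq" and G :: "'qq \<Rightarrow> 'qqq"
  assumes L: "state_slice qq \<omega> L" and L': "state_slice qq_q \<omega> L'"
    and F: "is_tensor_hom qq qq_q \<Delta> id F" and G: "is_tensor_hom qq q_qq id \<Delta> G"
    and FG: "F \<circ> \<Delta> = G \<circ> \<Delta>"
begin

text \<open>
  Convolution by \<open>\<omega>\<close>: a functional \<open>\<phi>\<close> composed with it is the convolution product of \<open>\<phi>\<close> and \<open>\<omega>\<close>.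
\<close>

definition conv :: "'q \<Rightarrow> 'q" where "conv x = L (\<Delta> x)"

text \<open>
  The map \<open>id \<otimes> conv\<close> on \<open>Q \<otimes> Q\<close>.
\<close>

definition conv2 :: "'qq \<Rightarrow> 'qq" where "conv2 X = L' (G X)"

lemma tensors: "min_tensor qq" "min_tensor qq_q" "min_tensor q_qq"
  and assoc: "qq_q (qq a b) c = q_qq a (qq b c)"
  using tensor_qqq by (simp_all add: triple_tensor_def)

lemma homs: "unital_star_hom F" "unital_star_hom G"
  and F_tensor: "F (qq a b) = qq_q (\<Delta> a) b" and G_tensor: "G (qq a b) = q_qq a (\<Delta> b)"
  using F G by (simp_all add: is_tensor_hom_def)

lemmas \<Delta>_simps = unital_star_homD(2-)[OF hom_coproduct] clinear_mapD[OF unital_star_homD(1)[OF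
    hom_coproduct]]
  and F_lin = clinear_mapD[OF unital_star_homD(1)[OF homs(1)]]
  and G_simps = unital_star_homD(2-)[OF homs(2)] clinear_mapD[OF unital_star_homD(1)[OF homs(2)]]
  and L_lin = clinear_mapD[OF state_sliceD(3)[OF L]]
  and L'_lin = clinear_mapD[OF state_sliceD(3)[OF L']]
  and qq_lin2 = clinear_mapD[OF min_tensorD(2)[OF tensors(1)]]
  and q_qq_lin2 = clinear_mapD[OF min_tensorD(2)[OF tensors(3)]]
  and cont_L = bounded_linear.continuous_on[OF state_slice_bounded_linear[OF L]]
  and cont_L' = bounded_linear.continuous_on[OF state_slice_bounded_linear[OF L']]
  and cont_\<Delta> = bounded_linear.continuous_on[OF unital_star_hom_bounded_linear[OF hom_coproduct]]
  and cont_F = bounded_linear.continuous_on[OF unital_star_hom_bounded_linear[OF homs(1)]]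
  and cont_G = bounded_linear.continuous_on[OF unital_star_hom_bounded_linear[OF homs(2)]]

lemma slice_tensor: "L' (q_qq a X) = qq a (L X)"
proof (rule tensor_induct[OF tensors(1), where P = "\<lambda>X. L' (q_qq a X) = qq a (L X)"])
  show "closed {X. L' (q_qq a X) = qq a (L X)}"
    by (intro closed_Collect_eq cont_L cont_L' continuous_on_id
        bounded_linear.continuous_on[OF tensor_bounded_linear[OF tensors(1)]]
        bounded_linear.continuous_on[OF tensor_bounded_linear[OF tensors(3)]])
  show "L' (q_qq a (qq b c)) = qq a (L (qq b c))" for b c
    unfolding assoc[symmetric] by (simp add: state_sliceD(5)[OF L] state_sliceD(5)[OF L'] qq_lin2)
qed (simp_all add: L_lin L'_lin qq_lin2 q_qq_lin2)

lemma slice_F: "L' (F X) = \<Delta> (L X)"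
proof (rule tensor_induct[OF tensors(1), where P = "\<lambda>X. L' (F X) = \<Delta> (L X)"])
  show "closed {X. L' (F X) = \<Delta> (L X)}"
    by (intro closed_Collect_eq cont_L' cont_L cont_F cont_\<Delta> continuous_on_id)
  show "L' (F (qq a b)) = \<Delta> (L (qq a b))" for a b
    by (simp add: F_tensor state_sliceD(5)[OF L] state_sliceD(5)[OF L'] \<Delta>_simps)
qed (simp_all add: L_lin L'_lin F_lin \<Delta>_simps)

lemma conv2_tensor: "conv2 (qq a b) = qq a (conv b)"
  by (simp add: conv2_def conv_def G_tensor slice_tensor)

text \<open>
  Coassociativity: convolution from one side commutes with translation on the other.
\<close>

lemma conv2_\<Delta>: "conv2 (\<Delta> a) = \<Delta> (conv a)"
  using fun_cong[OF FG, of a] slice_F[of "\<Delta> a"] by (simp add: conv2_def conv_def)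

sublocale conv: clinear_contraction conv
proof
  show "clinear_map conv" by (simp add: clinear_map_def conv_def \<Delta>_simps L_lin)
  show "norm (conv x) \<le> norm x" for x
    using order_trans[OF state_sliceD(4)[OF L] unital_star_hom_contractive[OF hom_coproduct]]
    by (simp add: conv_def)
qed

sublocale conv2: clinear_contraction conv2
proof
  show "clinear_map conv2" by (simp add: clinear_map_def conv2_def G_simps L'_lin)
  show "norm (conv2 x) \<le> norm x" for x
    using order_trans[OF state_sliceD(4)[OF L'] unital_star_hom_contractive[OF homs(2)]]
    by (simp add: conv2_def)
qed

lemma conv_star: "conv (star x) = star (conv x)"
  by (simp add: conv_def \<Delta>_simps state_slice_star[OF L])

lemma state_conv:
  assumes "state \<phi>"
  shows "state (\<lambda>x. \<phi> (conv x))"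
proof -
  have st: "state (\<lambda>X. \<phi> (L X))" by (rule state_sliceD(6)[OF L assms])
  have "clinear_map (\<lambda>x. \<phi> (L (\<Delta> x)))"
    by (rule clinear_map_comp[OF stateD(1)[OF st] unital_star_homD(1)[OF hom_coproduct]])
  then show ?thesis
    unfolding conv_def state_iff \<Delta>_simps(1,2) using stateD(2-4)[OF st] by (simp add: \<Delta>_simps(3))
qed

lemma conv2_mult_left: "conv2 (qq c 1 * X) = qq c 1 * conv2 X"
proof (rule tensor_induct[OF tensors(1), where P = "\<lambda>X. conv2 (qq c 1 * X) = qq c 1 * conv2 X"])
  show "closed {X. conv2 (qq c 1 * X) = qq c 1 * conv2 X}"
    unfolding conv2_def
    by (intro closed_Collect_eq continuous_on_mult continuous_on_const continuous_on_id cont_L'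
        cont_G)
  show "conv2 (qq c 1 * qq a b) = qq c 1 * conv2 (qq a b)" for a b
    by (simp add: min_tensorD(3)[OF tensors(1)] conv2_tensor)
qed (simp_all add: distrib_left clinear_mapD[OF conv2.clinear] scaleC_mult_right)

text \<open>
  The mean of the convolution powers of \<open>\<omega>\<close> with exponents \<open>1\<close> to \<open>n + 1\<close>, the substitute for a Haar
  state.
\<close>

definition mean_state :: "nat \<Rightarrow> 'q \<Rightarrow> complex" where
  "mean_state n x = \<omega> (cesaro conv n x)"

lemma mean_state: "state (mean_state n)"
  unfolding mean_state_def by (rule state_cesaro[OF state_conv state_sliceD(2)[OF L]])

lemma mean_state_almost_invariant:
  "cmod (mean_state n (conv x - x)) \<le> 2 * norm x * inverse (real (Suc n))"
proof -
  have eq: "mean_state n (conv x - x) = \<omega> (conv (cesaro conv n x) - cesaro conv n x)"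
    by (simp add: mean_state_def clinear_mapD[OF conv.clinear_cesaro] conv.cesaro_commute)
  show ?thesis
    unfolding eq by (rule order_trans[OF state_bound[OF state_sliceD(2)[OF L]]
        conv.norm_cesaro_diff_le])
qed

definition mean_state2 :: "nat \<Rightarrow> 'qq \<Rightarrow> complex" where
  "mean_state2 n X = mean_state n (L X)"

lemma mean_state2: "state (mean_state2 n)"
  unfolding mean_state2_def by (rule state_sliceD(6)[OF L mean_state])

text \<open>
  If \<open>h\<close> is a Haar state, then its convolution product with \<open>\<omega>(q \<cdot>)\<close> is \<open>\<omega>(q)h\<close>. The defect measures
  the failure of this identity for \<open>mean_state n\<close> instead of \<open>h\<close>, in the second leg of a functional
  on \<open>Q \<otimes> Q\<close> whose first leg is \<open>mean_state n\<close>.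
\<close>

definition defect :: "'q \<Rightarrow> nat \<Rightarrow> 'qq \<Rightarrow> complex" where
  "defect q n X = mean_state2 n (qq 1 q * cesaro conv2 n X) - \<omega> q * mean_state2 n
      (cesaro conv2 n X)"

lemma defect_clinear: "clinear_map (defect q n)"
  unfolding clinear_map_def defect_def
  by (simp add: clinear_mapD[OF conv2.clinear_cesaro] distrib_left scaleC_mult_right
      stateD[OF mean_state2] scaleC_complex_def algebra_simps)

lemma defect_bound: "cmod (defect q n X) \<le> 2 * norm q * norm X"
proof -
  have "cmod (mean_state2 n (qq 1 q * cesaro conv2 n X)) \<le> norm (qq 1 q * cesaro conv2 n X)"
    by (rule state_bound[OF mean_state2])
  also have "\<dots> \<le> norm q * norm X"
    using conv2.norm_cesaro_le[of n X]
    by (intro order_trans[OF norm_mult_ineq] mult_mono) (simp_all add: norm_tensor_one_left tensors)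
  finally have 1: "cmod (mean_state2 n (qq 1 q * cesaro conv2 n X)) \<le> norm q * norm X" .
  have "cmod (\<omega> q * mean_state2 n (cesaro conv2 n X)) \<le> norm q * norm X"
    unfolding norm_mult
    by (rule mult_mono[OF state_bound[OF state_sliceD(2)[OF L]]
          order_trans[OF state_bound[OF mean_state2] conv2.norm_cesaro_le]]) auto
  with 1 show ?thesis
    unfolding defect_def
    using norm_triangle_ineq4[of "mean_state2 n (qq 1 q * cesaro conv2 n X)"
        "\<omega> q * mean_state2 n (cesaro conv2 n X)"] by simp
qed

text \<open>
  With \<open>b\<close> the \<open>n\<close>-th mean of \<open>a\<close>, the element \<open>Y = \<Delta>(b) - b \<otimes> 1\<close> is small in the seminorm of the
  state \<open>mean_state n \<otimes> \<omega>\<close>, because \<open>b\<close> is almost fixed by the convolution and the state almost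
  invariant under it. By the Cauchy-Schwarz inequality, \<open>(c \<otimes> q)Y\<close> is small as well, and this is the
  defect up to another small term.
\<close>

lemma defect_generator_bound:
  "cmod (defect q n (qq c 1 * \<Delta> a)) \<le>
     norm c * norm q * norm a * sqrt (6 * inverse (real (Suc n))) +
     2 * norm c * norm q * norm a * inverse (real (Suc n))"
proof -
  define b where "b = cesaro conv n a"
  define \<epsilon> where "\<epsilon> = inverse (real (Suc n))"
  define Y where "Y = \<Delta> b - qq b 1"
  have b: "norm b \<le> norm a" unfolding b_def by (rule conv.norm_cesaro_le)
  have diff: "norm (conv b - b) \<le> 2 * norm a * \<epsilon>"
    unfolding b_def \<epsilon>_def by (rule conv.norm_cesaro_diff_le)
  have "cesaro conv2 n (qq c 1 * \<Delta> a) = qq c 1 * cesaro conv2 n (\<Delta> a)"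
    by (rule cesaro_intertwine[OF clinear_map_mult_left, symmetric]) (simp add: conv2_mult_left)
  also have "cesaro conv2 n (\<Delta> a) = \<Delta> b"
    unfolding b_def by (rule cesaro_intertwine[OF unital_star_homD(1)[OF hom_coproduct], symmetric])
      (simp add: conv2_\<Delta>)
  finally have ces: "cesaro conv2 n (qq c 1 * \<Delta> a) = qq c 1 * \<Delta> b" .
  have "qq 1 q * (qq c 1 * \<Delta> b) = qq c q * Y + qq (c * b) q"
    by (simp add: Y_def right_diff_distrib min_tensorD(3)[OF tensors(1)] flip: mult.assoc)
  then have "defect q n (qq c 1 * \<Delta> a) = mean_state2 n (qq c q * Y) - \<omega> q * mean_state n (c *
      (conv b - b))"
    unfolding defect_def ces
    by (simp add: stateD[OF mean_state2] mean_state2_def state_slice_mult[OF L] state_sliceD(5)[OF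
        L]
        L_lin stateD[OF mean_state] right_diff_distrib flip: conv_def)
  then have split: "cmod (defect q n (qq c 1 * \<Delta> a)) \<le>
      cmod (mean_state2 n (qq c q * Y)) + cmod (\<omega> q * mean_state n (c * (conv b - b)))"
    by (metis norm_triangle_ineq4)
  have "cmod (\<omega> q * mean_state n (c * (conv b - b))) \<le> norm q * (norm c * (2 * norm a * \<epsilon>))"
    unfolding norm_mult
    by (rule mult_mono[OF state_bound[OF state_sliceD(2)[OF L]] order_trans[OF state_bound[OF
        mean_state]
          order_trans[OF norm_mult_ineq mult_left_mono[OF diff]]]]) auto
  moreover have "cmod (mean_state2 n (qq c q * Y)) \<le> (norm c * norm q) * (sqrt (6 * \<epsilon>) * norm a)"
  proof (rule power2_le_imp_le)
    have "L (star Y * Y) = (conv (star b * b) - star b * b) - (star (conv b - b) * b) - star b *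
        (conv b - b)"
    proof -
      have "star Y * Y = \<Delta> (star b * b) - qq (star b) 1 * \<Delta> b - \<Delta> (star b) * qq b 1 + qq
          (star b * b) 1"
        by (simp add: Y_def star_diff \<Delta>_simps(1,2) min_tensorD(3,4)[OF tensors(1)] algebra_simps)
      then have "L (star Y * Y) = conv (star b * b) - star b * conv b - star (conv b) * b +
          star b * b"
        by (simp add: L_lin state_slice_mult[OF L] state_sliceD(5)[OF L] stateD(4)[OF
            state_sliceD(2)[OF L]]
            flip: conv_def conv_star)
      then show ?thesis by (simp add: star_diff algebra_simps)
    qed
    then have "mean_state2 n (star Y * Y) = mean_state n (conv (star b * b) - star b * b)
        - mean_state n (star (conv b - b) * b) - mean_state n (star b * (conv b - b))"
      by (simp add: mean_state2_def stateD[OF mean_state])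
    moreover have "cmod (mean_state n (conv (star b * b) - star b * b)) \<le> 2 * (norm a * norm a) * \<epsilon>"
    proof -
      have "norm (star b * b) \<le> norm a * norm a"
        using b by (intro order_trans[OF norm_mult_ineq] mult_mono) (simp_all add: norm_star)
      then have "2 * norm (star b * b) * \<epsilon> \<le> 2 * (norm a * norm a) * \<epsilon>"
        by (intro mult_right_mono mult_left_mono) (simp_all add: \<epsilon>_def)
      then show ?thesis
        using mean_state_almost_invariant[of n "star b * b"] unfolding \<epsilon>_def
            by (rule order_trans[rotated])
    qed
    moreover have "cmod (mean_state n (star (conv b - b) * b)) \<le> 2 * norm a * \<epsilon> * norm a"
      using diff b by (intro order_trans[OF state_bound[OF mean_state]] order_trans[OF
          norm_mult_ineq] mult_mono)
        (simp_all add: norm_star \<epsilon>_def)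
    moreover have "cmod (mean_state n (star b * (conv b - b))) \<le> norm a * (2 * norm a * \<epsilon>)"
      using diff b by (intro order_trans[OF state_bound[OF mean_state]] order_trans[OF
          norm_mult_ineq] mult_mono)
        (simp_all add: norm_star)
    ultimately have "cmod (mean_state2 n (star Y * Y)) \<le> 6 * \<epsilon> * (norm a)\<^sup>2"
      using norm_triangle_ineq4[of "mean_state n (conv (star b * b) - star b * b) - mean_state n
          (star (conv b - b) * b)" "mean_state n (star b * (conv b - b))"]
        norm_triangle_ineq4[of "mean_state n (conv (star b * b) - star b * b)"
            "mean_state n (star (conv b - b) * b)"]
      by (simp add: power2_eq_square mult_ac)
    then have Y: "Re (mean_state2 n (star Y * Y)) \<le> 6 * \<epsilon> * (norm a)\<^sup>2"
      using complex_Re_le_cmod order_trans by blast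
    have W: "Re (mean_state2 n (star (star (qq c q)) * star (qq c q))) \<le> (norm c * norm q)\<^sup>2"
    proof -
      have "cmod (mean_state2 n (star (star (qq c q)) * star (qq c q))) \<le>
          norm (star (star (qq c q)) * star (qq c q))"
        by (rule state_bound[OF mean_state2])
      also have "\<dots> = (norm (qq c q))\<^sup>2" by (simp only: norm_star_mult_self norm_star)
      also have "\<dots> \<le> (norm c * norm q)\<^sup>2" by (intro power_mono norm_tensor_le tensors) simp
      finally show ?thesis using complex_Re_le_cmod order_trans by blast
    qed
    have "(cmod (mean_state2 n (star (star (qq c q)) * Y)))\<^sup>2 \<le>
        (norm c * norm q)\<^sup>2 * (6 * \<epsilon> * (norm a)\<^sup>2)"
      by (rule order_trans[OF state_cauchy_schwarz[OF mean_state2] mult_mono[OF W Y]])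
        (simp_all add: stateD(2)[OF mean_state2])
    also have "\<dots> = ((norm c * norm q) * (sqrt (6 * \<epsilon>) * norm a))\<^sup>2"
      by (simp add: power_mult_distrib \<epsilon>_def)
    finally show "(cmod (mean_state2 n (qq c q * Y)))\<^sup>2 \<le>
        ((norm c * norm q) * (sqrt (6 * \<epsilon>) * norm a))\<^sup>2"
      by (simp add: star_star)
    show "0 \<le> norm c * norm q * (sqrt (6 * \<epsilon>) * norm a)" by (simp add: \<epsilon>_def)
  qed
  ultimately show ?thesis using split by (simp add: \<epsilon>_def mult_ac)
qed

text \<open>
  The elements \<open>(c \<otimes> 1)\<Delta>(a)\<close> span a dense subspace, and the defect, bounded uniformly in \<open>n\<close>, tends
  to \<open>0\<close> on them. Hence it tends to \<open>0\<close> everywhere, in particular at \<open>1 \<otimes> x\<close>.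
\<close>

theorem asymptotic_invariance:
  "(\<lambda>n. \<omega> (q * cesaro conv n x) - \<omega> q * \<omega> (cesaro conv n x)) \<longlonglongrightarrow> 0"
proof -
  define N where "N = {X. (\<lambda>n. defect q n X) \<longlonglongrightarrow> 0}"
  have "closed N"
    unfolding N_def by (rule closed_pointwise_null[OF defect_clinear]) (rule defect_bound)
  moreover have "cspan {qq c 1 * \<Delta> a |c a. c \<in> UNIV \<and> a \<in> UNIV} \<subseteq> N"
    unfolding cspan_def
  proof (intro complex_module.span_minimal complex_module.subspaceI)
    show "0 \<in> N" by (simp add: N_def clinear_mapD(4)[OF defect_clinear])
    show "X + Y \<in> N" if "X \<in> N" "Y \<in> N" for X Y
      using that tendsto_add[of "\<lambda>n. defect q n X" 0 sequentially "\<lambda>n. defect q n Y" 0]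
      by (simp add: N_def clinear_mapD(1)[OF defect_clinear])
    show "c *\<^sub>C X \<in> N" if "X \<in> N" for c X
      using that tendsto_mult_left[of "\<lambda>n. defect q n X" 0 sequentially c]
      by (simp add: N_def clinear_functional_scaleC[OF defect_clinear])
    have "qq c 1 * \<Delta> a \<in> N" for c a
      unfolding N_def mem_Collect_eq
    proof (rule Lim_null_comparison[OF always_eventually, OF allI, OF defect_generator_bound])
      show "(\<lambda>n. norm c * norm q * norm a * sqrt (6 * inverse (real (Suc n))) +
          2 * norm c * norm q * norm a * inverse (real (Suc n))) \<longlonglongrightarrow> 0"
        using tendsto_add[OF tendsto_mult_left[OF tendsto_real_sqrt[OF tendsto_mult_left[OF
                LIMSEQ_inverse_real_of_nat, of 6]], of "norm c * norm q * norm a"]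
            tendsto_mult_left[OF LIMSEQ_inverse_real_of_nat, of "2 * norm c * norm q * norm a"]]
        by (simp only: mult_zero_right real_sqrt_zero add_0)
    qed
    then show "{qq c 1 * \<Delta> a |c a. c \<in> UNIV \<and> a \<in> UNIV} \<subseteq> N" by blast
  qed
  ultimately have "closure (cspan {qq c 1 * \<Delta> a |c a. c \<in> UNIV \<and> a \<in> UNIV}) \<subseteq> N"
    by (intro closure_minimal)
  then have "tensor_sub qq UNIV UNIV \<subseteq> N"
    using cancellation unfolding cancellation_on_def by (elim conjE) simp
  then have "qq 1 x \<in> N"
    using min_tensorD(6)[OF tensors(1)] unfolding tensor_sub_def by auto
  moreover have "cesaro conv2 n (qq 1 x) = qq 1 (cesaro conv n x)" for n
    by (rule cesaro_intertwine[OF min_tensorD(2)[OF tensors(1)],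
        symmetric]) (simp add: conv2_tensor)
  ultimately show ?thesis
    by (simp add: N_def defect_def mean_state2_def min_tensorD(3)[OF tensors(1)]
        state_slice_one[OF L]
        stateD[OF mean_state])
qed

lemma conv_group_like: "\<Delta> s = qq s s \<Longrightarrow> conv s = \<omega> s *\<^sub>C s"
  by (simp add: conv_def state_sliceD(5)[OF L])

lemma conv_skew_primitive: "\<Delta> d = qq d 1 + qq s d \<Longrightarrow> conv d = d + \<omega> d *\<^sub>C s"
  by (simp add: conv_def L_lin state_sliceD(5)[OF L] stateD(4)[OF state_sliceD(2)[OF L]])

text \<open>
  On the span of \<open>s\<close> and \<open>d\<close> the powers of the convolution are explicit,
  \<open>conv\<^sup>k(d) = d + c(1 - \<omega>(s)\<^sup>k)s\<close>, and the means of the powers of \<open>\<omega>(s)\<close> tend to \<open>0\<close>. So the means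
  of \<open>d\<close> tend to \<open>d + cs\<close>, on which \<open>\<omega>\<close> takes the value \<open>c\<close>.
\<close>

lemma skew_primitive_invariance:
  assumes s: "\<Delta> s = qq s s" and d: "\<Delta> d = qq d 1 + qq s d" and ne: "\<omega> s \<noteq> 1"
    and c: "c = \<omega> d / (1 - \<omega> s)"
  shows "\<omega> (q * d) + c * \<omega> (q * s) = c * \<omega> q"
proof -
  define \<sigma> where "\<sigma> = \<omega> s"
  define m where "m n = of_real (inverse (real (Suc n))) * (\<Sum>k\<le>n. \<sigma> ^ k)" for n
  note \<omega> = stateD[OF state_sliceD(2)[OF L]]
  have cd: "\<omega> d = c * (1 - \<sigma>)" using ne by (simp add: c \<sigma>_def)
  have "cmod \<sigma> \<le> 1"
  proof (cases "s = 0")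
    case True
    then show ?thesis by (simp add: \<sigma>_def \<omega>)
  next
    case False
    then show ?thesis
      using conv.contraction[of s] unfolding conv_group_like[OF s] norm_scaleC \<sigma>_def by simp
  qed
  have pow: "(conv ^^ k) d = d + (c * (1 - \<sigma> ^ k)) *\<^sub>C s" for k
  proof (induction k)
    case (Suc k)
    have "(conv ^^ Suc k) d = (d + \<omega> d *\<^sub>C s) + (c * (1 - \<sigma> ^ k)) *\<^sub>C \<sigma> *\<^sub>C s"
      using Suc by (simp add: clinear_mapD[OF conv.clinear] conv_group_like[OF s]
          conv_skew_primitive[OF d] \<sigma>_def)
    also have "\<dots> = d + (\<omega> d + c * (1 - \<sigma> ^ k) * \<sigma>) *\<^sub>C s"
      by (simp add: scaleC_scaleC scaleC_add_left add.assoc)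
    also have "\<omega> d + c * (1 - \<sigma> ^ k) * \<sigma> = c * (1 - \<sigma> ^ Suc k)"
      by (simp add: cd algebra_simps)
    finally show ?case .
  qed simp
  have ces: "\<omega> (q' * cesaro conv n d) = \<omega> (q' * d) + c * (1 - m n) * \<omega> (q' * s)" for q' n
  proof -
    have "(\<Sum>k\<le>n. \<omega> (q' * (conv ^^ k) d)) =
        of_real (real (Suc n)) * (\<omega> (q' * d) + c * \<omega> (q' * s)) - c * (\<Sum>k\<le>n. \<sigma> ^ k) * \<omega> (q' * s)"
      unfolding pow by (simp add: distrib_left \<omega> scaleC_mult_right sum.distrib sum_distrib_left
          sum_distrib_right sum_subtractf algebra_simps)
    moreover have "\<omega> (q' * cesaro conv n d) = of_real (inverse (real (Suc n))) * (\<Sum>k\<le>n. \<omega> (q' *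
        (conv ^^ k) d))"
      unfolding cesaro_def by (simp add: \<omega> sum_distrib_left scaleC_mult_right divide_inverse
          del: of_nat_Suc flip: scaleC_of_real)
    ultimately have eq: "\<omega> (q' * cesaro conv n d) =
        of_real (inverse (real (Suc n))) * of_real (real (Suc n)) *
        (\<omega> (q' * d) + c * \<omega> (q' * s)) - c * m n * \<omega> (q' * s)"
      by (simp only: m_def right_diff_distrib mult_ac)
    have one: "(of_real (inverse (real (Suc n))) * of_real (real (Suc n)) :: complex) = 1"
      by (simp only: of_real_mult[symmetric]) simp
    show ?thesis using eq unfolding one by (simp add: algebra_simps)
  qed
  have "m \<longlonglongrightarrow> 0"
  proof (rule Lim_null_comparison[OF always_eventually, OF allI])
    fix n
    have "(1 - \<sigma>) * (\<Sum>k\<le>n. \<sigma> ^ k) = 1 - \<sigma> ^ Suc n" by (rule sum_gp_basic)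
    then have "cmod (1 - \<sigma>) * cmod (\<Sum>k\<le>n. \<sigma> ^ k) = cmod (1 - \<sigma> ^ Suc n)" by (metis norm_mult)
    also have "\<dots> \<le> 1 + cmod (\<sigma> ^ Suc n)" by (metis norm_one norm_triangle_ineq4)
    also have "\<dots> \<le> 2" using \<open>cmod \<sigma> \<le> 1\<close> by (simp add: norm_mult norm_power mult_le_one
        power_le_one)
    finally have "cmod (\<Sum>k\<le>n. \<sigma> ^ k) \<le> 2 / cmod (1 - \<sigma>)"
      using ne by (simp add: \<sigma>_def field_simps)
    then show "norm (m n) \<le> 2 / cmod (1 - \<sigma>) * inverse (real (Suc n))"
      unfolding m_def norm_mult norm_of_real
      by (subst mult.commute) (intro mult_mono, auto)
  next
    show "(\<lambda>n. 2 / cmod (1 - \<sigma>) * inverse (real (Suc n))) \<longlonglongrightarrow> 0"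
      using tendsto_mult_left[OF LIMSEQ_inverse_real_of_nat] by (simp only: mult_zero_right)
  qed
  define X where "X = \<omega> (q * d) - \<omega> q * \<omega> d"
  define Y where "Y = \<omega> (q * s) - \<omega> q * \<sigma>"
  have "\<omega> (q * cesaro conv n d) - \<omega> q * \<omega> (cesaro conv n d) = X + c * (1 - m n) * Y" for n
    unfolding ces[of q n] ces[of 1 n, unfolded mult_1]
        by (simp add: X_def Y_def \<sigma>_def algebra_simps)
  then have "(\<lambda>n. X + c * (1 - m n) * Y) \<longlonglongrightarrow> 0"
    using asymptotic_invariance[of q d] by simp
  moreover have "(\<lambda>n. X + c * (1 - m n) * Y) \<longlonglongrightarrow> X + c * (1 - 0) * Y"
    by (intro tendsto_intros \<open>m \<longlonglongrightarrow> 0\<close>)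
  ultimately have "X + c * Y = 0" using LIMSEQ_unique by fastforce
  then show ?thesis unfolding X_def Y_def cd by (simp add: algebra_simps)
qed

text \<open>
  Insert \<open>q = d\<close> and \<open>q = s\<close> into the invariance; eliminating \<open>\<omega>(ds)\<close> leaves \<open>\<omega>(d\<^sup>2)(1 - c\<^sup>2) = 0\<close>
  where \<open>\<omega>(d) = c(1 - \<omega>(s))\<close>.
\<close>

lemma state_on_skew_primitive:
  assumes s: "\<Delta> s = qq s s" and d: "\<Delta> d = qq d 1 + qq s d"
    and sq: "s * s + d * d = 1" and anti: "s * d + d * s = 0"
  shows "\<omega> s = 1 \<or> \<omega> (d * d) = 0 \<or> \<omega> d = 1 - \<omega> s \<or> \<omega> d = \<omega> s - 1"
proof (cases "\<omega> s = 1")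
  case False
  note \<omega> = stateD[OF state_sliceD(2)[OF L]]
  define c where "c = \<omega> d / (1 - \<omega> s)"
  note inv = skew_primitive_invariance[OF s d False c_def]
  have cd: "\<omega> d = c * (1 - \<omega> s)" using False by (simp add: c_def)
  have 1: "\<omega> (s * s) = 1 - \<omega> (d * d)"
    using arg_cong[OF sq, of \<omega>] by (simp add: \<omega> eq_diff_eq)
  have 2: "\<omega> (s * d) = - \<omega> (d * s)"
    using arg_cong[OF anti, of \<omega>] by (simp add: \<omega> eq_neg_iff_add_eq_0)
  have "\<omega> (d * d) + c * \<omega> (d * s) = c * (c * (1 - \<omega> s))" using inv[of d] by (simp only: cd)
  moreover have "- \<omega> (d * s) + c * (1 - \<omega> (d * d)) = c * \<omega> s" using inv[of s] by (simp only: 1 2)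
  then have "\<omega> (d * s) = c * (1 - \<omega> (d * d)) - c * \<omega> s" by (simp add: algebra_simps)
  ultimately have "\<omega> (d * d) * (1 - c * c) = 0" by (simp add: algebra_simps)
  then have "\<omega> (d * d) = 0 \<or> (1 - c) * (1 + c) = 0" by (simp add: algebra_simps)
  then have "\<omega> (d * d) = 0 \<or> c = 1 \<or> c = - 1" by (auto simp: eq_neg_iff_add_eq_0 add.commute)
  then show ?thesis by (auto simp: cd)
qed simp

end


section \<open>Equality of the initial and final projections\<close>

text \<open>
  In terms of \<open>e = A\<^sup>*A\<close> and \<open>f = AA\<^sup>*\<close>, the alternatives of the preceding lemma say that \<open>\<omega>\<close>
  vanishes on \<open>1 - e = B\<^sup>*B\<close>, on \<open>1 - f = BB\<^sup>*\<close> or on \<open>d\<^sup>2\<close>. If \<open>d\<close> were nonzero, then so would be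
  \<open>B\<close>, and a vector separating \<open>B\<close>, \<open>B\<^sup>*\<close> and \<open>d\<close> from \<open>0\<close> would define a vector state with none of
  these properties.
\<close>

lemma coefficient_normal:
  fixes qq :: "'q::cstar_algebra \<Rightarrow> 'q \<Rightarrow> 'qq::cstar_algebra"
    and qq_q :: "'qq \<Rightarrow> 'q \<Rightarrow> 'qqq::cstar_algebra"
  assumes cqg: "compact_quantum_group qq qq_q q_qq \<Delta>"
    and zero: "A * star B = 0" "star A * B = 0"
    and one: "A * star A + B * star B = 1" "star A * A + star B * B = 1"
    and \<Delta>: "\<Delta> A = qq A A + qq (star B) B" "\<Delta> B = qq B A + qq (star A) B"
  shows "star A * A = A * star A"
proof (rule ccontr)
  assume neq: "star A * A \<noteq> A * star A"
  interpret compact_quantum_group qq qq_q q_qq \<Delta> by (rule cqg)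
  have tens: "min_tensor qq" "min_tensor qq_q"
    using tensor_qqq by (simp_all add: triple_tensor_def)
  note hom = unital_star_homD[OF hom_coproduct]
      and lin = clinear_mapD[OF unital_star_homD(1)[OF hom_coproduct]]
  note lin1 = clinear_mapD[OF min_tensorD(1)[OF tens(1)]]
      and lin2 = clinear_mapD[OF min_tensorD(2)[OF tens(1)]]
  define e where "e = star A * A"
  define f where "f = A * star A"
  define s where "s = e + f - 1"
  define d where "d = e - f"
  have zero': "B * star A = 0" "star B * A = 0"
    using arg_cong[OF zero(1), of star] arg_cong[OF zero(2), of star]
        by (simp_all add: star_mult star_star)
  have BB: "star B * B = 1 - e" "B * star B = 1 - f"
    using one by (simp_all add: e_def f_def eq_diff_eq add.commute)
  have sa: "star e = e" "star f = f" by (simp_all add: e_def f_def star_mult star_star)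
  have "A * e = A"
    using arg_cong[OF BB(1), of "\<lambda>x. A * x"] by
        (simp add: zero(1) right_diff_distrib flip: mult.assoc)
  then have idem: "e * e = e" "f * f = f"
    by (simp_all add: e_def f_def mult.assoc) (metis mult.assoc)
  have sq: "s * s + d * d = 1" and anti: "s * d + d * s = 0"
    by (simp_all add: s_def d_def algebra_simps idem)
  have "\<Delta> e = qq e e + qq (1 - f) (1 - e)"
    unfolding BB[symmetric] unfolding e_def
    by (simp add: hom \<Delta> star_add min_tensorD(3,4)[OF tens(1)] star_star distrib_left distrib_right
        zero zero' lin1 lin2)
  moreover have "\<Delta> f = qq f f + qq (1 - e) (1 - f)"
    unfolding BB[symmetric] unfolding f_def
    by (simp add: hom \<Delta> star_add min_tensorD(3,4)[OF tens(1)] star_star distrib_left distrib_right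
        zero zero' lin1 lin2)
  ultimately have \<Delta>s: "\<Delta> s = qq s s" and \<Delta>d: "\<Delta> d = qq d 1 + qq s d"
    by (simp_all add: s_def d_def lin lin1 lin2 hom(4) min_tensorD(5)[OF tens(1)])
  have "d \<noteq> 0" using neq by (simp add: d_def e_def f_def)
  moreover have "B \<noteq> 0"
  proof
    assume "B = 0"
    then have "e = f" using BB by simp
    with \<open>d \<noteq> 0\<close> show False by (simp add: d_def)
  qed
  then have "star B \<noteq> 0" by (metis star_star star_zero)
  ultimately have F0: "finite {B, star B, d}" "0 \<notin> {B, star B, d}" using \<open>B \<noteq> 0\<close> by auto
  \<comment> \<open>The vector state needs slices on \<open>(Q \<otimes> Q) \<otimes> Q\<close>, so it comes from a representation
      for this product.\<close>
  obtain \<pi> \<rho> where reps: "spatial_reps qq_q \<pi> \<rho>" using tens(2) by (rule min_tensor_spatial_reps)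
  then have \<rho>: "faithful_rep \<rho>" by (simp add: spatial_reps_def)
  obtain \<xi> :: "'q \<Rightarrow> complex" where \<xi>: "\<xi> \<in> ell2"
      "ell2_norm \<xi> = 1" and sep: "\<forall>a\<in>{B, star B, d}. \<rho> a \<xi> \<noteq> (\<lambda>i. 0)"
    using separating_vector[OF \<rho> F0] .
  define \<omega> where "\<omega> b = ell2_inner (\<rho> b \<xi>) \<xi>" for b
  obtain L' where L': "state_slice qq_q (\<lambda>b. ell2_inner (\<rho> b \<xi>) \<xi>) L'"
    using vector_state_slice[OF tens(2) reps \<xi>] .
  obtain L where L: "state_slice qq (\<lambda>b. ell2_inner (\<rho> b \<xi>) \<xi>) L"
    using transfer_vector_state_slice[OF tensor_qqq L' \<rho> \<xi>] .
  obtain F G where FG: "is_tensor_hom qq qq_q \<Delta> id F" "is_tensor_hom qq q_qq id \<Delta> G" "F \<circ> \<Delta> = G \<circ> \<Delta>"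
    using coassociative by blast
  interpret sliced_quantum_group qq qq_q q_qq \<Delta> \<omega> L L' F G
    by unfold_locales (use L L' FG in \<open>simp_all add: \<omega>_def[abs_def]\<close>)
  note \<omega> = stateD[OF state_sliceD(2)[OF L]]
  have ne: "\<omega> (star a * a) \<noteq> 0" if "a \<in> {B, star B, d}" for a
  proof
    assume "\<omega> (star a * a) = 0"
    then have "ell2_norm (\<rho> a \<xi>) = 0"
      unfolding \<omega>_def vector_functional_mult[OF \<rho> \<xi>(1)] ell2_inner_self[OF faithful_repD(3)[OF \<rho>
          \<xi>(1)]] by simp
    then have "\<rho> a \<xi> = (\<lambda>i. 0)" using ell2_norm_eq_0[OF faithful_repD(3)[OF \<rho> \<xi>(1)]] by blast
    with bspec[OF sep that] show False by simp
  qed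
  have ne_e: "\<omega> (1 - e) \<noteq> 0" and ne_f: "\<omega> (1 - f) \<noteq> 0" and ne_d: "\<omega> (d * d) \<noteq> 0"
    using ne[of B] ne[of "star B"] ne[of d] by (simp_all add: BB star_star d_def star_diff sa)
  have "\<omega> s \<noteq> 1"
  proof
    assume "\<omega> s = 1"
    then have "\<omega> (1 - e) + \<omega> (1 - f) = 0" by (simp add: s_def \<omega> algebra_simps)
    moreover have "0 \<le> Re (\<omega> (1 - e))" "Im (\<omega> (1 - e)) = 0" "0 \<le> Re (\<omega> (1 - f))"
      using \<omega>(2,3)[of B] \<omega>(2)[of "star B"] by (simp_all add: BB star_star)
    ultimately show False using ne_e by (simp add: complex_eq_iff)
  qed
  then have "\<omega> d = 1 - \<omega> s \<or> \<omega> d = \<omega> s - 1"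
    using state_on_skew_primitive[OF \<Delta>s \<Delta>d sq anti] ne_d by blast
  then have "\<omega> (1 - e) = 0 \<or> \<omega> (1 - f) = 0"
    by (auto simp: s_def d_def \<omega> algebra_simps)
  with ne_e ne_f show False by blast
qed


section \<open>Generated C*-subalgebras\<close>

lemma closure_cspan_star_monoid:
  assumes one: "1 \<in> M" and mult: "\<And>x y. x \<in> M \<Longrightarrow> y \<in> M \<Longrightarrow> x * y \<in> M" and star: "\<And>x. x \<in> M \<Longrightarrow>
      star x \<in> M"
  shows "unital_cstar_subalgebra (closure (cspan M))"
proof -
  define V where "V = cspan M"
  have V: "x \<in> M \<Longrightarrow> x \<in> V" "x \<in> V \<Longrightarrow> y \<in> V \<Longrightarrow> x + y \<in> V" "x \<in> V \<Longrightarrow> c *\<^sub>C x \<in> V" "0 \<in> V" for x y c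
    unfolding V_def cspan_def
    by (auto intro: complex_module.span_base complex_module.span_add complex_module.span_scale
        complex_module.span_zero)
  have V_least: "V \<subseteq> W" if "M \<subseteq> W" "0 \<in> W" "\<And>x y. x \<in> W \<Longrightarrow> y \<in> W \<Longrightarrow> x + y \<in> W"
      "\<And>c x. x \<in> W \<Longrightarrow> c *\<^sub>C x \<in> W" for W
    unfolding V_def cspan_def using that by (intro complex_module.span_minimal
        complex_module.subspaceI)
  have "V \<subseteq> {x. \<forall>y\<in>M. x * y \<in> V}"
    by (rule V_least) (auto simp: distrib_right scaleC_mult_left intro: V mult)
  then have "V \<subseteq> {y. \<forall>x\<in>V. x * y \<in> V}"
    by (intro V_least) (auto simp: distrib_left scaleC_mult_right intro: V)
  then have V_mult: "x * y \<in> V" if "x \<in> V" "y \<in> V" for x y using that by blast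
  have "V \<subseteq> {x. star x \<in> V}"
    by (rule V_least) (auto simp: star_add star_scaleC intro: V star)
  then have V_star: "star x \<in> V" if "x \<in> V" for x using that by blast
  have lift2: "h x y \<in> closure V"
    if "continuous_on UNIV (\<lambda>p. h (fst p) (snd p))" "\<And>x y. x \<in> V \<Longrightarrow> y \<in> V \<Longrightarrow> h x y \<in> V"
        "x \<in> closure V" "y \<in> closure V"
    for h :: "'a \<Rightarrow> 'a \<Rightarrow> 'a" and x y
  proof -
    have "(\<lambda>p. h (fst p) (snd p)) ` closure (V \<times> V) \<subseteq> closure V"
      using that(2) closure_subset[of V]
      by (intro image_closure_subset continuous_on_subset[OF that(1)]) auto
    then show ?thesis using that(3,4) by (force simp: closure_Times)
  qed
  show ?thesis
    unfolding unital_cstar_subalgebra_def V_def[symmetric]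
  proof (intro conjI ballI allI)
    show "1 \<in> closure V" using V(1)[OF one] closure_subset by blast
    fix x assume x: "x \<in> closure V"
    show "star x \<in> closure V"
      by (rule lift2[of "\<lambda>x _. star x" x x])
        (intro continuous_star continuous_on_fst continuous_on_id V_star x | assumption)+
    show "c *\<^sub>C x \<in> closure V" for c
      by (rule lift2[of "\<lambda>x _. c *\<^sub>C x" x x])
        (intro continuous_scaleC continuous_on_fst continuous_on_id V(3) x | assumption)+
    fix y assume y: "y \<in> closure V"
    show "x + y \<in> closure V"
      by (rule lift2[of "\<lambda>x y. x + y" x y]) (intro continuous_intros V(2) x y | assumption)+
    show "x * y \<in> closure V"
      by (rule lift2[of "\<lambda>x y. x * y" x y]) (intro continuous_intros V_mult x y | assumption)+
  qed simp
qed

lemma vimage_subalgebra: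
  assumes f: "unital_star_hom f" and S: "unital_cstar_subalgebra S"
  shows "unital_cstar_subalgebra {x. f x \<in> S}"
proof -
  have "closed (f -` S)"
    using bounded_linear.continuous_on[OF unital_star_hom_bounded_linear[OF f] continuous_on_id]
    by (intro closed_vimage unital_cstar_subalgebraD(1)[OF S]) simp
  then have "closed {x. f x \<in> S}" by (simp add: vimage_def)
  then show ?thesis
    unfolding unital_cstar_subalgebra_def
    by (simp add: unital_star_homD[OF f] clinear_mapD[OF unital_star_homD(1)[OF f]]
        unital_cstar_subalgebraD[OF S])
qed

text \<open>
  Self-adjointness of \<open>X\<close> is what makes its centralizer closed under the involution.
\<close>

lemma centralizer_subalgebra:
  assumes "\<And>x. x \<in> X \<Longrightarrow> star x \<in> X"
  shows "unital_cstar_subalgebra {y. \<forall>x\<in>X. x * y = y * x}"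
  unfolding unital_cstar_subalgebra_def
proof (intro conjI ballI allI)
  have "closed (\<Inter>x\<in>X. {y. x * y = y * x})"
    by (intro closed_INT ballI closed_Collect_eq continuous_intros)
  then show "closed {y. \<forall>x\<in>X. x * y = y * x}" by (simp add: Collect_ball_eq)
  fix y assume y: "y \<in> {y. \<forall>x\<in>X. x * y = y * x}"
  show "c *\<^sub>C y \<in> {y. \<forall>x\<in>X. x * y = y * x}" for c
    using y by (simp add: scaleC_mult_left scaleC_mult_right)
  show "star y \<in> {y. \<forall>x\<in>X. x * y = y * x}"
  proof (intro CollectI ballI)
    fix x assume "x \<in> X"
    then have "star x * y = y * star x" using assms y by blast
    from arg_cong[OF this, of star] show "x * star y = star y * x"
        by (simp add: star_mult star_star)
  qed
  fix z assume z: "z \<in> {y. \<forall>x\<in>X. x * y = y * x}"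
  show "y + z \<in> {y. \<forall>x\<in>X. x * y = y * x}" using y z by (simp add: distrib_left distrib_right)
  show "y * z \<in> {y. \<forall>x\<in>X. x * y = y * x}"
  proof (intro CollectI ballI)
    fix x assume "x \<in> X"
    then have xy: "x * y = y * x" and xz: "x * z = z * x" using y z by auto
    have "x * (y * z) = y * (x * z)" by (simp add: xy flip: mult.assoc)
    then show "x * (y * z) = y * z * x" by (simp add: xz mult.assoc)
  qed
qed simp

definition cstar_generated :: "'a::cstar_algebra set \<Rightarrow> 'a set" where
  "cstar_generated X = \<Inter>{S. unital_cstar_subalgebra S \<and> X \<subseteq> S}"

lemma cstar_generated_subalgebra: "unital_cstar_subalgebra (cstar_generated X)"
proof -
  have "closed (cstar_generated X)"
    unfolding cstar_generated_def by (intro closed_Inter ballI)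
        (auto simp: unital_cstar_subalgebra_def)
  then show ?thesis
    unfolding unital_cstar_subalgebra_def
    by (auto simp: cstar_generated_def intro: unital_cstar_subalgebraD)
qed

lemma cstar_generated_superset: "X \<subseteq> cstar_generated X"
  by (auto simp: cstar_generated_def)

lemma cstar_generated_least: "unital_cstar_subalgebra S \<Longrightarrow> X \<subseteq> S \<Longrightarrow> cstar_generated X \<subseteq> S"
  by (auto simp: cstar_generated_def)

text \<open>
  Two applications of minimality to centralizers: first that of \<open>X\<close>, then that of the generated
  algebra.
\<close>

lemma cstar_generated_commute:
  assumes star: "\<And>x. x \<in> X \<Longrightarrow> star x \<in> X" and comm: "\<And>x y. x \<in> X \<Longrightarrow> y \<in> X \<Longrightarrow> x * y = y * x"
    and "x \<in> cstar_generated X" "y \<in> cstar_generated X"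
  shows "x * y = y * x"
proof -
  note S = cstar_generated_subalgebra[of X]
  have "cstar_generated X \<subseteq> {y. \<forall>x\<in>X. x * y = y * x}"
    using comm by (intro cstar_generated_least centralizer_subalgebra star) auto
  then have "cstar_generated X \<subseteq> {y. \<forall>x\<in>cstar_generated X. x * y = y * x}"
    by (intro cstar_generated_least centralizer_subalgebra unital_cstar_subalgebraD(6)[OF S]) auto
  with assms(3,4) show ?thesis by blast
qed

lemma unital_cstar_subalgebra_UNIV: "unital_cstar_subalgebra UNIV"
  by (simp add: unital_cstar_subalgebra_def)

lemma closure_cspan_least:
  assumes S: "unital_cstar_subalgebra S" and "M \<subseteq> S"
  shows "closure (cspan M) \<subseteq> S"
proof -
  note sub = unital_cstar_subalgebraD[OF S]
  have "0 \<in> S" using sub(5)[OF sub(2), of 0] by simp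
  then have "cspan M \<subseteq> S"
    unfolding cspan_def using assms(2) sub(3,5)
    by (intro complex_module.span_minimal complex_module.subspaceI) auto
  then show ?thesis using sub(1) by (rule closure_minimal)
qed

text \<open>
  This covers the tensor product of two subalgebras as well as the left-hand sides of the density
  conditions for a quantum group and for an action, once the algebras in question are commutative.
\<close>

lemma commuting_products_subalgebra:
  assumes g: "unital_star_hom g" and h: "unital_star_hom h"
    and U: "unital_cstar_subalgebra U" and S: "unital_cstar_subalgebra S"
    and comm: "\<forall>a\<in>U. \<forall>b\<in>S. g a * h b = h b * g a"
  defines "D \<equiv> closure (cspan {g a * h b |a b. a \<in> U \<and> b \<in> S})"
  shows "unital_cstar_subalgebra D" "a \<in> U \<Longrightarrow> g a \<in> D" "b \<in> S \<Longrightarrow> h b \<in> D"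
proof -
  define M where "M = {g a * h b |a b. a \<in> U \<and> b \<in> S}"
  note subU = unital_cstar_subalgebraD[OF U] and subS = unital_cstar_subalgebraD[OF S]
  note homg = unital_star_homD[OF g] and homh = unital_star_homD[OF h]
  have M: "g a * h b \<in> M" if "a \<in> U" "b \<in> S" for a b using that unfolding M_def by blast
  have D: "x \<in> D" if "x \<in> M" for x
    using that closure_subset[of "cspan M"] complex_module.span_base[of x M]
    unfolding D_def M_def[symmetric] cspan_def by blast
  have one: "1 \<in> M" using M[OF subU(2) subS(2)] by (simp add: homg homh)
  have mult: "x * y \<in> M" if xy: "x \<in> M" "y \<in> M" for x y
  proof -
    obtain a b a' b' where *: "x = g a * h b" "y = g a' * h b'" "a \<in> U" "b \<in> S" "a' \<in> U" "b' \<in> S"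
      using xy unfolding M_def by blast
    have "x * y = g a * (h b * g a') * h b'" by (simp add: * mult.assoc)
    also have "h b * g a' = g a' * h b" using comm * by simp
    finally have "x * y = g (a * a') * h (b * b')" by (simp add: homg homh mult.assoc)
    then show ?thesis using M subU(4) subS(4) * by simp
  qed
  have "star x \<in> M" if x: "x \<in> M" for x
  proof -
    obtain a b where *: "x = g a * h b" "a \<in> U" "b \<in> S" using x unfolding M_def by blast
    have "star x = h (star b) * g (star a)" by (simp add: * star_mult homg homh)
    also have "\<dots> = g (star a) * h (star b)" using comm subU(6) subS(6) * by simp
    finally show ?thesis using M subU(6) subS(6) * by simp
  qed
  from closure_cspan_star_monoid[OF one mult this] show "unital_cstar_subalgebra D"
    unfolding D_def M_def .
  show "g a \<in> D" if "a \<in> U" using D[OF M[OF that subS(2)]] by (simp add: homh)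
  show "h b \<in> D" if "b \<in> S" using D[OF M[OF subU(2) that]] by (simp add: homg)
qed

lemma tensor_sub_subalgebra:
  assumes t: "min_tensor t" and U: "unital_cstar_subalgebra U" and S: "unital_cstar_subalgebra S"
  shows "unital_cstar_subalgebra (tensor_sub t U S)"
    and "a \<in> U \<Longrightarrow> b \<in> S \<Longrightarrow> t a b \<in> tensor_sub t U S"
proof -
  have eq: "tensor_sub t U S = closure (cspan {t a 1 * t 1 b |a b. a \<in> U \<and> b \<in> S})"
    unfolding tensor_sub_def tensor_factor[OF t, symmetric] ..
  have comm: "\<forall>a\<in>U. \<forall>b\<in>S. t a 1 * t 1 b = t 1 b * t a 1" by (simp add: min_tensorD(3)[OF t])
  note prod = commuting_products_subalgebra[OF tensor_one_hom[OF t] U S comm, folded eq]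
  show *: "unital_cstar_subalgebra (tensor_sub t U S)" by (rule prod(1))
  show "t a b \<in> tensor_sub t U S" if "a \<in> U" "b \<in> S"
    unfolding tensor_factor[OF t, of a b] by (intro unital_cstar_subalgebraD(4)[OF *] prod that)
qed

lemma tensor_sub_least:
  assumes t: "min_tensor t" and W: "unital_cstar_subalgebra W"
    and "\<And>a. a \<in> U \<Longrightarrow> t a 1 \<in> W" "\<And>b. b \<in> S \<Longrightarrow> t 1 b \<in> W"
  shows "tensor_sub t U S \<subseteq> W"
proof -
  have "t a b \<in> W" if "a \<in> U" "b \<in> S" for a b
    unfolding tensor_factor[OF t, of a b] by (intro unital_cstar_subalgebraD(4)[OF W] assms(3,4)
        that)
  then show ?thesis unfolding tensor_sub_def by (intro closure_cspan_least[OF W]) auto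
qed

lemma tensor_sub_commute:
  assumes t: "min_tensor t" and U: "unital_cstar_subalgebra U" and S: "unital_cstar_subalgebra S"
    and comm: "\<And>a a'. a \<in> U \<Longrightarrow> a' \<in> U \<Longrightarrow> a * a' = a' * a" "\<And>b b'. b \<in> S \<Longrightarrow> b' \<in> S \<Longrightarrow> b * b' = b' * b"
    and xy: "x \<in> tensor_sub t U S" "y \<in> tensor_sub t U S"
  shows "x * y = y * x"
proof (rule cstar_generated_commute)
  let ?M = "{t a b |a b. a \<in> U \<and> b \<in> S}"
  show "star x \<in> ?M" if x: "x \<in> ?M" for x
  proof -
    obtain a b where x: "x = t a b" "a \<in> U" "b \<in> S" using x by blast
    have "star a \<in> U" "star b \<in> S"
      using x unital_cstar_subalgebraD(6)[OF U] unital_cstar_subalgebraD(6)[OF S] by auto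
    then show ?thesis unfolding x(1) min_tensorD(4)[OF t] by blast
  qed
  show "x * y = y * x" if xy: "x \<in> ?M" "y \<in> ?M" for x y
  proof -
    obtain a b where x: "x = t a b" "a \<in> U" "b \<in> S" using xy(1) by blast
    obtain a' b' where y: "y = t a' b'" "a' \<in> U" "b' \<in> S" using xy(2) by blast
    show ?thesis
      unfolding x(1) y(1) min_tensorD(3)[OF t] comm(1)[OF x(2) y(2)] comm(2)[OF x(3) y(3)] ..
  qed
  have "tensor_sub t U S \<subseteq> cstar_generated ?M"
    unfolding tensor_sub_def
    by (rule closure_cspan_least[OF cstar_generated_subalgebra cstar_generated_superset])
  with xy show "x \<in> cstar_generated ?M" "y \<in> cstar_generated ?M" by auto
qed


section \<open>Linear actions on the circle\<close>

lemma circle_z_unitary: "star circle_z * circle_z = 1" "circle_z * star circle_z = 1"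
proof -
  have "cnj (of_circle w) * of_circle w = 1" "of_circle w * cnj (of_circle w) = 1" for w
    using complex_norm_square[of "of_circle w"] by (simp_all add: mult.commute)
  then show "star circle_z * circle_z = 1" "circle_z * star circle_z = 1"
    by (auto intro!: bcontfun_eqI simp: apply_circle_z star_complex_def)
qed

lemma continuous_to_circle: "continuous_on (sphere 0 1) to_circle"
  unfolding continuous_on_iff dist_circle_def by (auto simp: to_circle_inverse)

text \<open>
  The Stone-Weierstrass theorem for the algebra generated by \<open>z\<close>: real polynomials in \<open>Re z\<close> and
  \<open>Im z\<close> are polynomials in \<open>z\<close> and its conjugate.
\<close>

lemma circle_generated:
  fixes S :: "(circle \<Rightarrow>\<^sub>C complex) set"
  assumes S: "unital_cstar_subalgebra S" and z: "circle_z \<in> S"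
  shows "f \<in> S"
proof -
  note sub = unital_cstar_subalgebraD[OF S]
  have const: "c *\<^sub>C 1 \<in> S" for c by (intro sub)
  have real_poly: "\<exists>h\<in>S. \<forall>w. apply_bcontfun h w = of_real (p (of_circle w))"
    if "real_polynomial_function p" for p
    using that
  proof (induction p rule: real_polynomial_function.induct)
    case (linear p)
    \<comment> \<open>A real linear form is \<open>w \<mapsto> Re w p(1) + Im w p(\<i>)\<close>, with \<open>2 Re w = w + cnj w\<close>
        and \<open>2 \<i> Im w = w - cnj w\<close>.\<close>
    define h where "h = complex_of_real (1/2) *\<^sub>C ((of_real (p 1) - \<i> * of_real (p \<i>)) *\<^sub>C circle_z
        + (of_real (p 1) + \<i> * of_real (p \<i>)) *\<^sub>C star circle_z)"
    have "h \<in> S" unfolding h_def by (intro sub z)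
    moreover have "apply_bcontfun h w = of_real (p (of_circle w))" for w
    proof -
      have "of_circle w = Re (of_circle w) *\<^sub>R 1 + Im (of_circle w) *\<^sub>R \<i>"
        by (simp add: complex_eq_iff)
      then have "p (of_circle w) = p (Re (of_circle w) *\<^sub>R 1 + Im (of_circle w) *\<^sub>R \<i>)" by simp
      also have "\<dots> = Re (of_circle w) * p 1 + Im (of_circle w) * p \<i>"
        using bounded_linear.linear[OF linear]
            by (simp only: linear_add linear_scale real_scaleR_def)
      finally show ?thesis
        by (simp add: h_def apply_circle_z star_complex_def scaleC_complex_def complex_eq_iff
            algebra_simps)
    qed
    ultimately show ?case by blast
  next
    case (const c)
    show ?case
      by (intro bexI[of _ "of_real c *\<^sub>C 1"] allI \<open>of_real c *\<^sub>C 1 \<in> S\<close>)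
          (simp add: scaleC_complex_def)
  next
    case (add p q)
    then obtain h k where "h \<in> S" "k \<in> S" "\<forall>w. apply_bcontfun h w = of_real (p (of_circle w))"
      "\<forall>w. apply_bcontfun k w = of_real (q (of_circle w))" by blast
    then show ?case by (intro bexI[of _ "h + k"] sub) auto
  next
    case (mult p q)
    then obtain h k where "h \<in> S" "k \<in> S" "\<forall>w. apply_bcontfun h w = of_real (p (of_circle w))"
      "\<forall>w. apply_bcontfun k w = of_real (q (of_circle w))" by blast
    then show ?case by (intro bexI[of _ "h * k"] sub) auto
  qed
  have "\<exists>h\<in>S. dist h f < e" if "0 < e" for e
  proof -
    have "continuous_on (sphere 0 1) (\<lambda>v. apply_bcontfun f (to_circle v))"
      by (intro continuous_on_compose2[OF _ continuous_to_circle, of UNIV]) auto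
    then obtain p where p: "polynomial_function p"
      and close: "\<And>v. v \<in> sphere 0 1 \<Longrightarrow> norm (apply_bcontfun f (to_circle v) - p v) < e / 2"
      using Stone_Weierstrass_polynomial_function[OF compact_sphere, of _ _ _ "e / 2"] \<open>0 < e\<close>
          by fastforce
    have "real_polynomial_function (\<lambda>v. Re (p v))" "real_polynomial_function (\<lambda>v. Im (p v))"
      using p bounded_linear_Re bounded_linear_Im unfolding polynomial_function_def comp_def
          by blast+
    then obtain h k where hk: "h \<in> S" "k \<in> S" "\<And>w. apply_bcontfun h w =
        of_real (Re (p (of_circle w)))"
        "\<And>w. apply_bcontfun k w = of_real (Im (p (of_circle w)))"
      using real_poly by meson
    have "dist (h + \<i> *\<^sub>C k) f \<le> e / 2"
    proof (rule dist_bound)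
      fix w
      have "apply_bcontfun (h + \<i> *\<^sub>C k) w = p (of_circle w)"
        by (simp add: hk scaleC_complex_def complex_eq_iff)
      then show "dist (apply_bcontfun (h + \<i> *\<^sub>C k) w) (apply_bcontfun f w) \<le> e / 2"
        using close[of "of_circle w"] by (simp add: of_circle_inverse dist_norm norm_minus_commute)
    qed
    moreover have "h + \<i> *\<^sub>C k \<in> S" by (intro sub hk)
    ultimately show ?thesis using \<open>0 < e\<close> by (intro bexI[of _ "h + \<i> *\<^sub>C k"]) auto
  qed
  then have "f \<in> closure S" by (auto simp: closure_approachable)
  then show ?thesis using sub(1) by simp
qed

lemma circle_functions_independent:
  assumes "c *\<^sub>C 1 + c1 *\<^sub>C (circle_z * circle_z) + c2 *\<^sub>C (star circle_z * star circle_z) = 0"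
  shows "c = 0" "c1 = 0" "c2 = 0"
proof -
  have eq: "c + c1 * v\<^sup>2 + c2 * (cnj v)\<^sup>2 = 0" if "cmod v = 1" for v
    using arg_cong[OF assms, of "\<lambda>f. apply_bcontfun f (to_circle v)"] that
    by (simp add: apply_circle_z star_complex_def scaleC_complex_def to_circle_inverse
        power2_eq_square)
  \<comment> \<open>Here \<open>r\<^sup>2 = \<i>\<close>; the points \<open>1\<close>, \<open>\<i>\<close> and \<open>r\<close> give three independent equations.\<close>
  define r where "r = cis (pi / 4)"
  have r: "r\<^sup>2 = \<i>" "(cnj r)\<^sup>2 = - \<i>" "cmod r = 1"
    unfolding r_def by (simp_all add: Complex.DeMoivre cis_cnj flip: cis_minus_pi_half)
  have 1: "c + c1 + c2 = 0" using eq[of 1] by simp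
  have 2: "c - c1 - c2 = 0" using eq[of \<i>] by simp
  have 3: "c + c1 * \<i> - c2 * \<i> = 0" using eq[of r] r by simp
  have "2 * c = (c + c1 + c2) + (c - c1 - c2)" by simp
  then show c: "c = 0" unfolding 1 2 by simp
  have 4: "c1 = - c2" using 1 c by (simp add: eq_neg_iff_add_eq_0)
  have "c1 = c2" using 3 c by (simp flip: left_diff_distrib)
  with 4 have "2 * c2 = 0" by (simp only: mult_2 eq_neg_iff_add_eq_0)
  with 4 show "c1 = 0" "c2 = 0" by simp_all
qed

lemma tensor_circle_independent:
  fixes t :: "(circle \<Rightarrow>\<^sub>C complex) \<Rightarrow> 'b::cstar_algebra \<Rightarrow> 'c::cstar_algebra"
  assumes t: "min_tensor t"
    and sum: "t 1 x + t (circle_z * circle_z) y + t (star circle_z * star circle_z) w = 0"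
  shows "x = 0" "y = 0" "w = 0"
proof -
  define a where "a k = [1, circle_z * circle_z, star circle_z * star circle_z] ! k" for k
  define b where "b k = [x, y, w] ! k" for k
  have sum3: "(\<Sum>k<3. g k) = g 0 + g 1 + g 2" for g :: "nat \<Rightarrow> 'z::comm_monoid_add"
    by (simp add: numeral_3_eq_3 numeral_2_eq_2)
  have "(\<Sum>k<3. t (a k) (b k)) = 0" using sum by (simp add: sum3 a_def b_def)
  moreover have "\<forall>k<3. c k = 0" if "(\<Sum>k<3. c k *\<^sub>C a k) = 0" for c
  proof -
    have "c 0 *\<^sub>C 1 + c 1 *\<^sub>C (circle_z * circle_z) + c 2 *\<^sub>C (star circle_z * star circle_z) = 0"
      using that by (simp add: sum3 a_def)
    from circle_functions_independent[OF this] show ?thesis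
      by (simp add: numeral_3_eq_3 less_Suc_eq numeral_2_eq_2)
  qed
  ultimately have "b k = 0" if "k < 3" for k
    using tensor_left_independent[OF t] that by blast
  from this[of 0] this[of 1] this[of 2] show "x = 0" "y = 0" "w = 0" by (simp_all add: b_def)
qed

text \<open>
  Multiplication by \<open>z \<otimes> 1\<close> reduces this to the preceding independence.
\<close>

lemma tensor_circle_independent2:
  fixes t :: "(circle \<Rightarrow>\<^sub>C complex) \<Rightarrow> 'b::cstar_algebra \<Rightarrow> 'c::cstar_algebra"
  assumes t: "min_tensor t" and eq: "t circle_z x + t (star circle_z) y =
      t circle_z x' + t (star circle_z) y'"
  shows "x = x'" "y = y'"
proof -
  note lin2 = clinear_mapD[OF min_tensorD(2)[OF t]]
  have "t circle_z 1 * (t circle_z (x - x') + t (star circle_z) (y - y')) = 0"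
    using eq by (simp add: lin2 algebra_simps)
  then have "t 1 (y - y') + t (circle_z * circle_z) (x - x') + t
      (star circle_z * star circle_z) 0 = 0"
    by (simp add: distrib_left min_tensorD(3)[OF t] circle_z_unitary lin2(4) add.commute)
  from tensor_circle_independent[OF t this] show "x = x'" "y = y'" by simp_all
qed

text \<open>
  The coefficients of \<open>1\<close>, \<open>z\<^sup>2\<close> and \<open>z\<^sup>-\<^sup>2\<close> in \<open>\<alpha>(z)\<alpha>(z)\<^sup>* = 1 = \<alpha>(z)\<^sup>*\<alpha>(z)\<close>.
\<close>

lemma linear_action_relations:
  assumes t: "min_tensor t" and \<alpha>: "unital_star_hom \<alpha>"
    and z: "\<alpha> circle_z = t circle_z A + t (star circle_z) B"
  shows "A * star B = 0" "star A * B = 0" "A * star A + B * star B = 1"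
      "star A * A + star B * B = 1"
proof -
  note hom = unital_star_homD[OF \<alpha>]
  note lin2 = clinear_mapD[OF min_tensorD(2)[OF t]]
  have z': "\<alpha> (star circle_z) = t (star circle_z) (star A) + t circle_z (star B)"
    by (simp add: hom z star_add min_tensorD(4)[OF t] star_star)
  have "\<alpha> circle_z * \<alpha> (star circle_z) = t 1 1"
    unfolding hom(2)[symmetric] by (simp add: circle_z_unitary hom(4) min_tensorD(5)[OF t])
  then have "t 1 (A * star A + B * star B - 1) + t (circle_z * circle_z) (A * star B)
      + t (star circle_z * star circle_z) (B * star A) = 0"
    unfolding z z' by (simp add: algebra_simps min_tensorD(3)[OF t] circle_z_unitary lin2)
  from tensor_circle_independent[OF t this]
  show "A * star B = 0" "A * star A + B * star B = 1" by simp_all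
  have "\<alpha> (star circle_z) * \<alpha> circle_z = t 1 1"
    unfolding hom(2)[symmetric] by (simp add: circle_z_unitary hom(4) min_tensorD(5)[OF t])
  then have "t 1 (star A * A + star B * B - 1) + t (circle_z * circle_z) (star B * A)
      + t (star circle_z * star circle_z) (star A * B) = 0"
    unfolding z z' by (simp add: algebra_simps min_tensorD(3)[OF t] circle_z_unitary lin2)
  from tensor_circle_independent[OF t this]
  show "star A * B = 0" "star A * A + star B * B = 1" by simp_all
qed

text \<open>
  The coefficients of \<open>z\<close> and \<open>z\<^sup>-\<^sup>1\<close> in the coaction identity at \<open>z\<close>.
\<close>

lemma linear_action_coproduct:
  assumes "quantum_group_action qq qq_q q_qq \<Delta> aq aq_q a_qq \<alpha>"
    and z: "\<alpha> circle_z = aq circle_z A + aq (star circle_z) B"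
  shows "\<Delta> A = qq A A + qq (star B) B" "\<Delta> B = qq B A + qq (star A) B"
proof -
  interpret quantum_group_action qq qq_q q_qq \<Delta> aq aq_q a_qq \<alpha> by (rule assms(1))
  have tens: "min_tensor aq" "min_tensor aq_q" "min_tensor qq" "min_tensor a_qq"
    and assoc: "\<And>a b c. aq_q (aq a b) c = a_qq a (qq b c)"
    using tensor_aqq by (simp_all add: triple_tensor_def)
  obtain F G where F: "is_tensor_hom aq aq_q \<alpha> id F" and G: "is_tensor_hom aq a_qq id \<Delta> G"
    and FG: "F \<circ> \<alpha> = G \<circ> \<alpha>"
    using action_coassociative by blast
  have F_lin: "clinear_map F" and G_lin: "clinear_map G"
    and F_tensor: "\<And>a b. F (aq a b) = aq_q (\<alpha> a) b" and G_tensor: "\<And>a b. G (aq a b) = a_qq a (\<Delta> b)"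
    using F G by (simp_all add: is_tensor_hom_def unital_star_hom_def)
  have z': "\<alpha> (star circle_z) = aq (star circle_z) (star A) + aq circle_z (star B)"
    by (simp add: unital_star_homD(3)[OF hom_action] z star_add min_tensorD(4)[OF tens(1)]
        star_star)
  have "a_qq circle_z (\<Delta> A) + a_qq (star circle_z) (\<Delta> B) = F (\<alpha> circle_z)"
    using fun_cong[OF FG, of circle_z] by (simp add: z clinear_mapD[OF G_lin] G_tensor)
  also have "\<dots> = aq_q (\<alpha> circle_z) A + aq_q (\<alpha> (star circle_z)) B"
    by (simp add: z clinear_mapD[OF F_lin] F_tensor)
  also have "\<dots> = a_qq circle_z (qq A A + qq (star B) B) + a_qq (star circle_z) (qq B A + qq
      (star A) B)"
    unfolding z z' by (simp add: clinear_mapD[OF min_tensorD(1)[OF tens(2)]]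
        clinear_mapD[OF min_tensorD(2)[OF tens(4)]] assoc add_ac)
  finally show "\<Delta> A = qq A A + qq (star B) B" "\<Delta> B = qq B A + qq (star A) B"
    using tensor_circle_independent2[OF tens(4)] by blast+
qed

lemma partial_isometry_relations_commute:
  assumes zero: "A * star B = 0" "star A * B = 0" and one: "A * star A + B * star B = 1"
      "star A * A + star B * B = 1"
    and normal: "star A * A = A * star A"
    and xy: "x \<in> {A, B, star A, star B}" "y \<in> {A, B, star A, star B}"
  shows "A * B = 0" "B * A = 0" "x * y = y * x"
proof -
  have zero': "B * star A = 0" "star B * A = 0"
    using arg_cong[OF zero(1), of star] arg_cong[OF zero(2), of star]
        by (simp_all add: star_mult star_star)
  have normal': "star B * B = B * star B"
    using one[unfolded normal] by (metis add_left_cancel)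
  have "star (A * B) * (A * B) = star B * (star A * A) * B" by (simp add: star_mult mult.assoc)
  also have "\<dots> = 0" unfolding normal by (simp add: mult.assoc zero)
  finally show AB: "A * B = 0" by (rule star_mult_self_eq_0)
  have "star (B * A) * (B * A) = star A * (star B * B) * A" by (simp add: star_mult mult.assoc)
  also have "\<dots> = 0" unfolding normal' by (simp add: mult.assoc zero')
  finally show BA: "B * A = 0" by (rule star_mult_self_eq_0)
  have "star A * star B = 0" "star B * star A = 0"
    using AB BA by (simp_all flip: star_mult)
  note all = this AB BA zero zero' normal normal'
  show "x * y = y * x" using xy by (elim insertE emptyE) (simp_all only: all)
qed

text \<open>
  With the restriction of \<open>\<Delta>\<close>, the algebra \<open>S\<close> is a compact quantum group that acts by \<open>\<alpha>\<close>. By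
  commutativity the closed spans in the density conditions are C*-algebras, so it is enough to find
  generators of the tensor products in them; these come from the unitarity of the matrix of
  coefficients, for instance \<open>1 \<otimes> A = (A\<^sup>* \<otimes> 1)\<Delta>(A) + (B\<^sup>* \<otimes> 1)\<Delta>(B)\<close>.
\<close>

lemma action_restricts_to_coefficients:
  fixes aq :: "(circle \<Rightarrow>\<^sub>C complex) \<Rightarrow> 'q::cstar_algebra \<Rightarrow> 'aq::cstar_algebra"
  assumes qga: "quantum_group_action qq qq_q q_qq \<Delta> aq aq_q a_qq \<alpha>"
    and z: "\<alpha> circle_z = aq circle_z A + aq (star circle_z) B"
    and normal: "star A * A = A * star A"
  defines "S \<equiv> cstar_generated {A, B, star A, star B}"
  shows "\<forall>q\<in>S. \<Delta> q \<in> tensor_sub qq S S" "cancellation_on qq \<Delta> S"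
    "\<forall>a. \<alpha> a \<in> tensor_sub aq UNIV S" "action_density_on aq \<alpha> S"
    "x \<in> S \<Longrightarrow> y \<in> S \<Longrightarrow> x * y = y * x"
proof -
  interpret quantum_group_action qq qq_q q_qq \<Delta> aq aq_q a_qq \<alpha> by (rule qga)
  have qq: "min_tensor qq" and aq: "min_tensor aq"
    using tensor_aqq by (simp_all add: triple_tensor_def)
  note rel = linear_action_relations[OF aq hom_action z]
  note \<Delta>A = linear_action_coproduct(1)[OF qga z] and \<Delta>B = linear_action_coproduct(2)[OF qga z]
  have zero': "B * star A = 0" "star B * A = 0"
    using arg_cong[OF rel(1), of star] arg_cong[OF rel(2), of star]
        by (simp_all add: star_mult star_star)
  have AB: "A * B = 0" "B * A = 0"
    using partial_isometry_relations_commute(1,2)[OF rel normal, of A A] by simp_all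
  then have AB': "star B * star A = 0" "star A * star B = 0" by (simp_all flip: star_mult)
  have one': "A * star A + star B * B = 1" "star A * A + B * star B = 1"
    using rel normal by simp_all
  note zeros = rel(1,2) zero' AB AB'
  have S: "unital_cstar_subalgebra S" unfolding S_def by (rule cstar_generated_subalgebra)
  note sub = unital_cstar_subalgebraD[OF S]
  have gens: "A \<in> S" "B \<in> S" "star A \<in> S" "star B \<in> S"
    using cstar_generated_superset[of "{A, B, star A, star B}"] unfolding S_def by auto
  have least: "S \<subseteq> W" if W: "unital_cstar_subalgebra W" "A \<in> W" "B \<in> W" for W
    unfolding S_def using unital_cstar_subalgebraD(6)[OF W(1)] W
        by (intro cstar_generated_least) auto
  show comm: "x * y = y * x" if "x \<in> S" "y \<in> S" for x y
  proof (rule cstar_generated_commute[of "{A, B, star A, star B}"])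
    show "star x \<in> {A, B, star A, star B}" if "x \<in> {A, B, star A, star B}" for x
      using that by (auto simp: star_star)
    show "x * y = y * x" if "x \<in> {A, B, star A, star B}" "y \<in> {A, B, star A, star B}" for x y
      by (rule partial_isometry_relations_commute(3)[OF rel normal that])
  qed (use that in \<open>simp_all add: S_def\<close>)
  note SS = tensor_sub_subalgebra[OF qq S S] and subSS = unital_cstar_subalgebraD[OF SS(1)]
  note UNIV = unital_cstar_subalgebra_UNIV
  note CS = tensor_sub_subalgebra[OF aq UNIV S] and subCS = unital_cstar_subalgebraD[OF CS(1)]
  note lin1 = clinear_mapD[OF min_tensorD(1)[OF qq]]
      and lin2 = clinear_mapD[OF min_tensorD(2)[OF qq]]
  note lina2 = clinear_mapD[OF min_tensorD(2)[OF aq]]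
  note tens = min_tensorD(3,4)[OF qq] and tensa = min_tensorD(3,4)[OF aq]
  note hom = unital_star_homD[OF hom_coproduct] and homa = unital_star_homD[OF hom_action]
  have "S \<subseteq> {q. \<Delta> q \<in> tensor_sub qq S S}"
  proof (rule least[OF vimage_subalgebra[OF hom_coproduct SS(1)]])
    show "A \<in> {q. \<Delta> q \<in> tensor_sub qq S S}" "B \<in> {q. \<Delta> q \<in> tensor_sub qq S S}"
      by (simp_all add: \<Delta>A \<Delta>B subSS(3) SS(2) gens)
  qed
  then show \<Delta>S: "\<forall>q\<in>S. \<Delta> q \<in> tensor_sub qq S S" by blast
  have "circle_z \<in> {a. \<alpha> a \<in> tensor_sub aq UNIV S}"
    by (simp add: z subCS(3) CS(2) gens)
  then have "a \<in> {a. \<alpha> a \<in> tensor_sub aq UNIV S}" for a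
    by (rule circle_generated[OF vimage_subalgebra[OF hom_action CS(1)]])
  then show \<alpha>S: "\<forall>a. \<alpha> a \<in> tensor_sub aq UNIV S" by blast
  have tensor_comm: "x * y = y * x" if "x \<in> tensor_sub qq S S" "y \<in> tensor_sub qq S S" for x y
    by (rule tensor_sub_commute[OF qq S S comm comm that])
  have "closure (cspan {qq a 1 * \<Delta> b |a b. a \<in> S \<and> b \<in> S}) = tensor_sub qq S S"
  proof (rule antisym)
    show "closure (cspan {qq a 1 * \<Delta> b |a b. a \<in> S \<and> b \<in> S}) \<subseteq> tensor_sub qq S S"
      using SS(2)[OF _ sub(2)] \<Delta>S by (intro closure_cspan_least SS(1)) (auto intro: subSS(4))
    have "\<forall>a\<in>S. \<forall>b\<in>S. qq a 1 * \<Delta> b = \<Delta> b * qq a 1"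
      using \<Delta>S SS(2) sub(2) by (intro ballI tensor_comm) auto
    note D = commuting_products_subalgebra[OF tensor_one_hom(1)[OF qq] hom_coproduct S S this]
    note subD = unital_cstar_subalgebraD[OF D(1)]
    have "qq (star A) 1 * \<Delta> A + qq (star B) 1 * \<Delta> B = qq (star A * A) A + qq (star B * B) A"
      by (simp add: \<Delta>A \<Delta>B distrib_left tens zeros lin1(4))
    also have "\<dots> = qq 1 A" by (simp only: lin1(1)[symmetric] rel(4))
    finally have "qq 1 A \<in> closure (cspan {qq a 1 * \<Delta> b |a b. a \<in> S \<and> b \<in> S})"
      by (rule subst) (intro subD(3,4) D(2,3) gens)
    moreover have "qq B 1 * \<Delta> A + qq A 1 * \<Delta> B = qq (B * star B) B + qq (A * star A) B"
      by (simp add: \<Delta>A \<Delta>B distrib_left tens zeros lin1(4))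
    then have "qq B 1 * \<Delta> A + qq A 1 * \<Delta> B = qq 1 B"
      by (simp only: lin1(1)[symmetric] rel(3) add.commute[of "B * star B"])
    then have "qq 1 B \<in> closure (cspan {qq a 1 * \<Delta> b |a b. a \<in> S \<and> b \<in> S})"
      by (rule subst) (intro subD(3,4) D(2,3) gens)
    ultimately have "S \<subseteq> {b. qq 1 b \<in> closure (cspan {qq a 1 * \<Delta> b |a b. a \<in> S \<and> b \<in> S})}"
      by (intro least[OF vimage_subalgebra[OF tensor_one_hom(2)[OF qq] D(1)]] CollectI)
    then show "tensor_sub qq S S \<subseteq> closure (cspan {qq a 1 * \<Delta> b |a b. a \<in> S \<and> b \<in> S})"
      by (intro tensor_sub_least[OF qq D(1)] D(2)) auto
  qed
  moreover have "closure (cspan {qq 1 a * \<Delta> b |a b. a \<in> S \<and> b \<in> S}) = tensor_sub qq S S"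
  proof (rule antisym)
    show "closure (cspan {qq 1 a * \<Delta> b |a b. a \<in> S \<and> b \<in> S}) \<subseteq> tensor_sub qq S S"
      using SS(2)[OF sub(2)] \<Delta>S by (intro closure_cspan_least SS(1)) (auto intro: subSS(4))
    have "\<forall>a\<in>S. \<forall>b\<in>S. qq 1 a * \<Delta> b = \<Delta> b * qq 1 a"
      using \<Delta>S SS(2) sub(2) by (intro ballI tensor_comm) auto
    note D = commuting_products_subalgebra[OF tensor_one_hom(2)[OF qq] hom_coproduct S S this]
    note subD = unital_cstar_subalgebraD[OF D(1)]
    have "\<Delta> A * qq 1 (star A) + \<Delta> (star B) * qq 1 B = qq A (A * star A) + qq A (star B * B)"
      by (simp add: \<Delta>A \<Delta>B hom(3) star_add star_star distrib_right tens zeros lin2(4))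
    also have "\<dots> = qq A 1" by (simp only: lin2(1)[symmetric] one'(1))
    finally have "qq A 1 \<in> closure (cspan {qq 1 a * \<Delta> b |a b. a \<in> S \<and> b \<in> S})"
      by (rule subst) (intro subD(3,4) D(2,3) gens)
    moreover have "\<Delta> B * qq 1 (star A) + \<Delta> (star A) * qq 1 B =
        qq B (A * star A) + qq B (star B * B)"
      by (simp add: \<Delta>A \<Delta>B hom(3) star_add star_star distrib_right tens zeros lin2(4))
    then have "\<Delta> B * qq 1 (star A) + \<Delta> (star A) * qq 1 B = qq B 1"
      by (simp only: lin2(1)[symmetric] one'(1))
    then have "qq B 1 \<in> closure (cspan {qq 1 a * \<Delta> b |a b. a \<in> S \<and> b \<in> S})"
      by (rule subst) (intro subD(3,4) D(2,3) gens)
    ultimately have "S \<subseteq> {b. qq b 1 \<in> closure (cspan {qq 1 a * \<Delta> b |a b. a \<in> S \<and> b \<in> S})}"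
      by (intro least[OF vimage_subalgebra[OF tensor_one_hom(1)[OF qq] D(1)]] CollectI)
    then show "tensor_sub qq S S \<subseteq> closure (cspan {qq 1 a * \<Delta> b |a b. a \<in> S \<and> b \<in> S})"
      by (intro tensor_sub_least[OF qq D(1)] D(2)) auto
  qed
  ultimately show "cancellation_on qq \<Delta> S" by (simp add: cancellation_on_def)
  have circle_comm: "a * a' = a' * a" for a a' :: "circle \<Rightarrow>\<^sub>C complex"
    by (intro bcontfun_eqI) (simp add: mult.commute)
  have "closure (cspan {\<alpha> a * aq 1 q |a q. a \<in> UNIV \<and> q \<in> S}) = tensor_sub aq UNIV S"
  proof (rule antisym)
    show "closure (cspan {\<alpha> a * aq 1 q |a q. a \<in> UNIV \<and> q \<in> S}) \<subseteq> tensor_sub aq UNIV S"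
      using CS(2)[of 1] \<alpha>S by (intro closure_cspan_least CS(1)) (auto intro: subCS(4))
    have "\<forall>a\<in>UNIV. \<forall>q\<in>S. \<alpha> a * aq 1 q = aq 1 q * \<alpha> a"
      using \<alpha>S CS(2) by (intro ballI tensor_sub_commute[OF aq UNIV S circle_comm comm]) auto
    note D = commuting_products_subalgebra[OF hom_action tensor_one_hom(2)[OF aq] UNIV S this]
    note subD = unital_cstar_subalgebraD[OF D(1)]
    have "\<alpha> circle_z * aq 1 (star A) + \<alpha> (star circle_z) * aq 1 B =
        aq circle_z (A * star A) + aq circle_z (star B * B)"
      by (simp add: z homa(3) star_add star_star distrib_right tensa zeros lina2(4))
    also have "\<dots> = aq circle_z 1" by (simp only: lina2(1)[symmetric] one'(1))
    finally have "aq circle_z 1 \<in> closure (cspan {\<alpha> a * aq 1 q |a q. a \<in> UNIV \<and> q \<in> S})"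
      by (rule subst) (intro subD(3,4) D(2,3) gens UNIV_I)
    then have "circle_z \<in> {a. aq a 1 \<in> closure (cspan {\<alpha> a * aq 1 q |a q. a \<in> UNIV \<and> q \<in> S})}"
      by (rule CollectI)
    then have "a \<in> {a. aq a 1 \<in> closure (cspan {\<alpha> a * aq 1 q |a q. a \<in> UNIV \<and> q \<in> S})}" for a
      by (rule circle_generated[OF vimage_subalgebra[OF tensor_one_hom(1)[OF aq] D(1)]])
    then show "tensor_sub aq UNIV S \<subseteq> closure (cspan {\<alpha> a * aq 1 q |a q. a \<in> UNIV \<and> q \<in> S})"
      by (intro tensor_sub_least[OF aq D(1)] D(3)) auto
  qed
  then show "action_density_on aq \<alpha> S" by (simp add: action_density_on_def)
qed

theorem theorem2p4:
  fixes qq :: "'q::cstar_algebra \<Rightarrow> 'q \<Rightarrow> 'qq::cstar_algebra"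
    and qq_q :: "'qq \<Rightarrow> 'q \<Rightarrow> 'qqq::cstar_algebra"
    and q_qq :: "'q \<Rightarrow> 'qq \<Rightarrow> 'qqq"
    and \<Delta> :: "'q \<Rightarrow> 'qq"
    and aq :: "(circle \<Rightarrow>\<^sub>C complex) \<Rightarrow> 'q \<Rightarrow> 'aq::cstar_algebra"
    and aq_q :: "'aq \<Rightarrow> 'q \<Rightarrow> 'aqq::cstar_algebra"
    and a_qq :: "(circle \<Rightarrow>\<^sub>C complex) \<Rightarrow> 'qq \<Rightarrow> 'aqq"
    and \<alpha> :: "(circle \<Rightarrow>\<^sub>C complex) \<Rightarrow> 'aq"
  assumes "compact_quantum_group qq qq_q q_qq \<Delta>"
    and "quantum_group_action qq qq_q q_qq \<Delta> aq aq_q a_qq \<alpha>"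
    and "faithful_action qq \<Delta> aq \<alpha>"
    and "smooth_circle_action aq \<alpha>"
    and "linear_circle_action aq \<alpha>"
  shows "\<forall>x y :: 'q. x * y = y * x"
proof -
  obtain A B where z: "\<alpha> circle_z = aq circle_z A + aq (star circle_z) B"
    using assms(5) unfolding linear_circle_action_def by blast
  have aq: "min_tensor aq" and hom: "unital_star_hom \<alpha>"
    using assms(2) by (simp_all add: quantum_group_action_def quantum_group_action_axioms_def
        triple_tensor_def)
  define S where "S = cstar_generated {A, B, star A, star B}"
  have "star A * A = A * star A"
    by (rule coefficient_normal[OF assms(1) linear_action_relations[OF aq hom z]
          linear_action_coproduct[OF assms(2) z]])
  note S = action_restricts_to_coefficients[OF assms(2) z this, folded S_def]
  have "S = UNIV"
    using assms(3) S(1-4) cstar_generated_subalgebra[of "{A, B, star A, star B}"]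
    unfolding faithful_action_def S_def by blast
  then show ?thesis using S(5) by simp
qed

end
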